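(* Let $R$ be a commutative ring and $X$ an indeterminate over $R$. The following conditions are equivalent (both with and without the word "weak" in (1) and in (2), so that all five resulting conditions are equivalent). (1) $R[X]$ is a (weak) strongly reduced unique factorization ring. (2) $R[X]$ is a (weak) reduced unique factorization ring. (3) $R$ is either a UFD or $R=D_1\times\cdots\times D_n$ where each $D_i$ is a UFD with $U(D_i)=\{1\}$.
   Context: All rings are commutative with identity $1\neq 0$; UFDs include fields. Let $A$ be a ring with unit group $U(A)$. For $a,b\in A$, $a\sim b$ means $Aa=Ab$. A nonunit $a\in A$ (possibly $0$) is irreducible (an atom) if $a=bc$ implies $a\sim b$ or $a\sim c$. $A$ is atomic if every nonzero nonunit is a finite product of atoms. A $\mu$-factorization of a nonunit $a\in A$ is a factorization $a=\lambda a_1\cdots a_n$ with $\lambda\in U(A)$ and each $a_i$ a nonunit; it is atomic if each $a_i$ is an atom. It is reduced if $\lambda a_1\cdots a_n\ne\lambda a_1\cdots\widehat{a_i}\cdots a_n$ for every $i$ (hat denotes omission), and strongly reduced if $\lambda a_1\cdots a_n\neq\lambda a_{i_1}\cdots a_{i_j}$ for every proper subset $\{i_1,\dots,i_j\}$ of $\{1,\dots,n\}$. $A$ is a reduced (resp., strongly reduced) unique factorization ring if (i) $A$ is atomic and (ii) for each nonunit $a\in A$, if $a=\lambda_1a_1\cdots a_n=\lambda_2b_1\cdots b_m$ are two reduced (resp., strongly reduced) atomic factorizations of $a$, then $n=m$ and, after reordering, $a_i\sim b_i$ for all $i$. The "weak" version requires (ii) only for nonzero nonunits $a$. *)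

theory Defs
  imports "HOL-Algebra.Algebra"
begin

definition assoc_elems :: "('a, 'm) ring_scheme \<Rightarrow> 'a \<Rightarrow> 'a \<Rightarrow> bool" where
  "assoc_elems A a b \<longleftrightarrow> PIdl\<^bsub>A\<^esub> a = PIdl\<^bsub>A\<^esub> b"

definition nonunits :: "('a, 'm) ring_scheme \<Rightarrow> 'a set" where
  "nonunits A = carrier A - Units A"

text \<open>
  In a ring with zero divisors this is weaker than the library notions of irreducibility (which ask
  one of the two factors to be a unit), and zero may be an atom.
\<close>

definition atom :: "('a, 'm) ring_scheme \<Rightarrow> 'a \<Rightarrow> bool" where
  "atom A a \<longleftrightarrow> a \<in> nonunits A \<and>
     (\<forall>b\<in>carrier A. \<forall>c\<in>carrier A. a = b \<otimes>\<^bsub>A\<^esub> c \<longrightarrow> assoc_elems A a b \<or> assoc_elems A a c)"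

definition atomic_ring :: "('a, 'm) ring_scheme \<Rightarrow> bool" where
  "atomic_ring A \<longleftrightarrow>
     (\<forall>a\<in>nonunits A - {\<zero>\<^bsub>A\<^esub>}. \<exists>(n::nat) f. (\<forall>i\<in>{1..n}. atom A (f i)) \<and> a = finprod A f {1..n})"

text \<open>
  \<open>mu_factorization A a u n f\<close> stands for the factorization
  \<open>a = u \<cdot> f 1 \<cdots> f n\<close>; the case \<open>n = 0\<close> cannot occur, since \<open>a\<close> is a nonunit.
\<close>

definition mu_factorization ::
  "('a, 'm) ring_scheme \<Rightarrow> 'a \<Rightarrow> 'a \<Rightarrow> nat \<Rightarrow> (nat \<Rightarrow> 'a) \<Rightarrow> bool" where
  "mu_factorization A a u n f \<longleftrightarrow>
     a \<in> nonunits A \<and> u \<in> Units A \<and> (\<forall>i\<in>{1..n}. f i \<in> nonunits A) \<and>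
     a = u \<otimes>\<^bsub>A\<^esub> finprod A f {1..n}"

definition atomic_factorization ::
  "('a, 'm) ring_scheme \<Rightarrow> 'a \<Rightarrow> 'a \<Rightarrow> nat \<Rightarrow> (nat \<Rightarrow> 'a) \<Rightarrow> bool" where
  "atomic_factorization A a u n f \<longleftrightarrow>
     mu_factorization A a u n f \<and> (\<forall>i\<in>{1..n}. atom A (f i))"

definition reduced_factorization ::
  "('a, 'm) ring_scheme \<Rightarrow> 'a \<Rightarrow> 'a \<Rightarrow> nat \<Rightarrow> (nat \<Rightarrow> 'a) \<Rightarrow> bool" where
  "reduced_factorization A a u n f \<longleftrightarrow>
     mu_factorization A a u n f \<and>
     (\<forall>i\<in>{1..n}. u \<otimes>\<^bsub>A\<^esub> finprod A f {1..n} \<noteq> u \<otimes>\<^bsub>A\<^esub> finprod A f ({1..n} - {i}))"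

definition strongly_reduced_factorization ::
  "('a, 'm) ring_scheme \<Rightarrow> 'a \<Rightarrow> 'a \<Rightarrow> nat \<Rightarrow> (nat \<Rightarrow> 'a) \<Rightarrow> bool" where
  "strongly_reduced_factorization A a u n f \<longleftrightarrow>
     mu_factorization A a u n f \<and>
     (\<forall>I. I \<subset> {1..n} \<longrightarrow> u \<otimes>\<^bsub>A\<^esub> finprod A f {1..n} \<noteq> u \<otimes>\<^bsub>A\<^esub> finprod A f I)"

definition same_up_to_order ::
  "('a, 'm) ring_scheme \<Rightarrow> nat \<Rightarrow> (nat \<Rightarrow> 'a) \<Rightarrow> nat \<Rightarrow> (nat \<Rightarrow> 'a) \<Rightarrow> bool" where
  "same_up_to_order A n f m g \<longleftrightarrow>
     n = m \<and> (\<exists>\<sigma>. bij_betw \<sigma> {1..n} {1..n} \<and> (\<forall>i\<in>{1..n}. assoc_elems A (f i) (g (\<sigma> i))))"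

definition reduced_ufr :: "('a, 'm) ring_scheme \<Rightarrow> bool" where
  "reduced_ufr A \<longleftrightarrow> atomic_ring A \<and>
     (\<forall>a\<in>nonunits A. \<forall>u v n m f g.
        atomic_factorization A a u n f \<and> reduced_factorization A a u n f \<and>
        atomic_factorization A a v m g \<and> reduced_factorization A a v m g
        \<longrightarrow> same_up_to_order A n f m g)"

definition weak_reduced_ufr :: "('a, 'm) ring_scheme \<Rightarrow> bool" where
  "weak_reduced_ufr A \<longleftrightarrow> atomic_ring A \<and>
     (\<forall>a\<in>nonunits A - {\<zero>\<^bsub>A\<^esub>}. \<forall>u v n m f g.
        atomic_factorization A a u n f \<and> reduced_factorization A a u n f \<and>
        atomic_factorization A a v m g \<and> reduced_factorization A a v m g
        \<longrightarrow> same_up_to_order A n f m g)"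

definition strongly_reduced_ufr :: "('a, 'm) ring_scheme \<Rightarrow> bool" where
  "strongly_reduced_ufr A \<longleftrightarrow> atomic_ring A \<and>
     (\<forall>a\<in>nonunits A. \<forall>u v n m f g.
        atomic_factorization A a u n f \<and> strongly_reduced_factorization A a u n f \<and>
        atomic_factorization A a v m g \<and> strongly_reduced_factorization A a v m g
        \<longrightarrow> same_up_to_order A n f m g)"

definition weak_strongly_reduced_ufr :: "('a, 'm) ring_scheme \<Rightarrow> bool" where
  "weak_strongly_reduced_ufr A \<longleftrightarrow> atomic_ring A \<and>
     (\<forall>a\<in>nonunits A - {\<zero>\<^bsub>A\<^esub>}. \<forall>u v n m f g.
        atomic_factorization A a u n f \<and> strongly_reduced_factorization A a u n f \<and>
        atomic_factorization A a v m g \<and> strongly_reduced_factorization A a v m g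
        \<longrightarrow> same_up_to_order A n f m g)"

text \<open>
  The equality of \<open>R\<close> with a direct product is read as a ring isomorphism. Taking the factors
  with carriers in the type of \<open>R\<close> loses no generality: each factor of a product isomorphic to
  \<open>R\<close> injects into \<open>R\<close> by padding with zeros, so it has an isomorphic copy in that type.
\<close>

definition ufd_product_with_trivial_units :: "('a, 'm) ring_scheme \<Rightarrow> bool" where
  "ufd_product_with_trivial_units R \<longleftrightarrow>
     (\<exists>Ds :: 'a ring list. Ds \<noteq> [] \<and>
        (\<forall>D\<in>set Ds. factorial_domain D \<and> Units D = {\<one>\<^bsub>D\<^esub>}) \<and>
        R \<simeq> RDirProd_list Ds)"

end

theory Submission
  imports Defs
begin

text \<open>
  Why the theorem holds. All four factoriality notions lie between the weakest one, the weak strongly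
  reduced one, and the strongest one, the reduced one. The condition on \<open>R\<close> says that it has a complete
  system of orthogonal idempotents \<open>e\<^sub>i\<close> whose corners \<open>e\<^sub>iR\<close> are factorial domains, with trivial units
  as soon as there are at least two of them (\<open>ufd_decomposition\<close>; the translation is
  \<open>ufd_decomposition_iff\<close>). By Gauss's lemma (\<open>factorial_UP\<close>) and its converse, such a system for
  \<open>R\<close> is the same as such a system, made of constants, for \<open>R[X]\<close> (\<open>ufd_decomposition_UP_iff\<close>).

  A ring with such a system is a reduced unique factorization ring (\<open>reduced_ufr\<close>): an atom has exactly
  one component that is not a unit. If that component of the factored element is nonzero, the number of
  associates of the atom in a factorization is a prime multiplicity; if it is zero, then in a reduced
  factorization a single factor lies in this component, and it is zero there.

  Conversely, suppose that \<open>R[X]\<close> has the weakest property. A factorization of a regular element is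
  always strongly reduced, so regular elements factor uniquely, and an atom that divides a regular
  product divides one of its factors (\<open>regular_atom_prime\<close>). A factorization of \<open>X\<close> into \<open>n\<close> atoms
  gives \<open>n\<close> orthogonal idempotents with sum 1: for \<open>fg = X\<close> the equations \<open>f\<^sub>0g\<^sub>0 = 0\<close> and
  \<open>f\<^sub>0g\<^sub>1 + f\<^sub>1g\<^sub>0 = 1\<close> make \<open>e = f\<^sub>1g\<^sub>0\<close> idempotent, and \<open>f\<close> is associated to \<open>y = eX + (1 - e)\<close>.
  If \<open>ab = 0\<close> in \<open>eR\<close>, then \<open>(y + a)(y + b) = y(y + a + b)\<close> is regular, so the atom \<open>y\<close> divides
  \<open>y + a\<close> or \<open>y + b\<close>, whence \<open>a = 0\<close> or \<open>b = 0\<close> (\<open>split_corner_domain\<close>). So \<open>R\<close>, and with it \<open>R[X]\<close>, is a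
  finite product of domains. Unique factorization of regular elements makes these domains factorial
  (\<open>corner_factorial_of_ufr\<close>). A nontrivial unit \<open>u\<close> in one of two components would give
  the factorization \<open>(1, 0) = (u, 0)(u\<inverse>, 0)\<close> of the atom \<open>(1, 0)\<close> (\<open>corner_units_of_ufr\<close>).
\<close>

section \<open>Factorial domains\<close>

lemma (in cring) Units_iff:
  "x \<in> Units R \<longleftrightarrow> x \<in> carrier R \<and> (\<exists>y\<in>carrier R. x \<otimes> y = \<one>)"
proof
  assume "x \<in> carrier R \<and> (\<exists>y\<in>carrier R. x \<otimes> y = \<one>)"
  then obtain y where "x \<in> carrier R" "y \<in> carrier R" "x \<otimes> y = \<one>" by blast
  then show "x \<in> Units R"
    using m_comm[of x y] unfolding Units_def by auto
qed (auto simp: Units_def)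

lemma (in domain) nat_pow_nonzero:
  assumes "x \<in> carrier R" "x \<noteq> \<zero>"
  shows "x [^] (n::nat) \<noteq> \<zero>"
  using assms by (induction n) (simp_all add: integral_iff)

lemma (in domain) mult_of_irreducible_iff:
  assumes "p \<in> carrier R - {\<zero>}"
  shows "irreducible (mult_of R) p \<longleftrightarrow> ring_irreducible p"
  using assms ring_irreducibleI' ring_irreducibleE(3) by blast

lemma (in domain) mult_of_prime_iff:
  assumes "p \<in> carrier R - {\<zero>}"
  shows "prime (mult_of R) p \<longleftrightarrow> ring_prime p"
  using assms ring_primeI' ring_primeE(2) by blast

lemma (in domain) primeness_mult_of:
  assumes "\<And>p. p \<in> carrier R \<Longrightarrow> ring_irreducible p \<Longrightarrow> ring_prime p"
  shows "primeness_condition_monoid (mult_of R)"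
proof -
  have "\<And>p. p \<in> carrier (mult_of R) \<Longrightarrow> irreducible (mult_of R) p \<Longrightarrow> prime (mult_of R) p"
    using assms mult_of_irreducible_iff mult_of_prime_iff by simp
  then show ?thesis
    using mult_of.comm_monoid_cancel_axioms
    by (simp add: primeness_condition_monoid_def primeness_condition_monoid_axioms_def)
qed

text \<open>Proper divisibility between nonzero elements, well-founded in a factorial domain.\<close>

abbreviation proper_factors :: "('a, 'm) ring_scheme \<Rightarrow> ('a \<times> 'a) set" where
  "proper_factors A \<equiv> {(x, y). x \<in> carrier A - {\<zero>\<^bsub>A\<^esub>} \<and> y \<in> carrier A - {\<zero>\<^bsub>A\<^esub>} \<and>
    properfactor (mult_of A) x y}"

lemma (in domain) factorial_domainI_wf:
  assumes "wf (proper_factors R)"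
    and "\<And>p. p \<in> carrier R \<Longrightarrow> ring_irreducible p \<Longrightarrow> ring_prime p"
  shows "factorial_domain R"
proof -
  have "divisor_chain_condition_monoid (mult_of R)"
    using assms(1) mult_of.comm_monoid_cancel_axioms
    by (simp add: divisor_chain_condition_monoid_def divisor_chain_condition_monoid_axioms_def)
  then have "factorial_monoid (mult_of R)"
    using primeness_mult_of[OF assms(2)] factorial_condition_one by blast
  then show ?thesis
    by (simp add: factorial_domain_def domain_axioms)
qed

lemma (in factorial_domain) ring_irreducible_imp_prime:
  assumes "p \<in> carrier R" "ring_irreducible p"
  shows "ring_prime p"
proof -
  have p: "p \<in> carrier R - {\<zero>}" using assms ring_irreducibleE(1) by simp
  then have "prime (mult_of R) p"
    using factorial_monoid.irreducible_prime[OF factorial_monoid_axioms, of p]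
      mult_of_irreducible_iff[OF p] assms(2) by simp
  then show ?thesis using mult_of_prime_iff[OF p] by simp
qed

lemma (in factorial_domain) wf_properfactor:
  "wf (proper_factors R)"
  using factorial_condition_one[of "mult_of R"] factorial_monoid_axioms
  by (auto simp: divisor_chain_condition_monoid_def divisor_chain_condition_monoid_axioms_def)

lemma (in domain) factorial_domainI_atomic:
  assumes "\<And>x. x \<in> carrier R - {\<zero>} \<Longrightarrow>
      \<exists>fs. set fs \<subseteq> {p \<in> carrier R. ring_irreducible p} \<and> foldr (\<otimes>) fs \<one> \<sim> x"
    and "\<And>p. p \<in> carrier R \<Longrightarrow> ring_irreducible p \<Longrightarrow> ring_prime p"
  shows "factorial_domain R"
proof -
  interpret pc: primeness_condition_monoid "mult_of R"
    using primeness_mult_of[OF assms(2)] .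
  have "factorial_monoid (mult_of R)"
  proof (rule mult_of.factorial_monoidI)
    fix a assume a: "a \<in> carrier (mult_of R)"
    then obtain fs where fs: "set fs \<subseteq> {p \<in> carrier R. ring_irreducible p}" "foldr (\<otimes>) fs \<one> \<sim> a"
      using assms(1) by auto
    have sub: "set fs \<subseteq> carrier (mult_of R)"
      using fs(1) by (auto simp: ring_irreducible_def)
    have "foldr (\<otimes>) fs \<one> \<in> carrier (mult_of R)"
      using mult_of.multlist_closed[OF sub] by simp
    then have "foldr (\<otimes>) fs \<one> \<sim>\<^bsub>mult_of R\<^esub> a"
      using fs(2) a assoc_iff_assoc_mult by simp
    moreover have "\<forall>f\<in>set fs. irreducible (mult_of R) f"
      using fs(1) by (auto intro: ring_irreducibleE(3))
    ultimately show "\<exists>fs. set fs \<subseteq> carrier (mult_of R) \<and> wfactors (mult_of R) fs a"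
      using sub by (auto simp: wfactors_def)
  next
    fix a fs fs'
    assume "a \<in> carrier (mult_of R)" "set fs \<subseteq> carrier (mult_of R)" "set fs' \<subseteq> carrier (mult_of R)"
      "wfactors (mult_of R) fs a" "wfactors (mult_of R) fs' a"
    then show "essentially_equal (mult_of R) fs fs'"
      using pc.wfactors_unique by blast
  qed
  then show ?thesis
    by (simp add: factorial_domain_def domain_axioms)
qed

text \<open>Induction on the number of prime factors of a nonzero element.\<close>

lemma (in factorial_domain) factorial_induct [consumes 2, case_names unit prime]:
  assumes "c \<in> carrier R" "c \<noteq> \<zero>"
    and unit: "\<And>u. u \<in> Units R \<Longrightarrow> Q u"
    and prime: "\<And>p c. p \<in> carrier R \<Longrightarrow> ring_prime p \<Longrightarrow> ring_irreducible p \<Longrightarrow>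
      c \<in> carrier R \<Longrightarrow> c \<noteq> \<zero> \<Longrightarrow> Q c \<Longrightarrow> Q (p \<otimes> c)"
  shows "Q c"
proof -
  have *: "Q (foldr (\<otimes>) fs \<one> \<otimes> u)"
    if "u \<in> Units R" "set fs \<subseteq> {p \<in> carrier R. ring_irreducible p}" for fs u
    using that(2)
  proof (induction fs)
    case Nil
    then show ?case using that(1) unit by simp
  next
    case (Cons p fs)
    let ?d = "foldr (\<otimes>) fs \<one>"
    have sub: "set fs \<subseteq> carrier (mult_of R)"
      using Cons.prems by (auto simp: ring_irreducible_def)
    have d: "?d \<in> carrier R" "?d \<noteq> \<zero>"
      using mult_of.multlist_closed[OF sub] by simp_all
    have u: "u \<in> carrier R" "u \<noteq> \<zero>"
      using that(1) by (auto simp: Units_def)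
    have p: "p \<in> carrier R" "ring_irreducible p" "ring_prime p"
      using Cons.prems ring_irreducible_imp_prime by auto
    have "Q (p \<otimes> (?d \<otimes> u))"
      using prime[OF p(1,3,2), of "?d \<otimes> u"] d u Cons by (simp add: integral_iff)
    then show ?case
      using p d u by (simp add: m_assoc)
  qed
  obtain fs where fs: "set fs \<subseteq> carrier (mult_of R)" "wfactors (mult_of R) fs c"
    using factorial_monoid.wfactors_exist[OF factorial_monoid_axioms, of c] assms by auto
  have irr: "set fs \<subseteq> {p \<in> carrier R. ring_irreducible p}"
    using fs mult_of_irreducible_iff by (auto simp: wfactors_def)
  have fold: "foldr (\<otimes>) fs \<one> \<in> carrier R"
    using mult_of.multlist_closed[OF fs(1)] by simp
  have "foldr (\<otimes>) fs \<one> \<sim>\<^bsub>mult_of R\<^esub> c"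
    using fs(2) by (simp add: wfactors_def)
  then have "c \<sim> foldr (\<otimes>) fs \<one>"
    using assoc_iff_assoc_mult[OF fold assms(1)] associated_sym by blast
  then obtain u where "u \<in> Units R" "c = u \<otimes> foldr (\<otimes>) fs \<one>"
    using ring_associated_iff[OF assms(1) fold] by blast
  then show ?thesis
    using *[OF _ irr, of u] fold by (simp add: m_comm Units_closed)
qed

section \<open>Gauss's lemma without fractions\<close>

text \<open>Coefficients, products and constants in the polynomial ring \<open>P\<close> over \<open>R\<close>.\<close>

context UP
begin

abbreviation cf :: "(nat \<Rightarrow> 'a) \<Rightarrow> nat \<Rightarrow> 'a" where "cf \<equiv> up_ring.coeff P"
abbreviation const :: "'a \<Rightarrow> nat \<Rightarrow> 'a" where "const a \<equiv> up_ring.monom P a 0"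
abbreviation times :: "(nat \<Rightarrow> 'a) \<Rightarrow> (nat \<Rightarrow> 'a) \<Rightarrow> nat \<Rightarrow> 'a" (infixl \<open>\<cdot>\<close> 70)
  where "p \<cdot> q \<equiv> p \<otimes>\<^bsub>P\<^esub> q"

end

context UP_cring
begin

lemma const_mult: "a \<in> carrier R \<Longrightarrow> b \<in> carrier R \<Longrightarrow>
  const a \<cdot> const b = const (a \<otimes> b)"
  by (metis R.m_closed add.right_neutral monom_mult)

lemma const_divides_iff:
  assumes "a \<in> carrier R" "f \<in> carrier P"
  shows "const a divides\<^bsub>P\<^esub> f \<longleftrightarrow> (\<forall>i. a divides cf f i)"
proof
  assume "const a divides\<^bsub>P\<^esub> f"
  then obtain g where g: "g \<in> carrier P" "f = a \<odot>\<^bsub>P\<^esub> g"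
    using assms monom_mult_is_smult by (auto simp: factor_def)
  then show "\<forall>i. a divides cf f i"
    using assms by (auto simp: factor_def)
next
  assume *: "\<forall>i. a divides cf f i"
  then have "\<forall>i. \<exists>c. c \<in> carrier R \<and> cf f i = a \<otimes> c"
    by (auto simp: factor_def)
  then obtain c where c: "\<And>i. c i \<in> carrier R" "\<And>i. cf f i = a \<otimes> c i"
    by metis
  define g where "g i = (if cf f i = \<zero> then \<zero> else c i)" for i
  have "bound \<zero> (deg R f) g"
    by (rule bound.intro) (use assms in \<open>simp add: g_def deg_aboveD\<close>)
  then have up: "g \<in> up R"
    using c by (intro mem_upI) (auto simp: g_def)
  then have g: "g \<in> carrier P" "\<And>i. cf g i = g i"
    unfolding P_def UP_def by simp_all
  have "f = a \<odot>\<^bsub>P\<^esub> g"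
  proof (rule up_eqI)
    show "cf f n = cf (a \<odot>\<^bsub>P\<^esub> g) n" for n
      using g c assms by (auto simp: g_def)
  qed (use assms g in auto)
  then show "const a divides\<^bsub>P\<^esub> f"
    using g assms monom_mult_is_smult by (auto simp: factor_def)
qed

end

lemma (in ideal) finsum_mem:
  assumes "finite A" "f \<in> A \<rightarrow> I"
  shows "finsum R f A \<in> I"
  using assms
proof (induction A rule: finite_induct)
  case (insert x A)
  then have "f \<in> A \<rightarrow> carrier R" "f x \<in> carrier R"
    by (auto intro: Icarr)
  with insert show ?case
    by (simp add: a_closed)
qed (simp add: additive_subgroup.zero_closed is_additive_subgroup)

lemma (in cring) mem_PIdl_iff:
  assumes "a \<in> carrier R"
  shows "x \<in> PIdl a \<longleftrightarrow> a divides x"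
  using assms m_comm by (auto simp: cgenideal_def factor_def)

lemma (in ideal) cancel_add_mem:
  assumes "x \<in> carrier R" "y \<in> I" "x \<oplus> y \<in> I"
  shows "x \<in> I"
proof -
  have "x = (x \<oplus> y) \<oplus> \<ominus> y"
    using assms Icarr by (simp add: a_assoc r_neg)
  moreover have "\<ominus> y \<in> I"
    using assms by (simp add: a_inv_closed)
  ultimately show ?thesis
    using assms(3) additive_subgroup.a_closed[OF is_additive_subgroup] by metis
qed

context UP_domain
begin

lemma coeff_prime_divides:
  assumes p: "p \<in> carrier R" "ring_prime p"
    and f: "f \<in> carrier P" and g: "g \<in> carrier P"
    and dvd: "\<And>k. p divides cf (f \<cdot> g) k"
  shows "(\<forall>i. p divides cf f i) \<or> (\<forall>j. p divides cf g j)"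
proof (rule ccontr)
  assume "\<not> ?thesis"
  then obtain i0 j0 where "\<not> p divides cf f i0" "\<not> p divides cf g j0" by blast
  \<comment> \<open>Of the products that make up the coefficient at \<open>i + j\<close>, only the one of the coefficients at
    \<open>i\<close> and \<open>j\<close> is not divisible by \<open>p\<close>.\<close>
  define i where "i = (LEAST i. \<not> p divides cf f i)"
  define j where "j = (LEAST j. \<not> p divides cf g j)"
  have i: "\<not> p divides cf f i" "\<And>k. k < i \<Longrightarrow> p divides cf f k"
    unfolding i_def using \<open>\<not> p divides cf f i0\<close> by (rule LeastI) (use not_less_Least in blast)
  have j: "\<not> p divides cf g j" "\<And>k. k < j \<Longrightarrow> p divides cf g k"
    unfolding j_def using \<open>\<not> p divides cf g j0\<close> by (rule LeastI) (use not_less_Least in blast)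
  interpret I: ideal "PIdl p" R
    using p(1) by (rule R.cgenideal_ideal)
  let ?t = "\<lambda>k. cf f k \<otimes> cf g (i + j - k)"
  have split: "{..i + j} = insert i ({..i + j} - {i})" by auto
  have "cf (f \<cdot> g) (i + j) = (\<Oplus>k\<in>insert i ({..i + j} - {i}). ?t k)"
    using f g split by simp
  also have "\<dots> = ?t i \<oplus> (\<Oplus>k\<in>{..i + j} - {i}. ?t k)"
    using f g by (subst R.finsum_insert) auto
  finally have eq: "cf (f \<cdot> g) (i + j) = ?t i \<oplus> (\<Oplus>k\<in>{..i + j} - {i}. ?t k)" .
  have rest: "(\<Oplus>k\<in>{..i + j} - {i}. ?t k) \<in> PIdl p"
  proof (rule I.finsum_mem)
    show "?t \<in> {..i + j} - {i} \<rightarrow> PIdl p"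
    proof
      fix k assume k: "k \<in> {..i + j} - {i}"
      show "?t k \<in> PIdl p"
      proof (cases "k < i")
        case True
        then show ?thesis using i(2) f g p I.I_r_closed R.mem_PIdl_iff by simp
      next
        case False
        then have "i + j - k < j" using k by auto
        then show ?thesis using j(2) f g p I.I_l_closed R.mem_PIdl_iff by simp
      qed
    qed
  qed simp
  have "?t i \<in> PIdl p"
  proof (rule I.cancel_add_mem[OF _ rest])
    show "?t i \<oplus> (\<Oplus>k\<in>{..i + j} - {i}. ?t k) \<in> PIdl p"
      using dvd[of "i + j"] unfolding eq R.mem_PIdl_iff[OF p(1)] .
  qed (use f g in simp)
  then have "p divides (cf f i \<otimes> cf g j)"
    using R.mem_PIdl_iff p by simp
  then have "p divides cf f i \<or> p divides cf g j"
    using R.ring_primeE(3)[OF p] coeff_closed[OF f] coeff_closed[OF g] unfolding prime_def by blast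
  then show False using i(1) j(1) by blast
qed

lemma const_Units_iff:
  assumes "f \<in> carrier P"
  shows "f \<in> Units P \<longleftrightarrow> (\<exists>u\<in>Units R. f = const u)"
proof
  assume f: "f \<in> Units P"
  then obtain g where g: "g \<in> carrier P" "f \<cdot> g = \<one>\<^bsub>P\<^esub>"
    by (auto simp: Units_def)
  have "f \<noteq> \<zero>\<^bsub>P\<^esub>" "g \<noteq> \<zero>\<^bsub>P\<^esub>"
    using g assms by auto
  then have "deg R f + deg R g = 0"
    using deg_mult[of f g] g assms by simp
  then have d: "f = const (cf f 0)" "g = const (cf g 0)"
    using deg_zero_impl_monom assms g by auto
  have "const (cf f 0 \<otimes> cf g 0) = const \<one>"
    using const_mult[of "cf f 0" "cf g 0"] d g assms by simp
  then have "cf f 0 \<otimes> cf g 0 = \<one>"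
    using monom_inj[of 0] assms g by (auto simp: inj_on_def)
  then have "cf f 0 \<in> Units R"
    using assms g R.unit_factor by (metis R.Units_one_closed coeff_closed)
  then show "\<exists>u\<in>Units R. f = const u" using d by blast
next
  assume "\<exists>u\<in>Units R. f = const u"
  then obtain u where u: "u \<in> Units R" "f = const u" by blast
  then have "f \<cdot> const (inv u) = \<one>\<^bsub>P\<^esub>"
    using const_mult[of u "inv u"] R.Units_closed by simp
  then show "f \<in> Units P"
    using u assms P.Units_iff R.Units_inv_closed monom_closed by blast
qed

lemma const_prime:
  assumes p: "p \<in> carrier R" "ring_prime p"
  shows "ring_prime\<^bsub>P\<^esub> (const p)"
proof (rule P.ring_primeI)
  show "const p \<noteq> \<zero>\<^bsub>P\<^esub>"
  proof
    assume "const p = \<zero>\<^bsub>P\<^esub>"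
    then have "const p = const \<zero>" by simp
    then show False using monom_inj[of 0] p by (auto simp: inj_on_def ring_prime_def)
  qed
  show "prime P (const p)"
  proof (rule primeI)
    show "const p \<notin> Units P"
    proof
      assume "const p \<in> Units P"
      then obtain u where "u \<in> Units R" "const p = const u"
        using const_Units_iff p by auto
      then have "p \<in> Units R"
        using monom_inj[of 0] p by (auto simp: inj_on_def)
      then show False using p by (auto simp: ring_prime_def prime_def)
    qed
    fix f g assume fg: "f \<in> carrier P" "g \<in> carrier P" "const p divides\<^bsub>P\<^esub> f \<cdot> g"
    then show "const p divides\<^bsub>P\<^esub> f \<or> const p divides\<^bsub>P\<^esub> g"
      using coeff_prime_divides[OF p fg(1,2)] p const_divides_iff by auto
  qed
qed

end

locale UP_factorial = UP + R?: factorial_domain R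

sublocale UP_factorial < UP_domain
  by intro_locales [1] (rule P_def)

context UP_domain
begin

lemmas UP_ring_irreducibleE = domain.ring_irreducibleE[OF UP_domain]
lemmas UP_ring_irreducibleI = domain.ring_irreducibleI[OF UP_domain]
lemmas UP_divides_imp_divides_mult = domain.divides_imp_divides_mult[OF UP_domain]
lemmas UP_factorial_domainI_wf = domain.factorial_domainI_wf[OF UP_domain]

lemma smult_prime_cancel:
  assumes p: "p \<in> carrier R" "p \<noteq> \<zero>" and f: "f \<in> carrier P" and g: "g \<in> carrier P"
    and eq: "p \<odot>\<^bsub>P\<^esub> f = p \<odot>\<^bsub>P\<^esub> g"
  shows "f = g"
proof (rule up_eqI)
  fix n
  have "p \<otimes> cf f n = p \<otimes> cf g n"
    using eq p f g by (metis coeff_smult)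
  then show "cf f n = cf g n"
    using p f g R.m_lcancel by simp
qed (use f g in auto)

end

context UP_factorial
begin

lemma smult_divides:
  assumes "p \<in> carrier R" "f \<in> carrier P" "\<And>i. p divides cf f i"
  obtains g where "g \<in> carrier P" "f = p \<odot>\<^bsub>P\<^esub> g"
proof -
  have "const p divides\<^bsub>P\<^esub> f"
    using assms const_divides_iff by blast
  then show thesis
    using that assms monom_mult_is_smult by (auto simp: factor_def)
qed

text \<open>
  The substitute for the field of fractions: a constant factor of a product of two polynomials
  can be split into constant factors of the two.
\<close>

lemma split_constant_factor:
  assumes "c \<in> carrier R" "c \<noteq> \<zero>"
  shows "\<forall>f q d. f \<in> carrier P \<longrightarrow> q \<in> carrier P \<longrightarrow> d \<in> carrier P \<longrightarrow> c \<odot>\<^bsub>P\<^esub> f = q \<cdot> d \<longrightarrow>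
    (\<exists>a b q' d'. a \<in> carrier R - {\<zero>} \<and> b \<in> carrier R - {\<zero>} \<and> q' \<in> carrier P \<and> d' \<in> carrier P \<and>
      d = a \<odot>\<^bsub>P\<^esub> d' \<and> q = b \<odot>\<^bsub>P\<^esub> q' \<and> f = q' \<cdot> d')"
  using assms
proof (induction c rule: factorial_induct)
  case (unit u)
  show ?case
  proof (intro allI impI)
    fix f q d
    assume *: "f \<in> carrier P" "q \<in> carrier P" "d \<in> carrier P" "u \<odot>\<^bsub>P\<^esub> f = q \<cdot> d"
    have u: "u \<in> carrier R" "inv u \<in> carrier R" "u \<noteq> \<zero>"
      using unit by (auto simp: Units_def)
    have "f = inv u \<odot>\<^bsub>P\<^esub> (u \<odot>\<^bsub>P\<^esub> f)"
      using u * UP_smult_assoc1[of "inv u" u f] unit by simp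
    also have "\<dots> = (inv u \<odot>\<^bsub>P\<^esub> q) \<cdot> d"
      using u * UP_smult_assoc2[of "inv u" q d] by simp
    finally have "f = (inv u \<odot>\<^bsub>P\<^esub> q) \<cdot> d" .
    moreover have "q = u \<odot>\<^bsub>P\<^esub> (inv u \<odot>\<^bsub>P\<^esub> q)"
      using u * UP_smult_assoc1[of u "inv u" q] unit by simp
    moreover have "d = \<one> \<odot>\<^bsub>P\<^esub> d" using * by simp
    ultimately show "\<exists>a b q' d'. a \<in> carrier R - {\<zero>} \<and> b \<in> carrier R - {\<zero>} \<and> q' \<in> carrier P \<and>
      d' \<in> carrier P \<and> d = a \<odot>\<^bsub>P\<^esub> d' \<and> q = b \<odot>\<^bsub>P\<^esub> q' \<and> f = q' \<cdot> d'"
      using u * by (intro exI[of _ \<one>] exI[of _ u] exI[of _ "inv u \<odot>\<^bsub>P\<^esub> q"] exI[of _ d]) auto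
  qed
next
  case (prime p c)
  show ?case
  proof (intro allI impI)
    fix f q d
    assume *: "f \<in> carrier P" "q \<in> carrier P" "d \<in> carrier P" "(p \<otimes> c) \<odot>\<^bsub>P\<^esub> f = q \<cdot> d"
    have p0: "p \<noteq> \<zero>" using prime.hyps by (simp add: ring_prime_def)
    have eq: "q \<cdot> d = p \<odot>\<^bsub>P\<^esub> (c \<odot>\<^bsub>P\<^esub> f)"
      using *(1,4) prime.hyps UP_smult_assoc1[of p c f] by simp
    have "\<And>k. p divides cf (q \<cdot> d) k"
      unfolding eq using prime.hyps * by (auto simp: factor_def simp del: coeff_mult)
    then consider "\<And>k. p divides cf q k" | "\<And>k. p divides cf d k"
      using coeff_prime_divides[OF prime.hyps(1,2) *(2,3)] by blast
    then show "\<exists>a b q' d'. a \<in> carrier R - {\<zero>} \<and> b \<in> carrier R - {\<zero>} \<and> q' \<in> carrier P \<and>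
      d' \<in> carrier P \<and> d = a \<odot>\<^bsub>P\<^esub> d' \<and> q = b \<odot>\<^bsub>P\<^esub> q' \<and> f = q' \<cdot> d'"
    proof cases
      case 1
      obtain q1 where q1: "q1 \<in> carrier P" "q = p \<odot>\<^bsub>P\<^esub> q1"
        by (rule smult_divides[OF prime.hyps(1) *(2) 1])
      have "p \<odot>\<^bsub>P\<^esub> (c \<odot>\<^bsub>P\<^esub> f) = p \<odot>\<^bsub>P\<^esub> (q1 \<cdot> d)"
        using eq q1 * prime.hyps UP_smult_assoc2 by simp
      then have ceq: "c \<odot>\<^bsub>P\<^esub> f = q1 \<cdot> d"
        by (rule smult_prime_cancel[OF prime.hyps(1) p0, rotated 2]) (use prime.hyps * q1 in simp_all)
      obtain a b q' d' where h: "a \<in> carrier R - {\<zero>}" "b \<in> carrier R - {\<zero>}" "q' \<in> carrier P"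
        "d' \<in> carrier P" "d = a \<odot>\<^bsub>P\<^esub> d'" "q1 = b \<odot>\<^bsub>P\<^esub> q'" "f = q' \<cdot> d'"
        using prime.IH[rule_format, OF *(1) q1(1) *(3) ceq] by (elim exE conjE) (rule that)
      have "q = (p \<otimes> b) \<odot>\<^bsub>P\<^esub> q'"
        using h q1 prime.hyps UP_smult_assoc1[of p b q'] by simp
      moreover have "p \<otimes> b \<in> carrier R - {\<zero>}"
        using h prime.hyps p0 by (simp add: R.integral_iff)
      ultimately show ?thesis using h by (intro exI conjI)
    next
      case 2
      obtain d1 where d1: "d1 \<in> carrier P" "d = p \<odot>\<^bsub>P\<^esub> d1"
        by (rule smult_divides[OF prime.hyps(1) *(3) 2])
      have "p \<odot>\<^bsub>P\<^esub> (c \<odot>\<^bsub>P\<^esub> f) = p \<odot>\<^bsub>P\<^esub> (d1 \<cdot> q)"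
        using eq d1 * prime.hyps UP_smult_assoc2[of p d1 q] P.m_comm[of q d] by simp
      then have ceq: "c \<odot>\<^bsub>P\<^esub> f = q \<cdot> d1"
        using smult_prime_cancel[OF prime.hyps(1) p0, of "c \<odot>\<^bsub>P\<^esub> f" "d1 \<cdot> q"]
          prime.hyps(3,4) *(1,2) d1(1) P.m_comm[OF *(2) d1(1)] by simp
      obtain a b q' d' where h: "a \<in> carrier R - {\<zero>}" "b \<in> carrier R - {\<zero>}" "q' \<in> carrier P"
        "d' \<in> carrier P" "d1 = a \<odot>\<^bsub>P\<^esub> d'" "q = b \<odot>\<^bsub>P\<^esub> q'" "f = q' \<cdot> d'"
        using prime.IH[rule_format, OF *(1,2) d1(1) ceq] by (elim exE conjE) (rule that)
      have "d = (p \<otimes> a) \<odot>\<^bsub>P\<^esub> d'"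
        using h d1 prime.hyps UP_smult_assoc1[of p a d'] by simp
      moreover have "p \<otimes> a \<in> carrier R - {\<zero>}"
        using h prime.hyps p0 by (simp add: R.integral_iff)
      ultimately show ?thesis using h by (intro exI conjI)
    qed
  qed
qed

text \<open>
  An irreducible polynomial of positive degree has no nonunit constant factor, so constants can be
  cancelled from its multiples.
\<close>

lemma irreducible_divides_smult:
  assumes f: "f \<in> carrier P" "ring_irreducible\<^bsub>P\<^esub> f" "deg R f > 0"
    and c: "c \<in> carrier R" "c \<noteq> \<zero>" and g: "g \<in> carrier P"
    and dvd: "f divides\<^bsub>P\<^esub> (c \<odot>\<^bsub>P\<^esub> g)"
  shows "f divides\<^bsub>P\<^esub> g"
proof -
  obtain q where q: "q \<in> carrier P" "c \<odot>\<^bsub>P\<^esub> g = f \<cdot> q"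
    using dvd by (auto simp: factor_def)
  obtain a b q' f' where h: "a \<in> carrier R - {\<zero>}" "b \<in> carrier R - {\<zero>}" "f' \<in> carrier P"
    "q' \<in> carrier P" "f = b \<odot>\<^bsub>P\<^esub> f'" "g = f' \<cdot> q'"
    using split_constant_factor[OF c, rule_format, OF g f(1) q] by (elim exE conjE) (rule that)
  have fm: "f = const b \<cdot> f'"
    using h monom_mult_is_smult by simp
  have "const b \<in> Units P \<or> f' \<in> Units P"
    using UP_ring_irreducibleE(5)[OF f(1,2) _ h(3) fm] h by simp
  moreover have "f' \<notin> Units P"
  proof
    assume "f' \<in> Units P"
    then obtain u where "u \<in> Units R" "f' = const u"
      using const_Units_iff h by blast
    then have "f = const (b \<otimes> u)"
      using fm h const_mult R.Units_closed by simp
    then show False using f(3) h \<open>u \<in> Units R\<close> R.Units_closed by simp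
  qed
  ultimately have "const b \<in> Units P" by blast
  then obtain v where v: "v \<in> carrier P" "const b \<cdot> v = \<one>\<^bsub>P\<^esub>"
    using P.Units_iff by blast
  have mb: "const b \<in> carrier P" using h by simp
  have "f \<cdot> (v \<cdot> q') = (const b \<cdot> v) \<cdot> (f' \<cdot> q')"
    using fm h v mb by (simp add: P.m_ac)
  then have "g = f \<cdot> (v \<cdot> q')"
    using h v g by simp
  then show ?thesis using v h by (auto simp: factor_def)
qed

text \<open>
  Let \<open>f\<close> divide \<open>gh\<close>. Pseudo-division makes an element \<open>d\<close> of least degree in the ideal generated by
  \<open>f\<close> and \<open>g\<close> divide both of them, up to constants. As \<open>f\<close> is irreducible, \<open>d\<close> is either a constant
  multiple of \<open>f\<close>, and then \<open>f\<close> divides \<open>g\<close>, or a constant, and then \<open>f\<close> divides a constant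
  multiple of \<open>h\<close>.
\<close>

lemma irreducible_pos_deg_prime:
  assumes f: "f \<in> carrier P" "ring_irreducible\<^bsub>P\<^esub> f" "deg R f > 0"
  shows "ring_prime\<^bsub>P\<^esub> f"
proof (rule P.ring_primeI)
  show f0: "f \<noteq> \<zero>\<^bsub>P\<^esub>" using f(2) by (simp add: ring_irreducible_def)
  show "prime P f"
  proof (rule primeI)
    show "f \<notin> Units P" using UP_ring_irreducibleE(4)[OF f(1,2)] .
    fix g h assume gh: "g \<in> carrier P" "h \<in> carrier P" "f divides\<^bsub>P\<^esub> g \<cdot> h"
    define J where "J = {x. \<exists>s\<in>carrier P. \<exists>t\<in>carrier P. x = s \<cdot> f \<oplus>\<^bsub>P\<^esub> t \<cdot> g}"
    have Jc: "x \<in> carrier P" if "x \<in> J" for x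
      using that f gh by (auto simp: J_def)
    have "f = \<one>\<^bsub>P\<^esub> \<cdot> f \<oplus>\<^bsub>P\<^esub> \<zero>\<^bsub>P\<^esub> \<cdot> g" using f(1) gh(1) by simp
    then have fJ: "f \<in> J" unfolding J_def by blast
    have "g = \<zero>\<^bsub>P\<^esub> \<cdot> f \<oplus>\<^bsub>P\<^esub> \<one>\<^bsub>P\<^esub> \<cdot> g" using f(1) gh(1) by simp
    then have gJ: "g \<in> J" unfolding J_def by blast
    define d where "d = arg_min (deg R) (\<lambda>x. x \<in> J \<and> x \<noteq> \<zero>\<^bsub>P\<^esub>)"
    have d: "d \<in> J" "d \<noteq> \<zero>\<^bsub>P\<^esub>" "\<And>x. x \<in> J \<Longrightarrow> x \<noteq> \<zero>\<^bsub>P\<^esub> \<Longrightarrow> deg R d \<le> deg R x"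
      using arg_min_natI[of "\<lambda>x. x \<in> J \<and> x \<noteq> \<zero>\<^bsub>P\<^esub>" f "deg R"]
        arg_min_nat_le[of "\<lambda>x. x \<in> J \<and> x \<noteq> \<zero>\<^bsub>P\<^esub>" _ "deg R"] fJ f0
      unfolding d_def by blast+
    have dc: "d \<in> carrier P" using Jc d by blast
    have sub: "x \<cdot> c \<ominus>\<^bsub>P\<^esub> d \<cdot> q \<in> J" if xcq: "x \<in> J" "c \<in> carrier P" "q \<in> carrier P" for x c q
    proof -
      obtain s t where st: "s \<in> carrier P" "t \<in> carrier P" "x = s \<cdot> f \<oplus>\<^bsub>P\<^esub> t \<cdot> g"
        using xcq(1) unfolding J_def by blast
      obtain s' t' where st': "s' \<in> carrier P" "t' \<in> carrier P" "d = s' \<cdot> f \<oplus>\<^bsub>P\<^esub> t' \<cdot> g"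
        using d(1) unfolding J_def by blast
      have "x \<cdot> c \<ominus>\<^bsub>P\<^esub> d \<cdot> q =
        (s \<cdot> c \<ominus>\<^bsub>P\<^esub> s' \<cdot> q) \<cdot> f \<oplus>\<^bsub>P\<^esub> (t \<cdot> c \<ominus>\<^bsub>P\<^esub> t' \<cdot> q) \<cdot> g"
        unfolding st(3) st'(3) using st(1,2) st'(1,2) xcq f(1) gh by algebra
      then show ?thesis
        using st(1,2) st'(1,2) xcq f(1) gh unfolding J_def by blast
    qed
    have pdiv: "\<exists>c q. c \<in> carrier R - {\<zero>} \<and> q \<in> carrier P \<and> c \<odot>\<^bsub>P\<^esub> x = q \<cdot> d" if x: "x \<in> J" for x
    proof -
      have xc: "x \<in> carrier P" using Jc x by blast
      obtain q r k where qr: "q \<in> carrier P" "r \<in> carrier P"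
        "cf d (deg R d) [^] (k::nat) \<odot>\<^bsub>P\<^esub> x = d \<cdot> q \<oplus>\<^bsub>P\<^esub> r"
        "r = \<zero>\<^bsub>P\<^esub> \<or> deg R r < deg R d"
        using long_div_theorem[OF dc xc d(2)] by blast
      define c where "c = cf d (deg R d) [^] k"
      have c: "c \<in> carrier R" "c \<noteq> \<zero>"
        unfolding c_def using lcoeff_nonzero[OF d(2) dc] dc
        by (simp_all add: R.nat_pow_nonzero)
      have "c \<odot>\<^bsub>P\<^esub> x = x \<cdot> const c"
        using c xc monom_mult_is_smult[of c x] P.m_comm by simp
      then have "x \<cdot> const c = d \<cdot> q \<oplus>\<^bsub>P\<^esub> r"
        using qr(3) c_def by simp
      then have "r = x \<cdot> const c \<ominus>\<^bsub>P\<^esub> d \<cdot> q"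
        using qr(1,2) dc by simp algebra
      then have "r \<in> J" using sub[OF x] c qr by simp
      then have "r = \<zero>\<^bsub>P\<^esub>" using d(3)[of r] qr(4) by (meson leD)
      then have "c \<odot>\<^bsub>P\<^esub> x = q \<cdot> d"
        using qr dc c_def P.m_comm by simp
      then show ?thesis using c qr by blast
    qed
    obtain c q where cq: "c \<in> carrier R" "c \<noteq> \<zero>" "q \<in> carrier P" "c \<odot>\<^bsub>P\<^esub> f = q \<cdot> d"
      using pdiv[OF fJ] by blast
    obtain a b q' d' where w: "a \<in> carrier R - {\<zero>}" "b \<in> carrier R - {\<zero>}" "q' \<in> carrier P"
      "d' \<in> carrier P" "d = a \<odot>\<^bsub>P\<^esub> d'" "q = b \<odot>\<^bsub>P\<^esub> q'" "f = q' \<cdot> d'"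
      using split_constant_factor[OF cq(1,2), rule_format, OF f(1) cq(3) dc cq(4)]
      by (elim exE conjE) (rule that)
    consider "q' \<in> Units P" | "d' \<in> Units P"
      using UP_ring_irreducibleE(5)[OF f(1,2) w(3,4,7)] by blast
    then show "f divides\<^bsub>P\<^esub> g \<or> f divides\<^bsub>P\<^esub> h"
    proof cases
      case 1
      then obtain v where v: "v \<in> carrier P" "q' \<cdot> v = \<one>\<^bsub>P\<^esub>"
        using P.Units_iff by blast
      have "f \<cdot> v = (q' \<cdot> v) \<cdot> d'"
        using w v by (simp add: P.m_ac)
      then have d': "d' = f \<cdot> v" using v w by simp
      obtain c2 q2 where c2: "c2 \<in> carrier R" "c2 \<noteq> \<zero>" "q2 \<in> carrier P" "c2 \<odot>\<^bsub>P\<^esub> g = q2 \<cdot> d"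
        using pdiv[OF gJ] by blast
      have "d = const a \<cdot> d'"
        using w monom_mult_is_smult by simp
      then have "c2 \<odot>\<^bsub>P\<^esub> g = f \<cdot> (q2 \<cdot> const a \<cdot> v)"
        using c2 d' v f(1) w(1) by (simp add: P.m_ac)
      then have "f divides\<^bsub>P\<^esub> (c2 \<odot>\<^bsub>P\<^esub> g)"
        using c2 v w(1) by (auto simp: factor_def)
      then show ?thesis
        using irreducible_divides_smult[OF f c2(1,2) gh(1)] by blast
    next
      case 2
      then obtain u where u: "u \<in> Units R" "d' = const u"
        using const_Units_iff w by blast
      have uc: "u \<in> carrier R" "u \<noteq> \<zero>" using u by (auto simp: Units_def)
      define e where "e = a \<otimes> u"
      have e: "e \<in> carrier R" "e \<noteq> \<zero>" "d = const e"
        using w uc u const_mult[of a u] monom_mult_is_smult[of a d']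
        by (simp_all add: e_def R.integral_iff)
      obtain s t where st: "s \<in> carrier P" "t \<in> carrier P" "d = s \<cdot> f \<oplus>\<^bsub>P\<^esub> t \<cdot> g"
        using d(1) unfolding J_def by blast
      obtain z where z: "z \<in> carrier P" "g \<cdot> h = f \<cdot> z"
        using gh by (auto simp: factor_def)
      have "e \<odot>\<^bsub>P\<^esub> h = (s \<cdot> f \<oplus>\<^bsub>P\<^esub> t \<cdot> g) \<cdot> h"
        using e gh monom_mult_is_smult[of e h] st(3) by simp
      also have "\<dots> = f \<cdot> (s \<cdot> h) \<oplus>\<^bsub>P\<^esub> t \<cdot> (g \<cdot> h)"
        using st(1,2) f(1) gh(1,2) by algebra
      also have "\<dots> = f \<cdot> (s \<cdot> h) \<oplus>\<^bsub>P\<^esub> t \<cdot> (f \<cdot> z)"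
        unfolding z(2) ..
      also have "\<dots> = f \<cdot> (s \<cdot> h \<oplus>\<^bsub>P\<^esub> t \<cdot> z)"
        using st(1,2) f(1) gh(1,2) z(1) by algebra
      finally have "f divides\<^bsub>P\<^esub> (e \<odot>\<^bsub>P\<^esub> h)"
        using st gh z by (auto simp: factor_def)
      then show ?thesis
        using irreducible_divides_smult[OF f e(1,2) gh(2)] by blast
    qed
  qed
qed

lemma irreducible_deg_0_prime:
  assumes f: "f \<in> carrier P" "ring_irreducible\<^bsub>P\<^esub> f" "deg R f = 0"
  shows "ring_prime\<^bsub>P\<^esub> f"
proof -
  define a where "a = cf f 0"
  have a: "a \<in> carrier R" "f = const a"
    using f deg_zero_impl_monom by (auto simp: a_def)
  have unit: "b \<in> Units R" if "b \<in> carrier R" "const b \<in> Units P" for b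
    using that const_Units_iff[of "const b"] monom_inj[of 0] R.Units_closed
    by (auto simp: inj_on_def)
  have "ring_irreducible a"
  proof (rule R.ring_irreducibleI)
    show "a \<in> carrier R - {\<zero>}"
      using a f by (auto simp: ring_irreducible_def)
    show "a \<notin> Units R"
      using UP_ring_irreducibleE(4)[OF f(1,2)] const_Units_iff[OF f(1)] a by blast
    fix b c assume bc: "b \<in> carrier R" "c \<in> carrier R" "a = b \<otimes> c"
    then have "f = const b \<cdot> const c"
      using a const_mult by simp
    then show "b \<in> Units R \<or> c \<in> Units R"
      using UP_ring_irreducibleE(5)[OF f(1,2)] bc unit by (metis monom_closed)
  qed
  then have "ring_prime a"
    using R.ring_irreducible_imp_prime a by blast
  then show ?thesis using const_prime a by simp
qed

text \<open>A proper factor has a smaller degree, or the same degree and a properly dividing leading coefficient.\<close>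

lemma wf_properfactor_UP:
  "wf (proper_factors P)"
proof (rule wf_subset)
  let ?W = "proper_factors R"
  let ?lc = "\<lambda>f. cf f (deg R f)"
  show "wf (inv_image (less_than <*lex*> ?W) (\<lambda>f. (deg R f, ?lc f)))"
    using R.wf_properfactor by (intro wf_inv_image wf_lex_prod) auto
  show "proper_factors P \<subseteq> inv_image (less_than <*lex*> ?W) (\<lambda>f. (deg R f, ?lc f))"
  proof (rule subrelI)
    fix f g
    assume "(f, g) \<in> proper_factors P"
    then have fg: "f \<in> carrier P" "f \<noteq> \<zero>\<^bsub>P\<^esub>" "g \<in> carrier P" "g \<noteq> \<zero>\<^bsub>P\<^esub>"
      and pf: "properfactor (mult_of P) f g"
      by blast+
    obtain h where h: "h \<in> carrier P" "h \<noteq> \<zero>\<^bsub>P\<^esub>" "g = f \<cdot> h"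
      using pf by (auto simp: properfactor_def factor_def)
    have nd: "\<not> g divides\<^bsub>P\<^esub> f"
      using pf UP_divides_imp_divides_mult[of g f] fg unfolding properfactor_def by blast
    have deg: "deg R g = deg R f + deg R h"
      using deg_mult[OF fg(2) h(2) fg(1) h(1)] h(3) by simp
    show "(f, g) \<in> inv_image (less_than <*lex*> ?W) (\<lambda>f. (deg R f, ?lc f))"
    proof (cases "deg R h = 0")
      case False
      then show ?thesis using deg by simp
    next
      case True
      define c where "c = cf h 0"
      have c: "c \<in> carrier R" "h = const c"
        using True h deg_zero_impl_monom by (auto simp: c_def)
      have c0: "c \<noteq> \<zero>" using c h by auto
      have gc: "g = c \<odot>\<^bsub>P\<^esub> f"
        using h c fg monom_mult_is_smult[of c f] P.m_comm by simp
      have dg: "deg R g = deg R f" using deg True by simp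
      have lc: "?lc g = c \<otimes> ?lc f"
        using gc dg fg c by simp
      have nz: "?lc f \<noteq> \<zero>" "?lc g \<noteq> \<zero>"
        using lcoeff_nonzero fg by auto
      have "\<not> ?lc g divides ?lc f"
      proof
        assume "?lc g divides ?lc f"
        then obtain t where t: "t \<in> carrier R" "?lc f = c \<otimes> ?lc f \<otimes> t"
          unfolding lc by (auto simp: factor_def)
        have "?lc f \<otimes> (c \<otimes> t) = ?lc f \<otimes> \<one>"
          using t c fg by (simp add: R.m_ac)
        then have ct: "c \<otimes> t = \<one>"
          using R.m_lcancel[OF nz(1), of "c \<otimes> t" \<one>] t c fg by simp
        have "g \<cdot> const t = (c \<otimes> t) \<odot>\<^bsub>P\<^esub> f"
          using gc c t fg monom_mult_is_smult[of t g] UP_smult_assoc1[of t c f]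
            P.m_comm[of g "const t"] R.m_comm[of c t] by simp
        then have "f = g \<cdot> const t"
          using ct fg by simp
        then show False using nd t by (auto simp: factor_def)
      qed
      then have "properfactor (mult_of R) (?lc f) (?lc g)"
        using lc c c0 fg R.m_comm[of c "?lc f"] unfolding properfactor_def
        by (auto simp: factor_def)
      then show ?thesis
        using nz dg fg by auto
    qed
  qed
qed

theorem factorial_UP: "factorial_domain P"
proof (rule UP_factorial_domainI_wf[OF wf_properfactor_UP])
  fix f assume "f \<in> carrier P" "ring_irreducible\<^bsub>P\<^esub> f"
  then show "ring_prime\<^bsub>P\<^esub> f"
    using irreducible_pos_deg_prime irreducible_deg_0_prime by blast
qed

end

text \<open>Conversely, factoriality descends to the ring of constants.\<close>

lemma (in UP_domain) factorial_of_UP: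
  assumes "factorial_domain P"
  shows "factorial_domain R"
proof -
  let ?C = "\<lambda>a. const a"
  have inj: "?C a = ?C b \<longleftrightarrow> a = b" if "a \<in> carrier R" "b \<in> carrier R" for a b
    using monom_inj[of 0] that by (auto simp: inj_on_def)
  have dvd: "?C a divides\<^bsub>P\<^esub> ?C b \<longleftrightarrow> a divides b" if "a \<in> carrier R" "b \<in> carrier R" for a b
    using that R.divides_zero unfolding const_divides_iff[OF that(1) monom_closed[OF that(2)]]
    by (metis coeff_monom)
  have C0: "?C a = \<zero>\<^bsub>P\<^esub> \<longleftrightarrow> a = \<zero>" if "a \<in> carrier R" for a
    using inj[of a \<zero>] that by auto
  show ?thesis
  proof (rule R.factorial_domainI_wf)
    show "wf (proper_factors R)"
    proof (rule wf_subset[OF wf_inv_image[OF factorial_domain.wf_properfactor[OF assms], of ?C]], rule subrelI)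
      fix a b
      assume "(a, b) \<in> proper_factors R"
      then have ab: "a \<in> carrier R" "a \<noteq> \<zero>" "b \<in> carrier R" "b \<noteq> \<zero>"
        "properfactor (mult_of R) a b"
        by blast+
      then have "a divides b" "\<not> b divides a"
        using R.divides_imp_divides_mult[of b a] unfolding properfactor_def
        by (blast intro: divides_mult_imp_divides)+
      then have "properfactor (mult_of P) (?C a) (?C b)"
        using UP_divides_imp_divides_mult[of "?C a" "?C b"] ab(1-4) C0[of b] dvd[of a b] dvd[of b a]
          divides_mult_imp_divides[of P "?C b" "?C a"]
        unfolding properfactor_def by (metis Diff_iff monom_closed singletonD)
      then show "(a, b) \<in> inv_image (proper_factors P) ?C"
        using ab C0 by simp
    qed
  next
    fix p assume p: "p \<in> carrier R" "ring_irreducible p"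
    have p0: "p \<noteq> \<zero>" "p \<notin> Units R" using R.ring_irreducibleE[OF p] by auto
    have "ring_irreducible\<^bsub>P\<^esub> (?C p)"
    proof (rule UP_ring_irreducibleI)
      show "?C p \<in> carrier P - {\<zero>\<^bsub>P\<^esub>}" using p p0 C0 by simp
      show "?C p \<notin> Units P"
        using p p0 const_Units_iff[of "?C p"] inj R.Units_closed by (metis monom_closed)
      fix f g assume fg: "f \<in> carrier P" "g \<in> carrier P" "?C p = f \<cdot> g"
      then have "f \<noteq> \<zero>\<^bsub>P\<^esub>" "g \<noteq> \<zero>\<^bsub>P\<^esub>" using p p0 C0 by auto
      then have "deg R f + deg R g = 0"
        using deg_mult[of f g] fg(1,2) deg_const[OF p(1)] unfolding fg(3) by simp
      then have d: "f = ?C (cf f 0)" "g = ?C (cf g 0)"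
        using deg_zero_impl_monom fg by auto
      have "p = cf f 0 \<otimes> cf g 0"
        using inj[of p "cf f 0 \<otimes> cf g 0"] fg d p
          const_mult[of "cf f 0" "cf g 0"] by simp
      then have "cf f 0 \<in> Units R \<or> cf g 0 \<in> Units R"
        using R.ring_irreducibleE(5)[OF p] fg by simp
      then show "f \<in> Units P \<or> g \<in> Units P"
        using d const_Units_iff fg by blast
    qed
    then have pr: "prime P (?C p)"
      using factorial_domain.ring_irreducible_imp_prime[OF assms, of "?C p"] p by (simp add: ring_prime_def)
    show "ring_prime p"
    proof (rule R.ring_primeI[OF p0(1)], rule primeI[OF p0(2)])
      fix a b assume ab: "a \<in> carrier R" "b \<in> carrier R" "p divides a \<otimes> b"
      then have "?C p divides\<^bsub>P\<^esub> ?C a \<cdot> ?C b"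
        using dvd[of p "a \<otimes> b"] p const_mult by simp
      then have "?C p divides\<^bsub>P\<^esub> ?C a \<or> ?C p divides\<^bsub>P\<^esub> ?C b"
        using pr ab by (simp add: prime_def)
      then show "p divides a \<or> p divides b"
        using dvd ab p by blast
    qed
  qed
qed

section \<open>Corner rings and complete systems of orthogonal idempotents\<close>

text \<open>
  For an idempotent \<open>e\<close> this is the ring \<open>eR\<close>, whose identity is \<open>e\<close>; membership in it is
  expressed by \<open>ex = x\<close>.
\<close>

definition corner :: "('a, 'm) ring_scheme \<Rightarrow> 'a \<Rightarrow> ('a, 'm) ring_scheme" where
  "corner R e = R\<lparr>carrier := {x \<in> carrier R. e \<otimes>\<^bsub>R\<^esub> x = x}, one := e\<rparr>"

lemma corner_simps [simp]:
  "carrier (corner R e) = {x \<in> carrier R. e \<otimes>\<^bsub>R\<^esub> x = x}"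
  "x \<otimes>\<^bsub>corner R e\<^esub> y = x \<otimes>\<^bsub>R\<^esub> y" "\<one>\<^bsub>corner R e\<^esub> = e"
  "\<zero>\<^bsub>corner R e\<^esub> = \<zero>\<^bsub>R\<^esub>" "x \<oplus>\<^bsub>corner R e\<^esub> y = x \<oplus>\<^bsub>R\<^esub> y"
  by (simp_all add: corner_def)

lemma (in cring) corner_one: "corner R \<one> = R"
proof -
  have "{x \<in> carrier R. \<one> \<otimes> x = x} = carrier R" by auto
  then show ?thesis by (simp add: corner_def)
qed

lemma (in cring) corner_cring:
  assumes e: "e \<in> carrier R" "e \<otimes> e = e"
  shows "cring (corner R e)"
proof (rule cringI)
  have cl: "e \<otimes> (x \<otimes> y) = x \<otimes> y" if "x \<in> carrier R" "y \<in> carrier R" "e \<otimes> x = x" for x y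
    using m_assoc[OF e(1) that(1,2)] that(3) by simp
  show "abelian_group (corner R e)"
  proof (rule abelian_groupI)
    fix x assume "x \<in> carrier (corner R e)"
    then have x: "x \<in> carrier R" "e \<otimes> x = x" by auto
    have "e \<otimes> (\<ominus> x) = \<ominus> x"
      using r_minus[OF e(1) x(1)] x(2) by simp
    then show "\<exists>y\<in>carrier (corner R e). y \<oplus>\<^bsub>corner R e\<^esub> x = \<zero>\<^bsub>corner R e\<^esub>"
      using x by (intro bexI[of _ "\<ominus> x"]) (simp_all add: l_neg)
  qed (use e in \<open>auto simp: r_distr a_ac\<close>)
  show "comm_monoid (corner R e)"
    by (rule comm_monoidI) (use e cl in \<open>auto simp: m_assoc intro: m_comm\<close>)
qed (use e in \<open>auto simp: l_distr\<close>)

lemma (in cring) corner_domainI: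
  assumes e: "e \<in> carrier R" "e \<otimes> e = e" "e \<noteq> \<zero>"
    and "\<And>a b. \<lbrakk>a \<in> carrier R; b \<in> carrier R; e \<otimes> a = a; e \<otimes> b = b; a \<otimes> b = \<zero>\<rbrakk> \<Longrightarrow> a = \<zero> \<or> b = \<zero>"
  shows "domain (corner R e)"
proof -
  interpret C: cring "corner R e" using corner_cring e by blast
  show ?thesis
    by unfold_locales (use assms in auto)
qed

lemma (in cring) corner_domain_integral:
  assumes "domain (corner R e)" "e \<in> carrier R" "e \<otimes> e = e"
    and "x \<in> carrier R" "y \<in> carrier R" "e \<otimes> (x \<otimes> y) = \<zero>"
  shows "e \<otimes> x = \<zero> \<or> e \<otimes> y = \<zero>"
proof -
  have i: "e \<otimes> (e \<otimes> z) = e \<otimes> z" if "z \<in> carrier R" for z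
    using that assms by (simp add: m_assoc[symmetric])
  have "(e \<otimes> x) \<otimes> (e \<otimes> y) = (e \<otimes> e) \<otimes> (x \<otimes> y)"
    using assms(2,4,5) by (simp add: m_ac)
  also have "\<dots> = \<zero>" using assms by simp
  finally have "(e \<otimes> x) \<otimes> (e \<otimes> y) = \<zero>" .
  then show ?thesis
    using domain.integral[OF assms(1), of "e \<otimes> x" "e \<otimes> y"] i assms by auto
qed

lemma (in cring) corner_Units_iff:
  assumes e: "e \<in> carrier R" "e \<otimes> e = e"
  shows "x \<in> Units (corner R e) \<longleftrightarrow> x \<in> carrier R \<and> e \<otimes> x = x \<and> (\<exists>y\<in>carrier R. x \<otimes> y = e)"
proof -
  interpret C: cring "corner R e" using corner_cring e by blast
  have "\<exists>z\<in>carrier (corner R e). x \<otimes> z = e"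
    if *: "x \<in> carrier R" "e \<otimes> x = x" "y \<in> carrier R" "x \<otimes> y = e" for y
  proof (rule bexI[of _ "e \<otimes> y"])
    have "x \<otimes> (e \<otimes> y) = (e \<otimes> x) \<otimes> y" using * e by (simp add: m_ac)
    then show "x \<otimes> (e \<otimes> y) = e" using * by simp
    show "e \<otimes> y \<in> carrier (corner R e)"
      using * e by (simp add: m_assoc[symmetric])
  qed
  then show ?thesis using C.Units_iff[of x] by auto
qed

lemma (in cring) corner_divides_iff:
  assumes e: "e \<in> carrier R" "e \<otimes> e = e" and x: "x \<in> carrier R" "e \<otimes> x = x"
  shows "x divides\<^bsub>corner R e\<^esub> y \<longleftrightarrow> x divides y"
proof
  assume "x divides y"
  then obtain z where z: "z \<in> carrier R" "y = x \<otimes> z" by (auto simp: factor_def)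
  have "y = x \<otimes> (e \<otimes> z)"
    using z x e m_assoc[of e x z] m_lcomm[of x e z] by simp
  moreover have "e \<otimes> z \<in> carrier (corner R e)"
    using z e by (simp add: m_assoc[symmetric])
  ultimately show "x divides\<^bsub>corner R e\<^esub> y"
    unfolding factor_def by auto
qed (auto simp: factor_def)

text \<open>
  A complete system of orthogonal idempotents. It is not required that they be nonzero; this follows
  where the corners are domains.
\<close>

locale idempotent_decomposition = cring +
  fixes n :: nat and e :: "nat \<Rightarrow> 'a"
  assumes idem_closed: "i < n \<Longrightarrow> e i \<in> carrier R"
    and idem_mult: "i < n \<Longrightarrow> j < n \<Longrightarrow> e i \<otimes> e j = (if i = j then e i else \<zero>)"
    and idem_sum: "(\<Oplus>i\<in>{..<n}. e i) = \<one>"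
begin

lemma idem: "i < n \<Longrightarrow> e i \<otimes> e i = e i"
  by (simp add: idem_mult)

lemma idem_l: "i < n \<Longrightarrow> x \<in> carrier R \<Longrightarrow> e i \<otimes> (e i \<otimes> x) = e i \<otimes> x"
  by (simp add: m_assoc[symmetric] idem_closed idem)

lemma idem_orth: "i < n \<Longrightarrow> j < n \<Longrightarrow> i \<noteq> j \<Longrightarrow> x \<in> carrier R \<Longrightarrow> e i \<otimes> (e j \<otimes> x) = \<zero>"
  by (simp add: m_assoc[symmetric] idem_closed idem_mult)

text \<open>Components can be prescribed independently of each other.\<close>

lemma glue:
  assumes "\<And>i. i < n \<Longrightarrow> z i \<in> carrier R"
  obtains y where "y \<in> carrier R" "\<And>i. i < n \<Longrightarrow> e i \<otimes> y = e i \<otimes> z i"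
proof
  let ?y = "\<Oplus>j\<in>{..<n}. e j \<otimes> z j"
  have cl: "(\<lambda>j. e j \<otimes> z j) \<in> {..<n} \<rightarrow> carrier R"
    using assms idem_closed by auto
  show "?y \<in> carrier R" using cl by simp
  fix i assume i: "i < n"
  have "e i \<otimes> ?y = (\<Oplus>j\<in>{..<n}. e i \<otimes> (e j \<otimes> z j))"
    using cl i idem_closed by (simp add: finsum_rdistr)
  also have "\<dots> = (\<Oplus>j\<in>{..<n}. if i = j then e j \<otimes> z j else \<zero>)"
    using i assms idem_l idem_orth idem_closed by (intro finsum_cong') auto
  also have "\<dots> = e i \<otimes> z i"
    using i cl by (intro finsum_singleton) auto
  finally show "e i \<otimes> ?y = e i \<otimes> z i" .
qed

lemma components_eqI:
  assumes "x \<in> carrier R" "y \<in> carrier R" "\<And>i. i < n \<Longrightarrow> e i \<otimes> x = e i \<otimes> y"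
  shows "x = y"
proof -
  have cl: "e \<in> {..<n} \<rightarrow> carrier R" using idem_closed by auto
  have "x = (\<Oplus>i\<in>{..<n}. e i \<otimes> x)"
    using assms idem_sum finsum_ldistr[OF _ assms(1) cl] by simp
  also have "\<dots> = (\<Oplus>i\<in>{..<n}. e i \<otimes> y)"
    using assms idem_closed by (intro finsum_cong') auto
  also have "\<dots> = y"
    using assms idem_sum finsum_ldistr[OF _ assms(2) cl] by simp
  finally show ?thesis .
qed

lemma divides_iff_components:
  assumes "x \<in> carrier R" "y \<in> carrier R"
  shows "x divides y \<longleftrightarrow> (\<forall>i<n. \<exists>t\<in>carrier R. e i \<otimes> y = e i \<otimes> (x \<otimes> t))"
proof
  assume "x divides y"
  then show "\<forall>i<n. \<exists>t\<in>carrier R. e i \<otimes> y = e i \<otimes> (x \<otimes> t)"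
    by (auto simp: factor_def)
next
  assume "\<forall>i<n. \<exists>t\<in>carrier R. e i \<otimes> y = e i \<otimes> (x \<otimes> t)"
  then obtain t where t: "\<And>i. i < n \<Longrightarrow> t i \<in> carrier R" "\<And>i. i < n \<Longrightarrow> e i \<otimes> y = e i \<otimes> (x \<otimes> t i)"
    by metis
  obtain s where s: "s \<in> carrier R" "\<And>i. i < n \<Longrightarrow> e i \<otimes> s = e i \<otimes> t i"
    using glue[of t] t(1) by blast
  have "y = x \<otimes> s"
  proof (rule components_eqI)
    fix i assume i: "i < n"
    have "e i \<otimes> (x \<otimes> s) = x \<otimes> (e i \<otimes> s)"
      using i s assms idem_closed m_lcomm by simp
    also have "\<dots> = e i \<otimes> (x \<otimes> t i)"
      using i s t(1) assms idem_closed m_lcomm by simp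
    finally show "e i \<otimes> y = e i \<otimes> (x \<otimes> s)" using t(2) i by simp
  qed (use assms s in auto)
  then show "x divides y" using s by (auto simp: factor_def)
qed

text \<open>The component of \<open>x\<close> in the \<open>i\<close>-th corner is a unit.\<close>

definition unit_at :: "nat \<Rightarrow> 'a \<Rightarrow> bool" where
  "unit_at i x \<longleftrightarrow> (\<exists>y\<in>carrier R. e i \<otimes> (x \<otimes> y) = e i)"

lemma unit_at_iff_corner:
  assumes "i < n" "x \<in> carrier R"
  shows "unit_at i x \<longleftrightarrow> e i \<otimes> x \<in> Units (corner R (e i))"
  unfolding unit_at_def corner_Units_iff[OF idem_closed[OF assms(1)] idem[OF assms(1)]]
  using assms idem_closed idem_l by (auto simp: m_assoc)

lemma Units_iff_components:
  "x \<in> Units R \<longleftrightarrow> x \<in> carrier R \<and> (\<forall>i<n. unit_at i x)"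
proof -
  have "x \<in> Units R \<longleftrightarrow> x divides \<one>" if "x \<in> carrier R"
    using divides_one[OF that] by simp
  then show ?thesis
    using divides_iff_components[of x \<one>] idem_closed Units_closed
    by (auto simp: unit_at_def) (metis+)
qed

text \<open>The element with \<open>i\<close>-th component that of \<open>x\<close> and all other components 1.\<close>

definition lift_at :: "nat \<Rightarrow> 'a \<Rightarrow> 'a" where
  "lift_at i x = e i \<otimes> x \<oplus> (\<one> \<ominus> e i)"

lemma lift_at_closed [simp]: "i < n \<Longrightarrow> x \<in> carrier R \<Longrightarrow> lift_at i x \<in> carrier R"
  by (simp add: lift_at_def idem_closed)

lemma lift_at_component:
  assumes "i < n" "k < n" "x \<in> carrier R"
  shows "e k \<otimes> lift_at i x = (if k = i then e i \<otimes> x else e k)"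
proof -
  have "e k \<otimes> lift_at i x = e k \<otimes> (e i \<otimes> x) \<oplus> (e k \<ominus> e k \<otimes> e i)"
    using assms idem_closed[OF assms(1)] idem_closed[OF assms(2)]
    unfolding lift_at_def by algebra
  also have "\<dots> = (if k = i then e i \<otimes> x else e k)"
    using assms idem_closed idem_l idem_orth idem_mult by (simp add: r_neg minus_eq)
  finally show ?thesis .
qed

end

section \<open>Products of domains: atoms and their components\<close>

lemma (in cring) assoc_elems_iff:
  assumes "a \<in> carrier R" "b \<in> carrier R"
  shows "assoc_elems R a b \<longleftrightarrow> a divides b \<and> b divides a"
  using associated_iff_same_ideal[OF assms] by (simp add: assoc_elems_def associated_def)

lemma atom_closed: "atom A p \<Longrightarrow> p \<in> carrier A"
  by (simp add: atom_def nonunits_def)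

lemma atom_nonunit: "atom A p \<Longrightarrow> p \<notin> Units A"
  by (simp add: atom_def nonunits_def)

lemma (in cring) atomD:
  assumes "atom R p" "b \<in> carrier R" "c \<in> carrier R" "p = b \<otimes> c"
  shows "p divides b \<or> p divides c"
  using assms assoc_elems_iff unfolding atom_def nonunits_def by blast

lemma (in cring) atomI:
  assumes "p \<in> carrier R" "p \<notin> Units R"
    and "\<And>b c. \<lbrakk>b \<in> carrier R; c \<in> carrier R; p = b \<otimes> c\<rbrakk> \<Longrightarrow> p divides b \<or> p divides c"
  shows "atom R p"
  unfolding atom_def nonunits_def
proof (intro conjI ballI impI)
  fix b c assume bc: "b \<in> carrier R" "c \<in> carrier R" "p = b \<otimes> c"
  then have "b divides p" "c divides p"
    using m_comm by (auto simp: factor_def)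
  then show "assoc_elems R p b \<or> assoc_elems R p c"
    using assms(3)[OF bc] assoc_elems_iff[OF assms(1)] bc by blast
qed (use assms in auto)

lemma (in monoid) Units_inv_cancel:
  assumes "u \<in> Units G" "b \<in> carrier G"
  shows "inv u \<otimes> (u \<otimes> b) = b" "u \<otimes> (inv u \<otimes> b) = b"
  using assms m_assoc[of "inv u" u b] m_assoc[of u "inv u" b] Units_closed[OF assms(1)] by simp_all

lemma (in cring) divides_cancel_unit:
  assumes "u \<in> Units R" "a \<in> carrier R" "b \<in> carrier R"
  shows "a divides u \<otimes> b \<longleftrightarrow> a divides b"
proof
  assume "a divides u \<otimes> b"
  then obtain c where c: "c \<in> carrier R" "u \<otimes> b = a \<otimes> c" by (auto simp: factor_def)
  have "b = inv u \<otimes> (u \<otimes> b)" using assms Units_inv_cancel by simp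
  also have "\<dots> = a \<otimes> (inv u \<otimes> c)" using assms c m_lcomm Units_closed by simp
  finally show "a divides b" using assms c by (auto simp: factor_def)
next
  assume "a divides b"
  then obtain c where c: "c \<in> carrier R" "b = a \<otimes> c" by (auto simp: factor_def)
  then have "u \<otimes> b = a \<otimes> (u \<otimes> c)" using assms m_lcomm Units_closed by simp
  then show "a divides u \<otimes> b" using assms c Units_closed by (metis dividesI' m_closed)
qed

lemma (in cring) atom_unit_mult:
  assumes "atom R p" "u \<in> Units R"
  shows "atom R (u \<otimes> p)"
proof (rule atomI)
  note pc = atom_closed[OF assms(1)] and uc = Units_closed[OF assms(2)]
  show "u \<otimes> p \<in> carrier R" using pc uc by simp
  show "u \<otimes> p \<notin> Units R"
    using assms atom_nonunit[OF assms(1)] pc unit_factor[of p u] m_comm[of u p] uc by metis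
  fix b c assume bc: "b \<in> carrier R" "c \<in> carrier R" "u \<otimes> p = b \<otimes> c"
  have "p = inv u \<otimes> (u \<otimes> p)" using assms pc Units_inv_cancel by simp
  also have "\<dots> = (inv u \<otimes> b) \<otimes> c" using assms bc by (simp add: m_assoc)
  finally have p: "p divides inv u \<otimes> b \<or> p divides c"
    using atomD[OF assms(1)] bc assms(2) by simp
  have "u \<otimes> p divides x" if px: "p divides x" for x
  proof -
    obtain t where t: "t \<in> carrier R" "x = p \<otimes> t" using px by (auto simp: factor_def)
    have "(u \<otimes> p) \<otimes> (inv u \<otimes> t) = (u \<otimes> inv u) \<otimes> (p \<otimes> t)"
      using assms(2) pc uc t Units_inv_closed[OF assms(2)] by (simp only: m_ac m_closed)
    then have "x = (u \<otimes> p) \<otimes> (inv u \<otimes> t)"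
      using assms(2) pc t by simp
    then show ?thesis using t assms(2) by (auto simp: factor_def)
  qed
  then show "u \<otimes> p divides b \<or> u \<otimes> p divides c"
    using p bc divides_cancel_unit[of "inv u" p b] assms(2) pc by auto
qed

text \<open>\<open>a\<close> is a unit times a finite product of atoms, and \<open>S\<close> is the set of atoms occurring.\<close>

definition atom_product :: "('a, 'm) ring_scheme \<Rightarrow> 'a \<Rightarrow> 'a set \<Rightarrow> bool" where
  "atom_product A a S \<longleftrightarrow> (\<exists>u (n::nat) f. u \<in> Units A \<and> (\<forall>i\<in>{1..n}. atom A (f i)) \<and>
     a = u \<otimes>\<^bsub>A\<^esub> finprod A f {1..n} \<and> S = f ` {1..n})"

lemma (in cring) atom_product_unit: "u \<in> Units R \<Longrightarrow> atom_product R u {}"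
  unfolding atom_product_def
  by (rule exI[of _ u], rule exI[of _ 0]) (auto simp: Units_closed)

lemma (in cring) atom_product_atom: "atom R p \<Longrightarrow> atom_product R p {p}"
  unfolding atom_product_def
  by (rule exI[of _ \<one>], rule exI[of _ 1], rule exI[of _ "\<lambda>_. p"]) (auto simp: atom_closed)

lemma (in cring) finprod_concat:
  fixes m n :: nat
  assumes f: "f \<in> {1..n} \<rightarrow> carrier R" and g: "g \<in> {1..m} \<rightarrow> carrier R"
  obtains h where "finprod R h {1..n + m} = finprod R f {1..n} \<otimes> finprod R g {1..m}"
    "h ` {1..n + m} = f ` {1..n} \<union> g ` {1..m}"
proof
  let ?h = "\<lambda>i. if i \<le> n then f i else g (i - n)"
  have split: "{1..n + m} = {1..n} \<union> (\<lambda>i. i + n) ` {1..m}"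
    by (auto simp: image_iff intro!: bexI[of _ "_ - n"])
  have disj: "{1..n} \<inter> (\<lambda>i. i + n) ` {1..m} = {}" by auto
  have cl1: "?h \<in> {1..n} \<rightarrow> carrier R" using f by auto
  have cl2: "?h \<in> (\<lambda>i. i + n) ` {1..m} \<rightarrow> carrier R"
    by (auto intro!: funcset_mem[OF g]) arith+
  have h1: "finprod R ?h {1..n} = finprod R f {1..n}"
    using f by (intro finprod_cong') auto
  have "finprod R ?h ((\<lambda>i. i + n) ` {1..m}) = finprod R (\<lambda>i. ?h (i + n)) {1..m}"
    using cl2 by (intro finprod_reindex) (auto simp: inj_on_def)
  also have "\<dots> = finprod R g {1..m}"
    using g by (intro finprod_cong') auto
  finally have h2: "finprod R ?h ((\<lambda>i. i + n) ` {1..m}) = finprod R g {1..m}" .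
  show "finprod R ?h {1..n + m} = finprod R f {1..n} \<otimes> finprod R g {1..m}"
    unfolding split h1[symmetric] h2[symmetric]
    by (rule finprod_Un_disjoint) (use disj cl1 cl2 in auto)
  have "?h ` {1..n} = f ` {1..n}" by auto
  moreover have "?h ` ((\<lambda>i. i + n) ` {1..m}) = g ` {1..m}"
    unfolding image_image by (rule image_cong) auto
  ultimately show "?h ` {1..n + m} = f ` {1..n} \<union> g ` {1..m}"
    unfolding split image_Un by simp
qed

lemma (in cring) atom_product_mult:
  assumes "atom_product R a S" "atom_product R b T"
  shows "atom_product R (a \<otimes> b) (S \<union> T)"
proof -
  obtain u n f where f: "u \<in> Units R" "\<forall>i\<in>{1..n::nat}. atom R (f i)"
    "a = u \<otimes> finprod R f {1..n}" "S = f ` {1..n}"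
    using assms(1) unfolding atom_product_def by blast
  obtain v m g where g: "v \<in> Units R" "\<forall>i\<in>{1..m::nat}. atom R (g i)"
    "b = v \<otimes> finprod R g {1..m}" "T = g ` {1..m}"
    using assms(2) unfolding atom_product_def by blast
  have cl: "f \<in> {1..n} \<rightarrow> carrier R" "g \<in> {1..m} \<rightarrow> carrier R"
    using f(2) g(2) by (auto intro!: atom_closed)
  obtain h where h: "finprod R h {1..n + m} = finprod R f {1..n} \<otimes> finprod R g {1..m}"
    "h ` {1..n + m} = f ` {1..n} \<union> g ` {1..m}"
    using finprod_concat[OF cl] by blast
  have "\<forall>i\<in>{1..n + m}. atom R (h i)"
  proof
    fix i assume "i \<in> {1..n + m}"
    then have "h i \<in> f ` {1..n} \<union> g ` {1..m}" using h(2) by blast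
    then show "atom R (h i)" using f(2) g(2) by auto
  qed
  moreover have "a \<otimes> b = (u \<otimes> v) \<otimes> finprod R h {1..n + m}"
    unfolding f(3) g(3) h(1) using f(1) g(1) cl Units_closed by (simp add: m_ac)
  moreover have "u \<otimes> v \<in> Units R" using f(1) g(1) by simp
  ultimately show ?thesis
    unfolding atom_product_def using h(2) f(4) g(4) by blast
qed

lemma (in cring) atom_product_finprod:
  assumes "finite J" "g \<in> J \<rightarrow> carrier R" "\<And>j. j \<in> J \<Longrightarrow> \<exists>S. atom_product R (g j) S"
  shows "\<exists>S. atom_product R (finprod R g J) S"
  using assms
proof (induction J rule: finite_induct)
  case empty
  then show ?case using atom_product_unit[of \<one>] by auto
next
  case (insert j J)
  then have "finprod R g (insert j J) = g j \<otimes> finprod R g J" by auto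
  moreover obtain S T where "atom_product R (g j) S" "atom_product R (finprod R g J) T"
    using insert by (metis (no_types, lifting) Pi_split_insert_domain insert_iff)
  ultimately show ?case using atom_product_mult by metis
qed

lemma (in cring) atomic_ringI:
  assumes "\<And>a. a \<in> carrier R \<Longrightarrow> a \<noteq> \<zero> \<Longrightarrow> \<exists>S. atom_product R a S"
  shows "atomic_ring R"
  unfolding atomic_ring_def
proof
  fix a assume a: "a \<in> nonunits R - {\<zero>}"
  then obtain S u n f where f: "u \<in> Units R" "\<forall>i\<in>{1..n::nat}. atom R (f i)"
    "a = u \<otimes> finprod R f {1..n}"
    using assms[of a] unfolding atom_product_def nonunits_def by blast
  have cl: "f \<in> {1..n} \<rightarrow> carrier R" using f(2) by (auto intro!: atom_closed)
  have "n \<noteq> 0" using a f(1,3) Units_closed by (auto simp: nonunits_def)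
  then have I: "{1..n} = insert 1 {2..n}" by auto
  have c1: "f 1 \<in> carrier R" "f \<in> {2..n} \<rightarrow> carrier R"
    using cl \<open>n \<noteq> 0\<close> by auto
  \<comment> \<open>The unit is absorbed by the first atom, which exists because \<open>a\<close> is not a unit.\<close>
  let ?g = "f(1 := u \<otimes> f 1)"
  have "finprod R ?g {2..n} = finprod R f {2..n}"
    using c1 by (intro finprod_cong') auto
  moreover have "?g \<in> {2..n} \<rightarrow> carrier R" using c1 by auto
  ultimately have "finprod R ?g {1..n} = (u \<otimes> f 1) \<otimes> finprod R f {2..n}"
    unfolding I using c1 Units_closed[OF f(1)] by simp
  also have "\<dots> = a"
    unfolding f(3) I using c1 Units_closed[OF f(1)] by (simp add: m_assoc)
  finally have "a = finprod R ?g {1..n}" by simp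
  moreover have "\<forall>i\<in>{1..n}. atom R (?g i)"
    using f(1,2) atom_unit_mult by auto
  ultimately show "\<exists>(n::nat) f. (\<forall>i\<in>{1..n}. atom R (f i)) \<and> a = finprod R f {1..n}" by blast
qed

context idempotent_decomposition
begin

lemma unit_at_mult:
  assumes "k < n" "x \<in> carrier R" "y \<in> carrier R"
  shows "unit_at k (x \<otimes> y) \<longleftrightarrow> unit_at k x \<and> unit_at k y"
proof
  assume "unit_at k (x \<otimes> y)"
  then obtain z where z: "z \<in> carrier R" "e k \<otimes> ((x \<otimes> y) \<otimes> z) = e k"
    unfolding unit_at_def by blast
  have "(x \<otimes> y) \<otimes> z = x \<otimes> (y \<otimes> z)" "(x \<otimes> y) \<otimes> z = y \<otimes> (x \<otimes> z)"
    using assms z by (simp_all add: m_ac)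
  then show "unit_at k x \<and> unit_at k y"
    using z assms unfolding unit_at_def by (metis m_closed)
next
  assume "unit_at k x \<and> unit_at k y"
  then obtain a b where ab: "a \<in> carrier R" "b \<in> carrier R" "e k \<otimes> (x \<otimes> a) = e k"
    "e k \<otimes> (y \<otimes> b) = e k"
    unfolding unit_at_def by blast
  have "e k \<otimes> ((x \<otimes> y) \<otimes> (a \<otimes> b)) = (e k \<otimes> (x \<otimes> a)) \<otimes> (y \<otimes> b)"
    using assms(1-3) ab(1,2) idem_closed by (simp add: m_ac)
  also have "\<dots> = e k" unfolding ab(3) ab(4) ..
  finally show "unit_at k (x \<otimes> y)"
    using ab assms unfolding unit_at_def by (metis m_closed)
qed

lemma unit_at_divides:
  assumes "k < n" "x \<in> carrier R" "x divides y" "unit_at k y"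
  shows "unit_at k x"
  using assms unit_at_mult by (auto simp: factor_def)

lemma unit_at_component_cong:
  assumes "k < n" "x \<in> carrier R" "y \<in> carrier R" "e k \<otimes> x = e k \<otimes> y"
  shows "unit_at k x \<longleftrightarrow> unit_at k y"
  using assms idem_closed unfolding unit_at_def
  by (simp add: m_assoc[symmetric] cong: bex_cong)

lemma unit_at_lift_at:
  assumes "i < n" "k < n" "x \<in> carrier R" "k \<noteq> i"
  shows "unit_at k (lift_at i x)"
  unfolding unit_at_def
  using assms lift_at_component[OF assms(1-3)] idem_closed by (auto intro!: bexI[of _ \<one>])

lemma unit_at_lift_at_same:
  assumes "i < n" "x \<in> carrier R"
  shows "unit_at i (lift_at i x) \<longleftrightarrow> unit_at i x"
  using assms lift_at_component[OF assms(1,1,2)] by (intro unit_at_component_cong) auto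

lemma lift_at_mult:
  assumes "i < n" "x \<in> carrier R" "y \<in> carrier R"
  shows "lift_at i (x \<otimes> y) = lift_at i x \<otimes> lift_at i y"
proof (rule components_eqI)
  fix k assume k: "k < n"
  have "e k \<otimes> (lift_at i x \<otimes> lift_at i y) = (e k \<otimes> lift_at i x) \<otimes> lift_at i y"
    using assms k idem_closed by (simp add: m_assoc)
  also have "\<dots> = e k \<otimes> lift_at i (x \<otimes> y)"
  proof (cases "k = i")
    case True
    have "(e i \<otimes> x) \<otimes> lift_at i y = x \<otimes> (e i \<otimes> lift_at i y)"
      using assms idem_closed by (simp add: m_ac)
    then show ?thesis
      using True assms lift_at_component idem_closed by (simp add: m_lcomm)
  next
    case False
    then show ?thesis using k assms lift_at_component by simp
  qed
  finally show "e k \<otimes> lift_at i (x \<otimes> y) = e k \<otimes> (lift_at i x \<otimes> lift_at i y)" by simp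
qed (use assms in auto)

text \<open>
  A factorization of the \<open>i\<close>-th component of \<open>x\<close> extends to a factorization of \<open>x\<close>, in which the second
  factor carries all the other components.
\<close>

lemma split_at:
  assumes "i < n" "b \<in> carrier R" "c \<in> carrier R" "x \<in> carrier R" "e i \<otimes> x = e i \<otimes> (b \<otimes> c)"
  obtains y where "y \<in> carrier R" "e i \<otimes> y = e i \<otimes> c" "\<And>k. k < n \<Longrightarrow> k \<noteq> i \<Longrightarrow> e k \<otimes> y = e k \<otimes> x"
    "x = lift_at i b \<otimes> y"
proof -
  obtain y where y: "y \<in> carrier R" "\<And>k. k < n \<Longrightarrow> e k \<otimes> y = e k \<otimes> (if k = i then c else x)"
    using glue[of "\<lambda>k. if k = i then c else x"] assms by metis
  have "x = lift_at i b \<otimes> y"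
  proof (rule components_eqI)
    fix k assume k: "k < n"
    have "e k \<otimes> (lift_at i b \<otimes> y) = (e k \<otimes> lift_at i b) \<otimes> y"
      using assms k y idem_closed by (simp add: m_assoc)
    also have "\<dots> = e k \<otimes> x"
    proof (cases "k = i")
      case True
      have "(e i \<otimes> b) \<otimes> y = b \<otimes> (e i \<otimes> y)"
        using assms y idem_closed by (simp add: m_ac)
      also have "\<dots> = e i \<otimes> x"
        using y(2)[OF assms(1)] assms idem_closed by (simp add: m_lcomm)
      finally show ?thesis using True assms lift_at_component by simp
    next
      case False
      then show ?thesis using k y assms lift_at_component by simp
    qed
    finally show "e k \<otimes> x = e k \<otimes> (lift_at i b \<otimes> y)" by simp
  qed (use assms y in auto)
  then show thesis using that y assms by simp
qed

text \<open>An atom has exactly one component that is not a unit.\<close>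

lemma atom_index:
  assumes "atom R p"
  obtains i where "i < n" "\<not> unit_at i p" "\<And>k. k < n \<Longrightarrow> k \<noteq> i \<Longrightarrow> unit_at k p"
proof -
  note pc = atom_closed[OF assms]
  obtain i where i: "i < n" "\<not> unit_at i p"
    using Units_iff_components atom_nonunit[OF assms] pc by blast
  obtain y where y: "y \<in> carrier R" "e i \<otimes> y = e i \<otimes> \<one>" "p = lift_at i p \<otimes> y"
    using split_at[OF i(1) pc one_closed pc] pc by auto
  have "unit_at i y"
    using unit_at_component_cong[OF i(1) y(1) one_closed y(2)] i(1) idem_closed
    by (auto simp: unit_at_def intro!: bexI[of _ \<one>])
  then have "\<not> p divides y" using unit_at_divides[OF i(1) pc] i(2) by blast
  then have "p divides lift_at i p"
    using atomD[OF assms _ y(1) y(3)] i(1) pc by simp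
  then have "unit_at k p" if "k < n" "k \<noteq> i" for k
    using unit_at_divides[OF that(1) pc] unit_at_lift_at[OF i(1) that(1) pc that(2)] by blast
  then show thesis using that i by blast
qed

end

text \<open>A ring that is a finite product of domains, given by idempotents.\<close>

locale domain_decomposition = idempotent_decomposition +
  assumes corner_domain: "i < n \<Longrightarrow> domain (corner R (e i))"
begin

lemma idem_nonzero: "i < n \<Longrightarrow> e i \<noteq> \<zero>"
  using domain.one_not_zero[OF corner_domain] by auto

lemma integral_at:
  assumes "i < n" "x \<in> carrier R" "y \<in> carrier R" "e i \<otimes> (x \<otimes> y) = \<zero>"
  shows "e i \<otimes> x = \<zero> \<or> e i \<otimes> y = \<zero>"
  using corner_domain_integral[OF corner_domain idem_closed idem] assms by blast

lemma cancel_at: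
  assumes "i < n" "x \<in> carrier R" "y \<in> carrier R" "z \<in> carrier R" "e i \<otimes> x \<noteq> \<zero>"
    "e i \<otimes> (x \<otimes> y) = e i \<otimes> (x \<otimes> z)"
  shows "e i \<otimes> y = e i \<otimes> z"
proof -
  have "e i \<otimes> (x \<otimes> (y \<ominus> z)) = e i \<otimes> (x \<otimes> y) \<ominus> e i \<otimes> (x \<otimes> z)"
    using assms(2-4) idem_closed[OF assms(1)] by algebra
  also have "\<dots> = \<zero>"
    using assms idem_closed by (simp add: r_neg minus_eq)
  finally have "e i \<otimes> (y \<ominus> z) = \<zero>"
    using integral_at[of i x "y \<ominus> z"] assms by simp
  moreover have "e i \<otimes> (y \<ominus> z) = e i \<otimes> y \<ominus> e i \<otimes> z"
    using assms(3,4) idem_closed[OF assms(1)] by algebra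
  ultimately show ?thesis
    using assms idem_closed r_right_minus_eq by simp
qed

lemma lift_at_zero_atom:
  assumes "i < n"
  shows "atom R (lift_at i \<zero>)"
proof (rule atomI)
  have c: "e k \<otimes> lift_at i \<zero> = (if k = i then \<zero> else e k)" if "k < n" for k
    using lift_at_component[OF assms that zero_closed] idem_closed[OF assms] by simp
  have "\<not> unit_at i (lift_at i \<zero>)"
    using c[OF assms] idem_nonzero[OF assms] assms idem_closed
    by (auto simp: unit_at_def m_assoc[symmetric])
  then show "lift_at i \<zero> \<notin> Units R" using Units_iff_components assms by blast
  fix b x assume bx: "b \<in> carrier R" "x \<in> carrier R" "lift_at i \<zero> = b \<otimes> x"
  have *: "lift_at i \<zero> divides y" if "y \<in> carrier R" "e i \<otimes> y = \<zero>" for y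
  proof -
    have "e k \<otimes> y = e k \<otimes> (lift_at i \<zero> \<otimes> y)" if "k < n" for k
      using c[OF that] \<open>y \<in> carrier R\<close> \<open>e i \<otimes> y = \<zero>\<close> assms that idem_closed
      by (auto simp: m_assoc[symmetric])
    then show ?thesis
      using divides_iff_components[of "lift_at i \<zero>" y] that assms by auto
  qed
  have "e i \<otimes> (b \<otimes> x) = \<zero>" using c[OF assms] bx(3) by simp
  then show "lift_at i \<zero> divides b \<or> lift_at i \<zero> divides x"
    using integral_at[OF assms bx(1,2)] * bx by blast
qed (use assms in simp)

text \<open>An irreducible element of a corner, extended by 1, is an atom of the whole ring.\<close>

lemma lift_at_irreducible_atom:
  assumes i: "i < n" and p: "p \<in> carrier (corner R (e i))" "ring_irreducible\<^bsub>corner R (e i)\<^esub> p"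
  shows "atom R (lift_at i p)"
proof (rule atomI)
  interpret C: domain "corner R (e i)" by (rule corner_domain[OF i])
  have pc: "p \<in> carrier R" "e i \<otimes> p = p" using p by auto
  note pE = C.ring_irreducibleE[OF p]
  show "lift_at i p \<in> carrier R" using i pc by simp
  have "\<not> unit_at i p" using pE(4) unit_at_iff_corner[OF i pc(1)] pc by simp
  then show "lift_at i p \<notin> Units R"
    using unit_at_lift_at_same[OF i pc(1)] Units_iff_components i by blast
  fix b c assume bc: "b \<in> carrier R" "c \<in> carrier R" "lift_at i p = b \<otimes> c"
  have unit: "x \<in> Units R"
    if "x \<in> carrier R" "x divides lift_at i p" "e i \<otimes> x \<in> Units (corner R (e i))" for x
    unfolding Units_iff_components
    using that unit_at_lift_at[OF i _ pc(1)] unit_at_divides[OF _ that(1,2)] unit_at_iff_corner[OF i that(1)]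
    by metis
  have "p = e i \<otimes> (b \<otimes> c)"
    using lift_at_component[OF i i pc(1)] pc bc by simp
  also have "\<dots> = (e i \<otimes> b) \<otimes> (e i \<otimes> c)"
    using bc idem_closed[OF i] idem_l[OF i] by (simp add: m_ac)
  finally have "p = (e i \<otimes> b) \<otimes>\<^bsub>corner R (e i)\<^esub> (e i \<otimes> c)" by simp
  then consider "e i \<otimes> b \<in> Units (corner R (e i))" | "e i \<otimes> c \<in> Units (corner R (e i))"
    using pE(5)[of "e i \<otimes> b" "e i \<otimes> c"] bc idem_closed[OF i] idem_l[OF i] by auto
  then show "lift_at i p divides b \<or> lift_at i p divides c"
  proof cases
    case 1
    then have "b \<in> Units R" using unit[of b] bc by (auto simp: factor_def)
    then have "lift_at i p divides c"
      using divides_cancel_unit[of b "lift_at i p" c] bc i pc by (metis divides_refl lift_at_closed)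
    then show ?thesis ..
  next
    case 2
    then have "c \<in> Units R" using unit[of c] bc m_comm by (auto simp: factor_def)
    then have "lift_at i p divides b"
      using divides_cancel_unit[of c "lift_at i p" b] bc i pc m_comm
      by (metis divides_refl lift_at_closed)
    then show ?thesis ..
  qed
qed

text \<open>A nonzero component and units elsewhere make an element regular.\<close>

lemma regularI:
  assumes "p \<in> carrier R" "i < n" "e i \<otimes> p \<noteq> \<zero>" "\<And>k. k < n \<Longrightarrow> k \<noteq> i \<Longrightarrow> unit_at k p"
    and "x \<in> carrier R" "y \<in> carrier R" "p \<otimes> x = p \<otimes> y"
  shows "x = y"
proof (rule components_eqI[OF assms(5,6)])
  fix k assume k: "k < n"
  have "e k \<otimes> p \<noteq> \<zero>"
  proof (cases "k = i")
    case False
    then obtain z where z: "z \<in> carrier R" "e k \<otimes> (p \<otimes> z) = e k"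
      using assms(4) k unfolding unit_at_def by blast
    then show ?thesis
      using idem_nonzero[OF k] assms(1) idem_closed[OF k] by (auto simp: m_assoc[symmetric])
  qed (use assms in simp)
  then show "e k \<otimes> x = e k \<otimes> y" using cancel_at[OF k assms(1,5,6)] assms by simp
qed

lemma atom_component_irreducible:
  assumes p: "atom R p" and i: "i < n" "\<not> unit_at i p" "e i \<otimes> p \<noteq> \<zero>"
  shows "ring_irreducible\<^bsub>corner R (e i)\<^esub> (e i \<otimes> p)"
proof -
  interpret C: domain "corner R (e i)" by (rule corner_domain[OF i(1)])
  note pc = atom_closed[OF p] and ec = idem_closed[OF i(1)]
  show ?thesis
  proof (rule C.ring_irreducibleI)
    show "e i \<otimes> p \<in> carrier (corner R (e i)) - {\<zero>\<^bsub>corner R (e i)\<^esub>}"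
      using i pc ec idem_l by simp
    show "e i \<otimes> p \<notin> Units (corner R (e i))"
      using unit_at_iff_corner i pc by blast
    fix b c
    assume "b \<in> carrier (corner R (e i))" "c \<in> carrier (corner R (e i))"
      and "e i \<otimes> p = b \<otimes>\<^bsub>corner R (e i)\<^esub> c"
    then have bc: "b \<in> carrier R" "c \<in> carrier R" "e i \<otimes> b = b" "e i \<otimes> c = c" "e i \<otimes> p = b \<otimes> c"
      by auto
    have eq: "e i \<otimes> p = e i \<otimes> (b \<otimes> c)" using bc idem_l[OF i(1) pc] by metis
    have nz: "e i \<otimes> b \<noteq> \<zero>" "e i \<otimes> c \<noteq> \<zero>" using bc i(3) by auto
    obtain y where y: "y \<in> carrier R" "e i \<otimes> y = e i \<otimes> c" "p = lift_at i b \<otimes> y"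
      using split_at[OF i(1) bc(1,2) pc eq] by blast
    consider "p divides lift_at i b" | "p divides y"
      using atomD[OF p _ y(1,3)] i(1) bc(1) by auto
    then have "unit_at i b \<or> unit_at i c"
    proof cases
      case 1
      then obtain t where t: "t \<in> carrier R" "lift_at i b = p \<otimes> t" by (auto simp: factor_def)
      have "e i \<otimes> (b \<otimes> \<one>) = e i \<otimes> lift_at i b"
        using lift_at_component[OF i(1,1) bc(1)] bc by simp
      also have "\<dots> = (e i \<otimes> p) \<otimes> t" using t pc ec by (simp add: m_assoc)
      also have "\<dots> = e i \<otimes> (b \<otimes> (c \<otimes> t))" 
        unfolding eq using t(1) bc(1,2) ec by (simp add: m_assoc)
      finally have "e i \<otimes> \<one> = e i \<otimes> (c \<otimes> t)"
        using cancel_at[OF i(1) bc(1) one_closed _ nz(1), of "c \<otimes> t"] bc t by simp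
      then have "e i \<otimes> (c \<otimes> t) = e i" using ec by simp
      then show ?thesis using t by (auto simp: unit_at_def)
    next
      case 2
      then obtain t where t: "t \<in> carrier R" "y = p \<otimes> t" by (auto simp: factor_def)
      have "e i \<otimes> (c \<otimes> \<one>) = e i \<otimes> y" using bc(2) y(2) by simp
      also have "\<dots> = (e i \<otimes> p) \<otimes> t" using t pc ec by (simp add: m_assoc)
      also have "\<dots> = e i \<otimes> (c \<otimes> (b \<otimes> t))"
        unfolding eq using t(1) bc(1,2) ec by (simp add: m_ac)
      finally have "e i \<otimes> \<one> = e i \<otimes> (b \<otimes> t)"
        using cancel_at[OF i(1) bc(2) one_closed _ nz(2), of "b \<otimes> t"] bc t by simp
      then have "e i \<otimes> (b \<otimes> t) = e i" using ec by simp
      then show ?thesis using t by (auto simp: unit_at_def)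
    qed
    then show "b \<in> Units (corner R (e i)) \<or> c \<in> Units (corner R (e i))"
      using unit_at_iff_corner[OF i(1)] bc by metis
  qed
qed

end

section \<open>Products of factorial domains are reduced unique factorization rings\<close>

lemma (in cring) pow_divides_cancel:
  assumes p: "p \<in> carrier R"
    and regular: "\<And>x y. \<lbrakk>x \<in> carrier R; y \<in> carrier R; p \<otimes> x = p \<otimes> y\<rbrakk> \<Longrightarrow> x = y"
    and prime: "\<And>x y. \<lbrakk>x \<in> carrier R; y \<in> carrier R; p divides x \<otimes> y\<rbrakk> \<Longrightarrow> p divides x \<or> p divides y"
    and a: "a \<in> carrier R" "\<not> p divides a"
  shows "x \<in> carrier R \<Longrightarrow> p [^] (k::nat) divides a \<otimes> x \<longleftrightarrow> p [^] k divides x"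
proof (induction k arbitrary: x)
  case 0
  then show ?case using a one_divides by simp
next
  case (Suc k)
  show ?case
  proof
    assume "p [^] Suc k divides a \<otimes> x"
    then obtain t where t: "t \<in> carrier R" "a \<otimes> x = (p [^] k \<otimes> p) \<otimes> t"
      by (auto simp: factor_def)
    have eq: "a \<otimes> x = p \<otimes> (p [^] k \<otimes> t)" using t p by (simp add: m_ac)
    then have "p divides a \<otimes> x" using t p by (auto simp: factor_def)
    then have "p divides x" using prime a Suc.prems by blast
    then obtain x' where x': "x' \<in> carrier R" "x = p \<otimes> x'" by (auto simp: factor_def)
    have "p \<otimes> (a \<otimes> x') = p \<otimes> (p [^] k \<otimes> t)"
      using eq x' a p m_lcomm[of a p x'] by simp
    then have "a \<otimes> x' = p [^] k \<otimes> t"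
      using regular x' a p t by simp
    then have "p [^] k divides a \<otimes> x'" using t by (auto simp: factor_def)
    then have "p [^] k divides x'" using Suc.IH x' by blast
    then obtain s where s: "s \<in> carrier R" "x' = p [^] k \<otimes> s" by (auto simp: factor_def)
    have "x = p [^] Suc k \<otimes> s" using x' s p by (simp add: m_ac)
    then show "p [^] Suc k divides x" using s by (auto simp: factor_def)
  next
    assume "p [^] Suc k divides x"
    then obtain s where s: "s \<in> carrier R" "x = p [^] Suc k \<otimes> s" by (auto simp: factor_def)
    then have "a \<otimes> x = p [^] Suc k \<otimes> (a \<otimes> s)" using a p m_lcomm by simp
    then show "p [^] Suc k divides a \<otimes> x" using s a by (metis dividesI' m_closed)
  qed
qed

text \<open>
  The multiplicity of a regular prime element \<open>p\<close> in a product, each of whose factors is either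
  associated to \<open>p\<close> or not divisible by \<open>p\<close>, is the number of factors divisible by \<open>p\<close>.
\<close>

lemma (in cring) pow_divides_finprod_iff:
  assumes p: "p \<in> carrier R" "p \<notin> Units R"
    and regular: "\<And>x y. \<lbrakk>x \<in> carrier R; y \<in> carrier R; p \<otimes> x = p \<otimes> y\<rbrakk> \<Longrightarrow> x = y"
    and prime: "\<And>x y. \<lbrakk>x \<in> carrier R; y \<in> carrier R; p divides x \<otimes> y\<rbrakk> \<Longrightarrow> p divides x \<or> p divides y"
    and "finite J" "f \<in> J \<rightarrow> carrier R"
    and "\<And>j. j \<in> J \<Longrightarrow> p divides f j \<Longrightarrow> f j divides p"
  shows "p [^] (k::nat) divides finprod R f J \<longleftrightarrow> k \<le> card {j \<in> J. p divides f j}"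
  using assms(5-7)
proof (induction J arbitrary: k rule: finite_induct)
  case empty
  have "\<not> p [^] Suc k divides \<one>" for k
  proof
    assume "p [^] Suc k divides \<one>"
    then obtain t where "t \<in> carrier R" "\<one> = p \<otimes> (p [^] k \<otimes> t)"
      using p by (auto simp: factor_def m_ac)
    then show False using p Units_iff by (metis m_closed nat_pow_closed)
  qed
  then show ?case by (cases k) (auto simp: one_divides)
next
  case (insert j J)
  have fj: "f j \<in> carrier R" "f \<in> J \<rightarrow> carrier R" using insert.prems by auto
  let ?Q = "finprod R f J"
  have Q: "?Q \<in> carrier R" using fj by simp
  have prod: "finprod R f (insert j J) = f j \<otimes> ?Q" using insert.hyps fj by simp
  have IH: "p [^] k divides ?Q \<longleftrightarrow> k \<le> card {j \<in> J. p divides f j}" for k :: nat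
    using insert.IH[OF fj(2)] insert.prems(2) by blast
  show ?case
  proof (cases "p divides f j")
    case False
    have pdc: "p [^] k divides f j \<otimes> ?Q \<longleftrightarrow> p [^] k divides ?Q"
      by (rule pow_divides_cancel[OF p(1) _ _ fj(1) False Q]) (erule (2) regular, erule (2) prime)
    from False have "{j' \<in> insert j J. p divides f j'} = {j \<in> J. p divides f j}" by auto
    then show ?thesis
      using pdc IH prod by simp
  next
    case True
    then have "{j' \<in> insert j J. p divides f j'} = insert j {j \<in> J. p divides f j}" by auto
    then have card: "card {j' \<in> insert j J. p divides f j'} = Suc (card {j \<in> J. p divides f j})"
      using insert.hyps by simp
    obtain w where w: "w \<in> carrier R" "f j = p \<otimes> w" using True by (auto simp: factor_def)
    obtain v where v: "v \<in> carrier R" "p = f j \<otimes> v"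
      using insert.prems(2)[of j] True by (auto simp: factor_def)
    have "p \<otimes> (w \<otimes> v) = (p \<otimes> w) \<otimes> v" using w(1) v(1) p(1) by (simp add: m_assoc)
    also have "\<dots> = p \<otimes> \<one>" unfolding w(2)[symmetric] v(2)[symmetric] using p(1) by simp
    finally have "p \<otimes> (w \<otimes> v) = p \<otimes> \<one>" .
    then have "w \<otimes> v = \<one>" using regular[of "w \<otimes> v" \<one>] w(1) v(1) one_closed by blast
    then have wU: "w \<in> Units R" using w v Units_iff by blast
    have "p [^] Suc k divides f j \<otimes> ?Q \<longleftrightarrow> p [^] k divides ?Q" for k :: nat
    proof -
      have "p [^] Suc k divides f j \<otimes> ?Q \<longleftrightarrow> p [^] k divides w \<otimes> ?Q"
      proof
        assume "p [^] Suc k divides f j \<otimes> ?Q"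
        then obtain t where t: "t \<in> carrier R" "f j \<otimes> ?Q = p [^] Suc k \<otimes> t"
          by (auto simp: factor_def)
        have "p \<otimes> (w \<otimes> ?Q) = f j \<otimes> ?Q" using w p Q by (simp add: m_assoc)
        also have "\<dots> = p \<otimes> (p [^] k \<otimes> t)" unfolding t(2) using t(1) p by (simp add: m_ac)
        finally have "w \<otimes> ?Q = p [^] k \<otimes> t" 
          using regular[of "w \<otimes> ?Q" "p [^] k \<otimes> t"] w(1) Q p(1) t(1) by blast
        then show "p [^] k divides w \<otimes> ?Q" using t by (auto simp: factor_def)
      next
        assume "p [^] k divides w \<otimes> ?Q"
        then obtain t where t: "t \<in> carrier R" "w \<otimes> ?Q = p [^] k \<otimes> t"
          by (auto simp: factor_def)
        have "f j \<otimes> ?Q = p \<otimes> (w \<otimes> ?Q)" using w p Q by (simp add: m_assoc)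
        also have "\<dots> = p [^] Suc k \<otimes> t" unfolding t(2) using t(1) p by (simp add: m_ac)
        finally show "p [^] Suc k divides f j \<otimes> ?Q" using t by (auto simp: factor_def)
      qed
      then show ?thesis using divides_cancel_unit[OF wU _ Q] p by simp
    qed
    then show ?thesis
      using IH card prod one_divides fj Q by (cases k) auto
  qed
qed

text \<open>Two finite families in which every value occurs equally often agree up to a bijection.\<close>

lemma bij_betw_of_equal_fibres:
  assumes "\<And>c. card {j \<in> {1..n::nat}. F j = c} = card {j \<in> {1..m::nat}. G j = c}"
  shows "n = m \<and> (\<exists>\<sigma>. bij_betw \<sigma> {1..n} {1..n} \<and> (\<forall>i\<in>{1..n}. F i = G (\<sigma> i)))"
proof -
  have eq: "image_mset F (mset_set {1..n}) = image_mset G (mset_set {1..m})"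
    using assms by (intro multiset_eqI) (simp add: count_image_mset_eq_card_vimage)
  then have "size (mset_set {1..n}) = size (mset_set {1..m})"
    by (metis size_image_mset)
  then have nm: "n = m" by simp
  obtain \<sigma> where "\<sigma> permutes {1..n}" "\<forall>i\<in>{1..n}. F i = G (\<sigma> i)"
    using image_mset_eq_implies_permutes[of "{1..n}" F G] eq nm by auto
  then show ?thesis using nm permutes_imp_bij by blast
qed

text \<open>
  The ring is a finite product of factorial domains, and these have trivial units unless there is
  only one of them. So a single factorial domain with arbitrary units is included.
\<close>

locale ufd_decomposition = domain_decomposition +
  assumes corner_factorial: "i < n \<Longrightarrow> factorial_domain (corner R (e i))"
    and corner_units: "i < n \<Longrightarrow> k < n \<Longrightarrow> i \<noteq> k \<Longrightarrow> Units (corner R (e i)) = {e i}"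
begin

lemma finprod_lift_at_component:
  assumes "finite J" "J \<subseteq> {..<n}" "a \<in> carrier R" "k < n"
  shows "e k \<otimes> finprod R (\<lambda>i. lift_at i a) J = (if k \<in> J then e k \<otimes> a else e k)"
  using assms(1,2)
proof (induction J rule: finite_induct)
  case empty
  then show ?case using assms idem_closed by simp
next
  case (insert j J)
  let ?Q = "finprod R (\<lambda>i. lift_at i a) J"
  have j: "j < n" "lift_at j a \<in> carrier R" "(\<lambda>i. lift_at i a) \<in> J \<rightarrow> carrier R"
    using insert.prems assms by auto
  have Q: "?Q \<in> carrier R" using j by simp
  have "e k \<otimes> finprod R (\<lambda>i. lift_at i a) (insert j J) = (e k \<otimes> lift_at j a) \<otimes> ?Q"
    using insert.hyps j assms(4) Q idem_closed by (simp add: m_assoc)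
  also have "\<dots> = (if k \<in> insert j J then e k \<otimes> a else e k)"
  proof (cases "k = j")
    case True
    have "(e k \<otimes> lift_at j a) \<otimes> ?Q = (e j \<otimes> a) \<otimes> ?Q"
      using True lift_at_component[OF j(1,1) assms(3)] by simp
    also have "\<dots> = a \<otimes> (e j \<otimes> ?Q)"
      using Q j assms(3) idem_closed by (simp add: m_ac)
    also have "\<dots> = a \<otimes> e j"
      using insert True by simp
    finally show ?thesis using True assms(3) idem_closed[OF j(1)] by (simp add: m_comm)
  next
    case False
    then show ?thesis
      using insert lift_at_component[OF j(1) assms(4,3)] by simp
  qed
  finally show ?case .
qed

theorem atomic: "atomic_ring R"
proof (rule atomic_ringI)
  fix a assume a: "a \<in> carrier R"
  have "\<exists>S. atom_product R (lift_at i a) S" if i: "i < n" for i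
  proof (cases "e i \<otimes> a = \<zero>")
    case True
    then have "lift_at i a = lift_at i \<zero>"
      using idem_closed[OF i] by (simp add: lift_at_def)
    then show ?thesis using lift_at_zero_atom[OF i] atom_product_atom by metis
  next
    case False
    interpret F: factorial_domain "corner R (e i)" by (rule corner_factorial[OF i])
    have c: "e i \<otimes> a \<in> carrier (corner R (e i))" "e i \<otimes> a \<noteq> \<zero>\<^bsub>corner R (e i)\<^esub>"
      using False a idem_closed[OF i] idem_l[OF i] by simp_all
    have "\<exists>S. atom_product R (lift_at i (e i \<otimes> a)) S"
    proof (rule F.factorial_induct[where Q = "\<lambda>c. \<exists>S. atom_product R (lift_at i c) S", OF c])
      fix u assume uU: "u \<in> Units (corner R (e i))"
      then have u: "u \<in> carrier R" "e i \<otimes> u = u" using F.Units_closed[OF uU] by simp_all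
      have "unit_at i u" using unit_at_iff_corner[OF i u(1)] uU u(2) by simp
      then have "lift_at i u \<in> Units R"
        unfolding Units_iff_components
        using unit_at_lift_at[OF i _ u(1)] unit_at_lift_at_same[OF i u(1)] i u(1)
        by (metis lift_at_closed)
      then show "\<exists>S. atom_product R (lift_at i u) S" using atom_product_unit by blast
    next
      fix p c
      assume p: "p \<in> carrier (corner R (e i))" "ring_irreducible\<^bsub>corner R (e i)\<^esub> p"
        and c: "c \<in> carrier (corner R (e i))" "\<exists>S. atom_product R (lift_at i c) S"
      have "atom_product R (lift_at i p) {lift_at i p}"
        using lift_at_irreducible_atom[OF i p] atom_product_atom by blast
      then have "\<exists>S. atom_product R (lift_at i p \<otimes> lift_at i c) S"
        using c(2) atom_product_mult by blast
      moreover have "lift_at i (p \<otimes> c) = lift_at i p \<otimes> lift_at i c"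
        using lift_at_mult[OF i] p(1) c(1) by simp
      ultimately show "\<exists>S. atom_product R (lift_at i (p \<otimes>\<^bsub>corner R (e i)\<^esub> c)) S" by simp
    qed
    moreover have "lift_at i (e i \<otimes> a) = lift_at i a"
      using idem_l[OF i a] by (simp add: lift_at_def)
    ultimately show ?thesis by simp
  qed
  then have "\<exists>S. atom_product R (finprod R (\<lambda>i. lift_at i a) {..<n}) S"
    using a by (intro atom_product_finprod) auto
  moreover have "finprod R (\<lambda>i. lift_at i a) {..<n} = a"
    by (rule components_eqI) (use a finprod_lift_at_component[of "{..<n}" a] in auto)
  ultimately show "\<exists>S. atom_product R a S" by simp
qed

lemma component_eq_of_unit_at:
  assumes "k < n" "i < n" "k \<noteq> i" "x \<in> carrier R" "unit_at k x"
  shows "e k \<otimes> x = e k"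
  using unit_at_iff_corner[OF assms(1,4)] corner_units[OF assms(1-3)] assms by simp

lemma component_zero_divides:
  assumes "i < n" "x \<in> carrier R" "x divides y" "e i \<otimes> x = \<zero>"
  shows "e i \<otimes> y = \<zero>"
proof -
  obtain t where t: "t \<in> carrier R" "y = x \<otimes> t" using assms(3) by (auto simp: factor_def)
  then have "e i \<otimes> y = (e i \<otimes> x) \<otimes> t"
    using assms(1,2) idem_closed by (simp add: m_assoc)
  then show ?thesis using assms(4) t(1) by simp
qed

lemma not_unit_at_zero:
  assumes "i < n" "x \<in> carrier R" "e i \<otimes> x = \<zero>"
  shows "\<not> unit_at i x"
  using component_zero_divides[OF assms(1,2) _ assms(3)] idem_nonzero[OF assms(1)]
  unfolding unit_at_def by (metis dividesI')

text \<open>The only atom with vanishing \<open>i\<close>-th component has all other components 1.\<close>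

lemma zero_atom_unique:
  assumes "atom R q" "i < n" "e i \<otimes> q = \<zero>"
  shows "q = lift_at i \<zero>"
proof (rule components_eqI)
  note qc = atom_closed[OF assms(1)]
  obtain i' where i': "i' < n" "\<not> unit_at i' q" "\<And>k. k < n \<Longrightarrow> k \<noteq> i' \<Longrightarrow> unit_at k q"
    by (rule atom_index[OF assms(1)]) (rule that; blast)
  then have "i' = i" using not_unit_at_zero[OF assms(2) qc assms(3)] assms(2) by blast
  fix k assume k: "k < n"
  show "e k \<otimes> q = e k \<otimes> lift_at i \<zero>"
    using k assms i' \<open>i' = i\<close> qc component_eq_of_unit_at[OF k assms(2)]
      lift_at_component[OF assms(2) k zero_closed] idem_closed by (cases "k = i") auto
qed (use assms atom_closed in auto)

text \<open>An atom whose nonunit component is nonzero is prime, because that component is irreducible.\<close>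

lemma atom_prime:
  assumes p: "atom R p" and i: "i < n" "\<not> unit_at i p" "e i \<otimes> p \<noteq> \<zero>"
    and units: "\<And>k. k < n \<Longrightarrow> k \<noteq> i \<Longrightarrow> unit_at k p"
    and xy: "x \<in> carrier R" "y \<in> carrier R" "p divides x \<otimes> y"
  shows "p divides x \<or> p divides y"
proof -
  interpret F: factorial_domain "corner R (e i)" by (rule corner_factorial[OF i(1)])
  note pc = atom_closed[OF p] and ec = idem_closed[OF i(1)]
  have cl: "e i \<otimes> z \<in> carrier (corner R (e i))" if "z \<in> carrier R" for z
    using that ec idem_l[OF i(1)] by simp
  note div = corner_divides_iff[OF ec idem[OF i(1)], of "e i \<otimes> p"]
  have pr: "prime (corner R (e i)) (e i \<otimes> p)"
    using F.ring_irreducible_imp_prime[OF cl[OF pc] atom_component_irreducible[OF p i]]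
    by (simp add: ring_prime_def)
  obtain t where t: "t \<in> carrier R" "x \<otimes> y = p \<otimes> t" using xy by (auto simp: factor_def)
  have "(e i \<otimes> x) \<otimes> (e i \<otimes> y) = (e i \<otimes> e i) \<otimes> (x \<otimes> y)"
    using xy(1,2) ec by (simp add: m_ac)
  also have "\<dots> = (e i \<otimes> p) \<otimes> t"
    using idem[OF i(1)] ec pc t by (simp add: m_assoc)
  finally have "(e i \<otimes> p) divides (e i \<otimes> x) \<otimes> (e i \<otimes> y)"
    using t by (auto simp: factor_def)
  then have "(e i \<otimes> p) divides (e i \<otimes> x) \<or> (e i \<otimes> p) divides (e i \<otimes> y)"
    using pr cl[OF xy(1)] cl[OF xy(2)] div pc ec idem_l[OF i(1)] unfolding prime_def by simp
  moreover have "p divides z" if z: "z \<in> carrier R" "(e i \<otimes> p) divides (e i \<otimes> z)" for z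
    unfolding divides_iff_components[OF pc z(1)]
  proof (intro allI impI)
    fix k assume k: "k < n"
    show "\<exists>t\<in>carrier R. e k \<otimes> z = e k \<otimes> (p \<otimes> t)"
    proof (cases "k = i")
      case True
      then show ?thesis using z pc ec by (auto simp: factor_def m_assoc)
    next
      case False
      then obtain v where v: "v \<in> carrier R" "e k \<otimes> (p \<otimes> v) = e k"
        using units[OF k] unfolding unit_at_def by blast
      have "e k \<otimes> (p \<otimes> (v \<otimes> z)) = (e k \<otimes> (p \<otimes> v)) \<otimes> z"
        using v(1) z(1) pc idem_closed[OF k] by (simp add: m_assoc)
      then show ?thesis using v z(1) by (metis m_closed)
    qed
  qed
  ultimately show ?thesis using xy by blast
qed

lemma atom_divisor_associated:
  assumes p: "atom R p" "i < n" "\<not> unit_at i p"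
    and q: "atom R q" "e i \<otimes> q \<noteq> \<zero>" "p divides q"
  shows "q divides p"
proof -
  note pc = atom_closed[OF p(1)] and qc = atom_closed[OF q(1)]
  obtain c where c: "c \<in> carrier R" "q = p \<otimes> c" using q(3) by (auto simp: factor_def)
  have "\<not> q divides c"
  proof
    assume "q divides c"
    then obtain d where d: "d \<in> carrier R" "c = q \<otimes> d" by (auto simp: factor_def)
    have "q \<otimes> \<one> = q \<otimes> (p \<otimes> d)"
      using c(2) unfolding d(2) using d(1) qc pc by (simp add: m_ac)
    then have "e i \<otimes> \<one> = e i \<otimes> (p \<otimes> d)"
      using cancel_at[OF p(2) qc one_closed _ q(2), of "p \<otimes> d"] pc d(1) by simp
    then show False using p d idem_closed by (auto simp: unit_at_def)
  qed
  then show ?thesis using atomD[OF q(1) pc c] by blast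
qed

text \<open>
  The associates of an atom \<open>p\<close> with index \<open>i\<close> are counted in a reduced atomic factorization of \<open>a\<close>. In each
  of the three cases, the result depends only on \<open>a\<close> and \<open>p\<close>.
\<close>

context
  fixes a u N f p i
  assumes fac: "atomic_factorization R a u N f" and red: "reduced_factorization R a u N f"
    and p: "atom R p" and i: "i < n" "\<not> unit_at i p"
    and units: "\<And>k. k < n \<Longrightarrow> k \<noteq> i \<Longrightarrow> unit_at k p"
begin

private lemma basic:
  shows "u \<in> Units R" "\<And>j. j \<in> {1..N} \<Longrightarrow> atom R (f j)" "f \<in> {1..N} \<rightarrow> carrier R"
    "a = u \<otimes> finprod R f {1..N}" "p \<in> carrier R"
proof -
  show u: "u \<in> Units R" and "a = u \<otimes> finprod R f {1..N}"
    using fac unfolding atomic_factorization_def mu_factorization_def by blast+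
  show at: "atom R (f j)" if "j \<in> {1..N}" for j
    using fac that unfolding atomic_factorization_def by blast
  show "f \<in> {1..N} \<rightarrow> carrier R" by (intro funcsetI atom_closed at)
  show "p \<in> carrier R" using p by (rule atom_closed)
qed

lemma count_component_zero:
  assumes "e i \<otimes> a = \<zero>"
  shows "card {j \<in> {1..N}. assoc_elems R (f j) p} = (if e i \<otimes> p = \<zero> then 1 else 0)"
proof -
  have ex: "\<exists>j\<in>J. e i \<otimes> f j = \<zero>"
    if "finite J" "f \<in> J \<rightarrow> carrier R" "e i \<otimes> finprod R f J = \<zero>" for J
    using that
  proof (induction J rule: finite_induct)
    case empty
    then show ?case using idem_nonzero[OF i(1)] idem_closed[OF i(1)] by simp
  next
    case (insert j J)
    then show ?case
      using integral_at[OF i(1), of "f j" "finprod R f J"] by auto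
  qed
  have "unit_at i u" using Units_iff_components basic(1) i(1) by blast
  then have "e i \<otimes> u \<noteq> \<zero>" using not_unit_at_zero i(1) basic(1) Units_closed by blast
  then have "e i \<otimes> finprod R f {1..N} = \<zero>"
    using integral_at[OF i(1), of u "finprod R f {1..N}"] assms basic Units_closed by auto
  then obtain j0 where j0: "j0 \<in> {1..N}" "e i \<otimes> f j0 = \<zero>"
    using ex[of "{1..N}"] basic(3) by auto
  have fc: "f j \<in> carrier R" if "j \<in> {1..N}" for j using basic(3) that by auto
  \<comment> \<open>A second factor with index \<open>i\<close> could be omitted: it changes neither the \<open>i\<close>-th component of the
    product, which stays 0, nor the other ones, where it is 1.\<close>
  have other: "unit_at i (f j)" if j: "j \<in> {1..N}" "j \<noteq> j0" for j
  proof (rule ccontr)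
    assume nu: "\<not> unit_at i (f j)"
    obtain i' where i': "i' < n" "\<not> unit_at i' (f j)"
      "\<And>k. k < n \<Longrightarrow> k \<noteq> i' \<Longrightarrow> unit_at k (f j)"
      by (rule atom_index[OF basic(2)[OF j(1)]]) (rule that; blast)
    have "i' = i" using i' nu i(1) by blast
    let ?Q = "finprod R f ({1..N} - {j})"
    have QI: "f \<in> {1..N} - {j} \<rightarrow> carrier R" using basic(3) by auto
    then have Q: "?Q \<in> carrier R" by simp
    have prod: "finprod R f {1..N} = f j \<otimes> ?Q"
      using finprod_insert[of "{1..N} - {j}" j f] QI fc[OF j(1)] j(1) by (simp add: insert_absorb)
    have "f j0 divides ?Q"
    proof -
      let ?Q' = "finprod R f ({1..N} - {j} - {j0})"
      have "?Q = f j0 \<otimes> ?Q'"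
        using finprod_insert[of "{1..N} - {j} - {j0}" j0 f] QI fc[OF j0(1)] j0(1) j(2)
        by (simp add: insert_absorb Pi_iff)
      then show ?thesis using QI by (auto simp: factor_def Pi_iff)
    qed
    then have zQ: "e i \<otimes> ?Q = \<zero>"
      using component_zero_divides[OF i(1) fc[OF j0(1)]] j0(2) by blast
    have "f j \<otimes> ?Q = ?Q"
    proof (rule components_eqI)
      fix k assume k: "k < n"
      show "e k \<otimes> (f j \<otimes> ?Q) = e k \<otimes> ?Q"
      proof (cases "k = i")
        case True
        then show ?thesis
          using zQ m_lcomm[OF idem_closed[OF k] fc[OF j(1)] Q] fc[OF j(1)] by simp
      next
        case False
        then have "e k \<otimes> f j = e k"
          using component_eq_of_unit_at[OF k i(1) False fc[OF j(1)]] i' \<open>i' = i\<close> k by blast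
        then show ?thesis
          using m_assoc[OF idem_closed[OF k] fc[OF j(1)] Q] by simp
      qed
    qed (use Q fc[OF j(1)] in auto)
    then show False
      using red j(1) prod by (auto simp: reduced_factorization_def)
  qed
  have nj0: "\<not> unit_at i (f j0)" using not_unit_at_zero[OF i(1) fc[OF j0(1)] j0(2)] .
  have no: "\<not> assoc_elems R (f j) p" if j: "j \<in> {1..N}" "j \<noteq> j0" for j
    using other[OF j] unit_at_divides[OF i(1) basic(5)] i(2) assoc_elems_iff[OF fc[OF j(1)] basic(5)]
    by blast
  show ?thesis
  proof (cases "e i \<otimes> p = \<zero>")
    case True
    then have "f j0 = p"
      using zero_atom_unique[OF p i(1)] zero_atom_unique[OF basic(2)[OF j0(1)] i(1) j0(2)] by simp
    then have "{j \<in> {1..N}. assoc_elems R (f j) p} = {j0}"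
      using no j0 by (auto simp: assoc_elems_def)
    then show ?thesis using True by simp
  next
    case False
    then have "\<not> assoc_elems R (f j0) p"
      using component_zero_divides[OF i(1) fc[OF j0(1)] _ j0(2)] assoc_elems_iff[OF fc[OF j0(1)] basic(5)]
      by blast
    then have "{j \<in> {1..N}. assoc_elems R (f j) p} = {}" using no by blast
    then show ?thesis using False by simp
  qed
qed

lemma factor_component_nonzero:
  assumes "e i \<otimes> a \<noteq> \<zero>" "j \<in> {1..N}"
  shows "e i \<otimes> f j \<noteq> \<zero>"
proof
  have fc: "f j \<in> carrier R" using basic(3) assms(2) by auto
  assume z: "e i \<otimes> f j = \<zero>"
  let ?Q = "finprod R f ({1..N} - {j})"
  have QI: "f \<in> {1..N} - {j} \<rightarrow> carrier R" using basic(3) by auto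
  have "finprod R f {1..N} = f j \<otimes> ?Q"
    using finprod_insert[of "{1..N} - {j}" j f] QI fc assms(2) by (simp add: insert_absorb)
  then have "a = f j \<otimes> (u \<otimes> ?Q)"
    using basic(1,4) fc QI Units_closed by (simp add: m_lcomm)
  then have "f j divides a"
    using QI basic(1) Units_closed by (auto simp: factor_def)
  then show False using component_zero_divides[OF i(1) fc _ z] assms(1) by blast
qed

lemma count_component_nonzero:
  assumes a: "e i \<otimes> a \<noteq> \<zero>" and "e i \<otimes> p \<noteq> \<zero>"
  shows "p [^] (k::nat) divides a \<longleftrightarrow> k \<le> card {j \<in> {1..N}. assoc_elems R (f j) p}"
proof -
  have fc: "f j \<in> carrier R" if "j \<in> {1..N}" for j using basic(3) that by auto
  have assoc: "f j divides p" if "j \<in> {1..N}" "p divides f j" for j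
    using atom_divisor_associated[OF p i basic(2)[OF that(1)] factor_component_nonzero[OF a that(1)] that(2)] .
  have "p [^] k divides a \<longleftrightarrow> p [^] k divides finprod R f {1..N}"
    unfolding basic(4) using basic(1,3,5) by (intro divides_cancel_unit) auto
  also have "\<dots> \<longleftrightarrow> k \<le> card {j \<in> {1..N}. p divides f j}"
  proof (rule pow_divides_finprod_iff[OF basic(5) atom_nonunit[OF p]])
    show "x = y" if "x \<in> carrier R" "y \<in> carrier R" "p \<otimes> x = p \<otimes> y" for x y
      using regularI[OF basic(5) i(1) assms(2) units that] .
    show "p divides x \<or> p divides y" if "x \<in> carrier R" "y \<in> carrier R" "p divides x \<otimes> y" for x y
      using atom_prime[OF p i assms(2) units that] .
  qed (use basic(3) assoc in auto)
  also have "{j \<in> {1..N}. p divides f j} = {j \<in> {1..N}. assoc_elems R (f j) p}"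
    using assoc assoc_elems_iff[OF fc basic(5)] by blast
  finally show ?thesis .
qed

lemma count_component_mixed:
  assumes a: "e i \<otimes> a \<noteq> \<zero>" and "e i \<otimes> p = \<zero>"
  shows "card {j \<in> {1..N}. assoc_elems R (f j) p} = 0"
proof -
  have fc: "f j \<in> carrier R" if "j \<in> {1..N}" for j using basic(3) that by auto
  have "\<not> assoc_elems R (f j) p" if j: "j \<in> {1..N}" for j
    using component_zero_divides[OF i(1) basic(5) _ assms(2), of "f j"]
      factor_component_nonzero[OF a j] assoc_elems_iff[OF fc[OF j] basic(5)] by blast
  then have "{j \<in> {1..N}. assoc_elems R (f j) p} = {}" by blast
  then show ?thesis by (simp only: card.empty)
qed

end

theorem reduced_ufr: "reduced_ufr R"
  unfolding reduced_ufr_def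
proof (intro conjI ballI allI impI, rule atomic)
  fix a u v N M f g
  assume a: "a \<in> nonunits R"
    and fg: "atomic_factorization R a u N f \<and> reduced_factorization R a u N f \<and>
      atomic_factorization R a v M g \<and> reduced_factorization R a v M g"
  then have f: "atomic_factorization R a u N f" "reduced_factorization R a u N f"
    and g: "atomic_factorization R a v M g" "reduced_factorization R a v M g" by blast+
  have atom_count: "card {j \<in> {1..N}. assoc_elems R (f j) p} = card {j \<in> {1..M}. assoc_elems R (g j) p}"
    if p: "atom R p" for p
  proof -
    obtain i where i: "i < n" "\<not> unit_at i p" "\<And>k. k < n \<Longrightarrow> k \<noteq> i \<Longrightarrow> unit_at k p"
      by (rule atom_index[OF p]) (rule that; blast)
    show ?thesis
    proof (cases "e i \<otimes> a = \<zero>")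
      case True
      then show ?thesis
        using count_component_zero[OF f p i True] count_component_zero[OF g p i True] by simp
    next
      case False
      show ?thesis
      proof (cases "e i \<otimes> p = \<zero>")
        case True
        have "card {j \<in> {1..N}. assoc_elems R (f j) p} = 0"
          by (rule count_component_mixed[OF f p i(1,2) _ False True]) (erule (1) i(3))
        moreover have "card {j \<in> {1..M}. assoc_elems R (g j) p} = 0"
          by (rule count_component_mixed[OF g p i(1,2) _ False True]) (erule (1) i(3))
        ultimately show ?thesis by (simp only:)
      next
        case nz: False
        have "k \<le> card {j \<in> {1..N}. assoc_elems R (f j) p} \<longleftrightarrow>
            k \<le> card {j \<in> {1..M}. assoc_elems R (g j) p}" for k
          using count_component_nonzero[OF f p i False nz, of k]
            count_component_nonzero[OF g p i False nz, of k] by simp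
        from this[of "card {j \<in> {1..N}. assoc_elems R (f j) p}"]
          this[of "card {j \<in> {1..M}. assoc_elems R (g j) p}"]
        show ?thesis by (simp only: order_refl) (rule order_antisym; blast)
      qed
    qed
  qed
  have fa: "\<And>j. j \<in> {1..N} \<Longrightarrow> atom R (f j)" "\<And>j. j \<in> {1..M} \<Longrightarrow> atom R (g j)"
    using f g by (auto simp: atomic_factorization_def)
  have "card {j \<in> {1..N}. PIdl (f j) = c} = card {j \<in> {1..M}. PIdl (g j) = c}" for c
  proof (cases "\<exists>p. atom R p \<and> c = PIdl p")
    case True
    then show ?thesis using atom_count unfolding assoc_elems_def by auto
  next
    case False
    then have "{j \<in> {1..N}. PIdl (f j) = c} = {}" "{j \<in> {1..M}. PIdl (g j) = c} = {}"
      using fa by auto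
    then show ?thesis by (simp only: card.empty)
  qed
  from bij_betw_of_equal_fibres[OF this]
  show "same_up_to_order R N f M g"
    unfolding same_up_to_order_def assoc_elems_def .
qed

end

section \<open>Unique factorization of regular elements\<close>

text \<open>Elements that are not zero divisors.\<close>

definition regular_elem :: "('a, 'm) ring_scheme \<Rightarrow> 'a \<Rightarrow> bool" where
  "regular_elem A a \<longleftrightarrow> a \<in> carrier A \<and> (\<forall>x\<in>carrier A. a \<otimes>\<^bsub>A\<^esub> x = \<zero>\<^bsub>A\<^esub> \<longrightarrow> x = \<zero>\<^bsub>A\<^esub>)"

context cring
begin

lemma regular_elem_cancel:
  assumes "regular_elem R a" "x \<in> carrier R" "y \<in> carrier R" "a \<otimes> x = a \<otimes> y"
  shows "x = y"
proof -
  have a: "a \<in> carrier R" using assms(1) by (simp add: regular_elem_def)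
  have "a \<otimes> (x \<ominus> y) = a \<otimes> x \<ominus> a \<otimes> y" using a assms(2,3) by algebra
  also have "\<dots> = \<zero>" using a assms by (simp add: r_neg minus_eq)
  finally have "x \<ominus> y = \<zero>" using assms by (simp add: regular_elem_def)
  then show ?thesis using assms r_right_minus_eq by simp
qed

lemma regular_elem_mult:
  assumes "regular_elem R a" "regular_elem R b"
  shows "regular_elem R (a \<otimes> b)"
proof -
  have ab: "a \<in> carrier R" "b \<in> carrier R" using assms by (simp_all add: regular_elem_def)
  have "x = \<zero>" if "x \<in> carrier R" "(a \<otimes> b) \<otimes> x = \<zero>" for x
    using assms that ab m_assoc[OF ab that(1)] unfolding regular_elem_def by (metis m_closed)
  then show ?thesis using ab by (simp add: regular_elem_def)
qed

lemma regular_elem_nonzero: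
  assumes "regular_elem R a" "\<one> \<noteq> \<zero>"
  shows "a \<noteq> \<zero>"
  using assms unfolding regular_elem_def by (metis l_null one_closed)

text \<open>
  No proper subproduct of a factorization of a regular element can have the same value, since the
  complementary product would be 1.
\<close>

lemma regular_strongly_reduced:
  assumes reg: "regular_elem R a" and fac: "atomic_factorization R a u n f"
  shows "strongly_reduced_factorization R a u n f"
  unfolding strongly_reduced_factorization_def
proof (intro conjI allI impI notI)
  show mu: "mu_factorization R a u n f" using fac by (simp add: atomic_factorization_def)
  have u: "u \<in> Units R" and a: "a = u \<otimes> finprod R f {1..n}" "a \<in> carrier R"
    and f: "\<And>j. j \<in> {1..n} \<Longrightarrow> atom R (f j)"
    using fac reg unfolding atomic_factorization_def mu_factorization_def regular_elem_def by blast+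
  have fc: "f \<in> {1..n} \<rightarrow> carrier R" by (intro funcsetI atom_closed f)
  fix I assume I: "I \<subset> {1..n}" and eq: "u \<otimes> finprod R f {1..n} = u \<otimes> finprod R f I"
  have fI: "f \<in> I \<rightarrow> carrier R" "f \<in> {1..n} - I \<rightarrow> carrier R" using fc I by auto
  have fin: "finite I" using I finite_subset[of I "{1..n}"] by blast
  have un: "I \<union> ({1..n} - I) = {1..n}" using I by blast
  have split: "finprod R f {1..n} = finprod R f I \<otimes> finprod R f ({1..n} - I)"
    using finprod_Un_disjoint[OF fin _ _ fI] unfolding un by auto
  have "a \<otimes> \<one> = u \<otimes> (finprod R f I \<otimes> finprod R f ({1..n} - I))"
    using a split by simp
  also have "\<dots> = (u \<otimes> finprod R f I) \<otimes> finprod R f ({1..n} - I)"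
    using u fI Units_closed by (simp add: m_assoc)
  also have "\<dots> = a \<otimes> finprod R f ({1..n} - I)" using a(1) eq by simp
  finally have one: "\<one> = finprod R f ({1..n} - I)"
    using regular_elem_cancel[OF reg one_closed, of "finprod R f ({1..n} - I)"] fI by simp
  obtain j where j: "j \<in> {1..n}" "j \<notin> I" using I by blast
  have f': "f \<in> {1..n} - I - {j} \<rightarrow> carrier R" using fI by auto
  have "{1..n} - I = insert j ({1..n} - I - {j})" using j by blast
  then have "finprod R f ({1..n} - I) = f j \<otimes> finprod R f ({1..n} - I - {j})"
    using finprod_insert[of "{1..n} - I - {j}" j f] f' atom_closed[OF f[OF j(1)]] by simp
  then have "f j \<in> Units R"
    unfolding Units_iff using one atom_closed[OF f[OF j(1)]] f' by (metis finprod_closed)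
  then show False using atom_nonunit[OF f[OF j(1)]] by blast
qed

lemma atom_product_exists:
  assumes "atomic_ring R" "a \<in> carrier R" "a \<noteq> \<zero>"
  shows "\<exists>S. atom_product R a S"
proof (cases "a \<in> Units R")
  case True
  then show ?thesis using atom_product_unit by blast
next
  case False
  then have "a \<in> nonunits R - {\<zero>}" using assms by (simp add: nonunits_def)
  then obtain n f where f: "\<forall>i\<in>{1..n::nat}. atom R (f i)" "a = finprod R f {1..n}"
    using assms(1) unfolding atomic_ring_def by blast
  have "f \<in> {1..n} \<rightarrow> carrier R" using f(1) by (auto intro!: atom_closed)
  then have "a = \<one> \<otimes> finprod R f {1..n}" using f by simp
  then show ?thesis using f(1) unfolding atom_product_def by blast
qed

lemma atom_product_divides:
  assumes "atom_product R a S" "p \<in> S"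
  shows "atom R p" "p divides a"
proof -
  obtain u n f where f: "u \<in> Units R" "\<forall>i\<in>{1..n::nat}. atom R (f i)"
    "a = u \<otimes> finprod R f {1..n}" "S = f ` {1..n}"
    using assms(1) unfolding atom_product_def by blast
  obtain j where j: "j \<in> {1..n}" "p = f j" using f(4) assms(2) by blast
  show p: "atom R p" using j f by blast
  have f': "f \<in> {1..n} - {j} \<rightarrow> carrier R" using f(2) by (auto intro!: atom_closed)
  have "{1..n} = insert j ({1..n} - {j})" using j by blast
  then have "finprod R f {1..n} = p \<otimes> finprod R f ({1..n} - {j})"
    using finprod_insert[of "{1..n} - {j}" j f] f' atom_closed[OF p] j by simp
  then have "a = p \<otimes> (u \<otimes> finprod R f ({1..n} - {j}))"
    using f(1,3) f' atom_closed[OF p] Units_closed m_lcomm by simp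
  then show "p divides a"
    using f(1) f' Units_closed by (metis dividesI' finprod_closed m_closed)
qed

lemma regular_unique_atoms:
  assumes ufr: "weak_strongly_reduced_ufr R" and "\<one> \<noteq> \<zero>"
    and reg: "regular_elem R a" "a \<notin> Units R"
    and S: "atom_product R a S" and T: "atom_product R a T" and p: "p \<in> S"
  shows "\<exists>q\<in>T. p divides q"
proof -
  have a: "a \<in> nonunits R" "a \<noteq> \<zero>"
    using reg regular_elem_nonzero[OF reg(1) assms(2)] by (simp_all add: nonunits_def regular_elem_def)
  have fac: "atomic_factorization R a u n f"
    if "u \<in> Units R" "\<forall>i\<in>{1..n}. atom R (f i)" "a = u \<otimes> finprod R f {1..n}" for u n f
    using that a(1) unfolding atomic_factorization_def mu_factorization_def by (simp add: atom_def)
  obtain u n f where f: "u \<in> Units R" "\<forall>i\<in>{1..n::nat}. atom R (f i)"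
    "a = u \<otimes> finprod R f {1..n}" "S = f ` {1..n}"
    using S unfolding atom_product_def by blast
  obtain v m g where g: "v \<in> Units R" "\<forall>i\<in>{1..m::nat}. atom R (g i)"
    "a = v \<otimes> finprod R g {1..m}" "T = g ` {1..m}"
    using T unfolding atom_product_def by blast
  note F = fac[OF f(1-3)] and G = fac[OF g(1-3)]
  have "same_up_to_order R n f m g"
    using ufr a F G regular_strongly_reduced[OF reg(1)] unfolding weak_strongly_reduced_ufr_def by blast
  then obtain \<sigma> where \<sigma>: "n = m" "bij_betw \<sigma> {1..n} {1..n}" "\<forall>i\<in>{1..n}. assoc_elems R (f i) (g (\<sigma> i))"
    unfolding same_up_to_order_def by blast
  obtain j where j: "j \<in> {1..n}" "p = f j" using f(4) p by blast
  have \<sigma>j: "\<sigma> j \<in> {1..m}" using \<sigma>(1,2) j(1) bij_betwE by blast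
  have "f j \<in> carrier R" "g (\<sigma> j) \<in> carrier R"
    using f(2) g(2) j(1) \<sigma>j by (auto intro!: atom_closed)
  then have "p divides g (\<sigma> j)"
    using assoc_elems_iff[of "f j" "g (\<sigma> j)"] \<sigma>(3) j by blast
  then show ?thesis using \<sigma>j g(4) by blast
qed

text \<open>Regular atoms behave like primes as far as regular elements are concerned.\<close>

lemma regular_atom_prime:
  assumes ufr: "weak_strongly_reduced_ufr R" and one: "\<one> \<noteq> \<zero>"
    and p: "atom R p" and cl: "x \<in> carrier R" "q \<in> carrier R" "r \<in> carrier R"
    and eq: "p \<otimes> x = q \<otimes> r" and reg: "regular_elem R (q \<otimes> r)"
  shows "p divides q \<or> p divides r"
proof -
  note pc = atom_closed[OF p]
  have at: "atomic_ring R" using ufr by (simp add: weak_strongly_reduced_ufr_def)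
  have nz: "q \<noteq> \<zero>" "r \<noteq> \<zero>" "x \<noteq> \<zero>"
    using regular_elem_nonzero[OF reg one] eq cl pc by auto
  obtain Sx where Sx: "atom_product R x Sx" using atom_product_exists[OF at cl(1) nz(3)] by blast
  obtain Sq where Sq: "atom_product R q Sq" using atom_product_exists[OF at cl(2) nz(1)] by blast
  obtain Sr where Sr: "atom_product R r Sr" using atom_product_exists[OF at cl(3) nz(2)] by blast
  have px: "atom_product R (q \<otimes> r) ({p} \<union> Sx)"
    using atom_product_mult[OF atom_product_atom[OF p] Sx] eq by simp
  have "q \<otimes> r \<notin> Units R"
    using atom_nonunit[OF p] unit_factor[of p x] eq pc cl by metis
  then obtain t where t: "t \<in> Sq \<union> Sr" "p divides t"
    using regular_unique_atoms[OF ufr one reg _ px atom_product_mult[OF Sq Sr], of p] by blast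
  then have "t divides q \<or> t divides r"
    using atom_product_divides(2)[OF Sq] atom_product_divides(2)[OF Sr] by blast
  then show ?thesis using divides_trans[OF t(2)] pc by blast
qed

end

section \<open>Products of domains with unique factorization\<close>

context domain_decomposition
begin

lemma lift_at_regular:
  assumes "i < n" "x \<in> carrier R" "e i \<otimes> x \<noteq> \<zero>"
  shows "regular_elem R (lift_at i x)"
  unfolding regular_elem_def
proof (intro conjI ballI impI)
  fix y assume y: "y \<in> carrier R" "lift_at i x \<otimes> y = \<zero>"
  have lc: "lift_at i x \<in> carrier R" using assms by simp
  have "lift_at i x \<otimes> y = lift_at i x \<otimes> \<zero>" using y lc by simp
  moreover have "e i \<otimes> lift_at i x \<noteq> \<zero>" using lift_at_component[OF assms(1,1,2)] assms(3) by simp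
  ultimately show "y = \<zero>"
    using regularI[OF lc assms(1) _ _ y(1) zero_closed] unit_at_lift_at[OF assms(1) _ assms(2)] by blast
qed (use assms in simp)

text \<open>
  Each atom has a unit or an irreducible element as its component in a corner, if that component is
  nonzero.
\<close>

lemma corner_atomic:
  assumes i: "i < n" and at: "atomic_ring R"
    and x: "x \<in> carrier (corner R (e i))" "x \<noteq> \<zero>"
  shows "\<exists>fs. set fs \<subseteq> {p \<in> carrier (corner R (e i)). ring_irreducible\<^bsub>corner R (e i)\<^esub> p} \<and>
    foldr (\<otimes>\<^bsub>corner R (e i)\<^esub>) fs \<one>\<^bsub>corner R (e i)\<^esub> \<sim>\<^bsub>corner R (e i)\<^esub> x"
proof -
  let ?C = "corner R (e i)"
  interpret C: domain ?C by (rule corner_domain[OF i])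
  note ec = idem_closed[OF i]
  \<comment> \<open>\<open>Q c\<close>: up to a unit, \<open>c\<close> is a product of irreducible elements of the corner.\<close>
  define Q where "Q c \<longleftrightarrow> (\<exists>fs. set fs \<subseteq> {p \<in> carrier ?C. ring_irreducible\<^bsub>?C\<^esub> p} \<and>
    foldr (\<otimes>\<^bsub>?C\<^esub>) fs \<one>\<^bsub>?C\<^esub> \<sim>\<^bsub>?C\<^esub> c)" for c
  have fold_closed: "foldr (\<otimes>\<^bsub>?C\<^esub>) fs \<one>\<^bsub>?C\<^esub> \<in> carrier ?C"
    if "set fs \<subseteq> {p \<in> carrier ?C. ring_irreducible\<^bsub>?C\<^esub> p}" for fs
    using that by (intro C.multlist_closed) blast
  have Qone: "Q \<one>\<^bsub>?C\<^esub>"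
    unfolding Q_def by (rule exI[of _ "[]"]) (simp only: list.set foldr.simps id_apply C.associated_refl
      C.one_closed empty_subsetI simp_thms)
  have Qirr: "Q (p \<otimes>\<^bsub>?C\<^esub> c)" if p: "p \<in> carrier ?C" "ring_irreducible\<^bsub>?C\<^esub> p"
    and c: "c \<in> carrier ?C" "Q c" for p c
  proof -
    obtain fs where fs: "set fs \<subseteq> {p \<in> carrier ?C. ring_irreducible\<^bsub>?C\<^esub> p}"
      "foldr (\<otimes>\<^bsub>?C\<^esub>) fs \<one>\<^bsub>?C\<^esub> \<sim>\<^bsub>?C\<^esub> c"
      using c(2) unfolding Q_def by blast
    have "p \<otimes>\<^bsub>?C\<^esub> foldr (\<otimes>\<^bsub>?C\<^esub>) fs \<one>\<^bsub>?C\<^esub> \<sim>\<^bsub>?C\<^esub> p \<otimes>\<^bsub>?C\<^esub> c"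
      using C.mult_cong_r[OF fs(2) p(1) fold_closed[OF fs(1)] c(1)] .
    moreover have "set (p # fs) \<subseteq> {p \<in> carrier ?C. ring_irreducible\<^bsub>?C\<^esub> p}"
      using fs(1) p by (simp only: list.set insert_subset mem_Collect_eq simp_thms)
    ultimately show ?thesis
      unfolding Q_def by (intro exI[of _ "p # fs"]) (simp only: foldr.simps o_apply simp_thms)
  qed
  have Qunit: "Q (u \<otimes>\<^bsub>?C\<^esub> c)" if u: "u \<in> Units ?C" and c: "c \<in> carrier ?C" "Q c" for u c
  proof -
    obtain fs where fs: "set fs \<subseteq> {p \<in> carrier ?C. ring_irreducible\<^bsub>?C\<^esub> p}"
      "foldr (\<otimes>\<^bsub>?C\<^esub>) fs \<one>\<^bsub>?C\<^esub> \<sim>\<^bsub>?C\<^esub> c"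
      using c(2) unfolding Q_def by blast
    have uc: "u \<otimes>\<^bsub>?C\<^esub> c \<in> carrier ?C" using C.m_closed[OF C.Units_closed[OF u] c(1)] .
    have "u \<otimes>\<^bsub>?C\<^esub> c \<sim>\<^bsub>?C\<^esub> c"
      using C.ring_associated_iff[OF uc c(1)] u by blast
    then have "foldr (\<otimes>\<^bsub>?C\<^esub>) fs \<one>\<^bsub>?C\<^esub> \<sim>\<^bsub>?C\<^esub> u \<otimes>\<^bsub>?C\<^esub> c"
      using C.associated_trans[OF fs(2) C.associated_sym fold_closed[OF fs(1)] uc] by blast
    then show ?thesis unfolding Q_def using fs(1) by blast
  qed
  have xc: "x \<in> carrier R" "e i \<otimes> x = x" using x(1) by simp_all
  have l0: "lift_at i x \<noteq> \<zero>"
    using lift_at_component[OF i i xc(1)] xc x(2) ec by auto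
  obtain S where "atom_product R (lift_at i x) S"
    using atom_product_exists[OF at _ l0] i xc by auto
  then obtain u m f where f: "u \<in> Units R" "\<forall>j\<in>{1..m::nat}. atom R (f j)"
    "lift_at i x = u \<otimes> finprod R f {1..m}"
    unfolding atom_product_def by blast
  have fc: "f \<in> {1..m} \<rightarrow> carrier R" using f(2) by (auto intro!: atom_closed)
  have uc: "u \<in> carrier R" using f(1) by (rule Units_closed)
  have cl: "e i \<otimes> y \<in> carrier ?C" if "y \<in> carrier R" for y
    using that ec idem_l[OF i] by simp
  have mult: "e i \<otimes> (y \<otimes> z) = (e i \<otimes> y) \<otimes>\<^bsub>?C\<^esub> (e i \<otimes> z)"
    if "y \<in> carrier R" "z \<in> carrier R" for y z
  proof -
    have "(e i \<otimes> y) \<otimes> (e i \<otimes> z) = e i \<otimes> (e i \<otimes> (y \<otimes> z))"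
      using that ec by (simp add: m_ac)
    then show ?thesis using idem_l[OF i, of "y \<otimes> z"] that by simp
  qed
  have prod: "Q (e i \<otimes> finprod R f J)" if "finite J" "J \<subseteq> {1..m}" "e i \<otimes> finprod R f J \<noteq> \<zero>" for J
    using that
  proof (induction J rule: finite_induct)
    case empty
    then show ?case using Qone ec by simp
  next
    case (insert j J)
    have fj: "f j \<in> carrier R" "atom R (f j)" and fJ: "f \<in> J \<rightarrow> carrier R"
      using insert.prems fc f(2) by auto
    let ?P = "finprod R f J"
    have P: "?P \<in> carrier R" using fJ by simp
    have ins: "e i \<otimes> finprod R f (insert j J) = (e i \<otimes> f j) \<otimes>\<^bsub>?C\<^esub> (e i \<otimes> ?P)"
      using insert.hyps fj fJ mult[OF fj(1) P] by simp
    have nz: "e i \<otimes> f j \<noteq> \<zero>" "e i \<otimes> ?P \<noteq> \<zero>"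
      using insert.prems(2) ins cl[OF fj(1)] cl[OF P] by auto
    have QP: "Q (e i \<otimes> ?P)" using insert nz by blast
    show ?case
    proof (cases "unit_at i (f j)")
      case True
      then show ?thesis
        unfolding ins using unit_at_iff_corner[OF i fj(1)] Qunit[OF _ cl[OF P] QP] by blast
    next
      case False
      then show ?thesis
        unfolding ins
        using Qirr[OF cl[OF fj(1)] atom_component_irreducible[OF fj(2) i False nz(1)] cl[OF P] QP] by blast
    qed
  qed
  have eq: "x = (e i \<otimes> u) \<otimes>\<^bsub>?C\<^esub> (e i \<otimes> finprod R f {1..m})"
    using lift_at_component[OF i i xc(1)] xc f(3) mult[OF uc, of "finprod R f {1..m}"] fc by simp
  then have "e i \<otimes> finprod R f {1..m} \<noteq> \<zero>" using x(2) cl[OF uc] by auto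
  then have "Q (e i \<otimes> finprod R f {1..m})" using prod[of "{1..m}"] by blast
  moreover have "e i \<otimes> u \<in> Units ?C"
    using f(1) Units_iff_components unit_at_iff_corner[OF i uc] i by blast
  ultimately have "Q x"
    using Qunit[OF _ cl, of "e i \<otimes> u" "finprod R f {1..m}"] eq fc by simp
  then show ?thesis unfolding Q_def .
qed

text \<open>
  Irreducible elements of a corner become regular atoms when extended by 1 in the other components;
  unique factorization of regular elements then shows that they are prime.
\<close>

theorem corner_factorial_of_ufr:
  assumes ufr: "weak_strongly_reduced_ufr R" and i: "i < n"
  shows "factorial_domain (corner R (e i))"
proof -
  let ?C = "corner R (e i)"
  interpret C: domain ?C by (rule corner_domain[OF i])
  note ec = idem_closed[OF i]
  have one: "\<one> \<noteq> \<zero>" using idem_nonzero[OF i] ec by (metis l_null l_one)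
  show ?thesis
  proof (rule C.factorial_domainI_atomic)
    fix x assume "x \<in> carrier ?C - {\<zero>\<^bsub>?C\<^esub>}"
    then show "\<exists>fs. set fs \<subseteq> {p \<in> carrier ?C. ring_irreducible\<^bsub>?C\<^esub> p} \<and>
        foldr (\<otimes>\<^bsub>?C\<^esub>) fs \<one>\<^bsub>?C\<^esub> \<sim>\<^bsub>?C\<^esub> x"
      using ufr by (intro corner_atomic[OF i]) (simp_all add: weak_strongly_reduced_ufr_def)
  next
    fix p assume p: "p \<in> carrier ?C" "ring_irreducible\<^bsub>?C\<^esub> p"
    then have pc: "p \<in> carrier R" "e i \<otimes> p = p" by simp_all
    note at = lift_at_irreducible_atom[OF i p]
    note dvd = corner_divides_iff[OF ec idem[OF i] pc]
    have lift: "p divides x" if x: "x \<in> carrier R" "e i \<otimes> x = x" "lift_at i p divides lift_at i x" for x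
    proof -
      obtain t where t: "t \<in> carrier R" "lift_at i x = lift_at i p \<otimes> t"
        using x(3) by (auto simp: factor_def)
      have "x = e i \<otimes> (lift_at i p \<otimes> t)"
        using lift_at_component[OF i i x(1)] x(2) t(2) by simp
      also have "\<dots> = (e i \<otimes> lift_at i p) \<otimes> t"
        using t(1) ec i pc by (simp add: m_assoc)
      also have "\<dots> = p \<otimes> t" using lift_at_component[OF i i pc(1)] pc(2) by simp
      finally show ?thesis using t(1) by (auto simp: factor_def)
    qed
    show "ring_prime\<^bsub>?C\<^esub> p"
    proof (rule C.ring_primeI)
      show "p \<noteq> \<zero>\<^bsub>?C\<^esub>" using C.ring_irreducibleE(1)[OF p] .
      show "prime ?C p"
      proof (rule primeI)
        show "p \<notin> Units ?C" using C.ring_irreducibleE(4)[OF p] .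
        fix a b assume a: "a \<in> carrier ?C" and b: "b \<in> carrier ?C" and "p divides\<^bsub>?C\<^esub> a \<otimes>\<^bsub>?C\<^esub> b"
        then have ab: "a \<in> carrier R" "e i \<otimes> a = a" "b \<in> carrier R" "e i \<otimes> b = b"
          "p divides a \<otimes> b"
          using dvd by simp_all
        show "p divides\<^bsub>?C\<^esub> a \<or> p divides\<^bsub>?C\<^esub> b"
        proof (cases "a = \<zero> \<or> b = \<zero>")
          case True
          then show ?thesis using divides_zero[OF pc(1)] dvd by blast
        next
          case False
          then have nz: "a \<otimes> b \<noteq> \<zero>"
            using C.integral[of a b] a b by auto
          have eab: "e i \<otimes> (a \<otimes> b) = a \<otimes> b"
            using ab ec m_assoc[of "e i" a b] by simp
          obtain t where t: "t \<in> carrier R" "a \<otimes> b = p \<otimes> t" using ab(5) by (auto simp: factor_def)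
          have "lift_at i p \<otimes> lift_at i t = lift_at i a \<otimes> lift_at i b"
            using lift_at_mult[OF i] t pc ab by metis
          moreover have "regular_elem R (lift_at i a \<otimes> lift_at i b)"
            using lift_at_regular[OF i, of "a \<otimes> b"] lift_at_mult[OF i, of a b] nz eab ab by simp
          ultimately have "lift_at i p divides lift_at i a \<or> lift_at i p divides lift_at i b"
            using regular_atom_prime[OF ufr one at] i t ab by (meson lift_at_closed)
          then show ?thesis using lift ab dvd by blast
        qed
      qed
    qed
  qed
qed

text \<open>
  With two components, a nontrivial unit of one of them would allow to write an atom that is zero in
  the other component as a product of two atoms.
\<close>

theorem corner_units_of_ufr:
  assumes ufr: "weak_strongly_reduced_ufr R" and ik: "i < n" "k < n" "i \<noteq> k"
  shows "Units (corner R (e i)) = {e i}"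
proof -
  interpret C: domain "corner R (e i)" by (rule corner_domain[OF ik(1)])
  note ec = idem_closed[OF ik(1)]
  have "u = e i" if uU: "u \<in> Units (corner R (e i))" for u
  proof (rule ccontr)
    assume ne: "u \<noteq> e i"
    have uc: "u \<in> carrier R" "e i \<otimes> u = u" using C.Units_closed[OF uU] by simp_all
    define v where "v = lift_at i u"
    define z where "z = lift_at k \<zero>"
    have vc: "v \<in> carrier R" using ik uc by (simp add: v_def)
    have "unit_at i u" using unit_at_iff_corner[OF ik(1) uc(1)] uU uc by simp
    then have v: "v \<in> Units R"
      unfolding Units_iff_components v_def
      using unit_at_lift_at[OF ik(1) _ uc(1)] unit_at_lift_at_same[OF ik(1) uc(1)] vc v_def by metis
    then have iv: "inv v \<in> Units R" "inv v \<in> carrier R" by simp_all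
    have z: "atom R z" using lift_at_zero_atom[OF ik(2)] by (simp add: z_def)
    note zc = atom_closed[OF z]
    have zz: "z \<otimes> z = z"
      using lift_at_mult[OF ik(2) zero_closed zero_closed] by (simp add: z_def)
    have ez: "e i \<otimes> z = e i"
      using lift_at_component[OF ik(2,1) zero_closed] ik(3) by (simp add: z_def)
    have z0: "z \<noteq> \<zero>" using ez idem_nonzero[OF ik(1)] ec by auto
    have z1: "z \<noteq> \<one>" using atom_nonunit[OF z] by auto
    have vz: "v \<otimes> z \<noteq> z"
    proof
      assume "v \<otimes> z = z"
      then have "e i \<otimes> (v \<otimes> z) = e i" using ez by simp
      moreover have "e i \<otimes> (v \<otimes> z) = v \<otimes> (e i \<otimes> z)" using ec vc zc m_lcomm by simp
      moreover have "v \<otimes> e i = u"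
        using lift_at_component[OF ik(1,1) uc(1)] uc(2) m_comm[OF vc ec] by (simp add: v_def)
      ultimately show False using ez ne by simp
    qed
    have ivz: "inv v \<otimes> z \<noteq> z"
      using vz Units_inv_cancel(2)[OF v zc] by metis
    let ?f = "\<lambda>j::nat. z" and ?g = "\<lambda>j::nat. if j = 1 then v \<otimes> z else inv v \<otimes> z"
    have zn: "z \<in> nonunits R" using z by (simp add: atom_def)
    have atoms: "atom R (v \<otimes> z)" "atom R (inv v \<otimes> z)"
      using atom_unit_mult[OF z] v iv by blast+
    have c12: "{1..2::nat} = {1, 2}" by auto
    have prodg: "finprod R ?g {1..2} = z"
    proof -
      have "finprod R ?g {1..2} = (v \<otimes> z) \<otimes> (inv v \<otimes> z)"
        unfolding c12 using vc zc iv by simp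
      also have "\<dots> = (v \<otimes> inv v) \<otimes> (z \<otimes> z)" using vc zc iv(2) by (simp only: m_ac m_closed)
      finally show ?thesis using v zz zc by simp
    qed
    have prodf: "finprod R ?f {1..1} = z" using zc by simp
    have F: "atomic_factorization R z \<one> 1 ?f" "atomic_factorization R z \<one> 2 ?g"
      unfolding atomic_factorization_def mu_factorization_def
      using zn z atoms prodf prodg zc atoms by (auto simp: atom_def)
    have s1: "strongly_reduced_factorization R z \<one> 1 ?f"
      unfolding strongly_reduced_factorization_def
    proof (intro conjI allI impI)
      fix I assume "I \<subset> {1..1::nat}"
      then have "I = {}" by auto
      then show "\<one> \<otimes> finprod R ?f {1..1} \<noteq> \<one> \<otimes> finprod R ?f I"
        using zc z1 by simp
    qed (use F in \<open>simp add: atomic_factorization_def\<close>)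
    have s2: "strongly_reduced_factorization R z \<one> 2 ?g"
      unfolding strongly_reduced_factorization_def
    proof (intro conjI allI impI)
      fix I assume "I \<subset> {1..2::nat}"
      then consider "I = {}" | "I = {1}" | "I = {2}" unfolding c12 by blast
      then show "\<one> \<otimes> finprod R ?g {1..2} \<noteq> \<one> \<otimes> finprod R ?g I"
        unfolding prodg using zc vc iv(2) z1 vz ivz by cases auto
    qed (use F in \<open>simp add: atomic_factorization_def\<close>)
    have "same_up_to_order R 1 ?f 2 ?g"
      using ufr F s1 s2 zn z0 unfolding weak_strongly_reduced_ufr_def by blast
    then show False by (simp add: same_up_to_order_def)
  qed
  moreover have "e i \<in> Units (corner R (e i))" using C.Units_one_closed by simp
  ultimately show ?thesis by blast
qed

end

section \<open>The idempotents of a polynomial ring with unique factorization\<close>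

context UP_cring
begin

abbreviation indet :: "nat \<Rightarrow> 'a" where "indet \<equiv> up_ring.monom P \<one> 1"

lemma coeff_mult_0:
  assumes "p \<in> carrier P" "q \<in> carrier P"
  shows "cf (p \<cdot> q) 0 = cf p 0 \<otimes> cf q 0"
  using assms by simp

lemma coeff_mult_1:
  assumes "p \<in> carrier P" "q \<in> carrier P"
  shows "cf (p \<cdot> q) 1 =
    cf p 0 \<otimes> cf q 1 \<oplus> cf p 1 \<otimes> cf q 0"
proof -
  have "{..1::nat} = {0, 1}" by auto
  then show ?thesis using assms by (simp add: R.a_comm)
qed

lemma coeff_const_mult:
  assumes "a \<in> carrier R" "p \<in> carrier P"
  shows "cf (const a \<cdot> p) n = a \<otimes> cf p n"
  using monom_mult_is_smult[OF assms] assms by simp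

lemma coeff_indet_mult_Suc:
  assumes "p \<in> carrier P"
  shows "cf (indet \<cdot> p) (Suc n) = cf p n"
  using coeff_monom_mult[OF R.one_closed assms, of 1 n] assms by simp

lemma coeff_indet_mult_0:
  assumes "p \<in> carrier P"
  shows "cf (indet \<cdot> p) 0 = \<zero>"
  using coeff_mult_0[of indet p] assms by simp

lemma divisible_by_indet:
  assumes p: "p \<in> carrier P" "cf p 0 = \<zero>"
  obtains q where "q \<in> carrier P" "p = indet \<cdot> q"
proof -
  define q where "q n = cf p (Suc n)" for n
  have "bound \<zero> (deg R p) q"
    by (rule bound.intro) (use p in \<open>simp add: q_def deg_aboveD\<close>)
  then have up: "q \<in> up R"
    by (intro mem_upI) (auto simp: q_def p)
  then have q: "q \<in> carrier P" "\<And>n. cf q n = q n"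
    unfolding P_def UP_def by simp_all
  have "p = indet \<cdot> q"
  proof (rule up_eqI)
    fix n
    show "cf p n = cf (indet \<cdot> q) n"
    proof (cases n)
      case 0
      then show ?thesis using p(2) coeff_indet_mult_0[OF q(1)] by simp
    next
      case (Suc m)
      then show ?thesis
        using coeff_indet_mult_Suc[OF q(1)] q(2) q_def by simp
    qed
  qed (use p q in auto)
  then show thesis using that q by blast
qed

lemma monic_linear_regular:
  assumes c: "c \<in> carrier R" and s: "s \<in> carrier P"
    and eq: "(indet \<oplus>\<^bsub>P\<^esub> const c) \<cdot> s = \<zero>\<^bsub>P\<^esub>"
  shows "s = \<zero>\<^bsub>P\<^esub>"
proof (rule ccontr)
  assume s0: "s \<noteq> \<zero>\<^bsub>P\<^esub>"
  have "indet \<cdot> s \<oplus>\<^bsub>P\<^esub> const c \<cdot> s = \<zero>\<^bsub>P\<^esub>"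
    using eq s c P.l_distr[of indet "const c" s] by simp
  then have "cf (indet \<cdot> s \<oplus>\<^bsub>P\<^esub> const c \<cdot> s) (Suc (deg R s)) = \<zero>"
    using coeff_zero by simp
  then have "cf (indet \<cdot> s) (Suc (deg R s)) \<oplus>
      cf (const c \<cdot> s) (Suc (deg R s)) = \<zero>"
    using coeff_add s c by (metis P.m_closed R.one_closed monom_closed)
  then have "cf s (deg R s) = \<zero>"
    using coeff_indet_mult_Suc[OF s] coeff_const_mult[OF c s] deg_aboveD[of s "Suc (deg R s)"] s c by simp
  then show False using lcoeff_nonzero[OF s0 s] by blast
qed

lemma indet_cancel:
  assumes "p \<in> carrier P" "q \<in> carrier P" "indet \<cdot> p = indet \<cdot> q"
  shows "p = q"
proof (rule up_eqI)
  fix n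
  show "cf p n = cf q n"
    using coeff_indet_mult_Suc[OF assms(1), of n] coeff_indet_mult_Suc[OF assms(2), of n] assms(3) by simp
qed (use assms in auto)

text \<open>The product rule for the linear coefficient of a finite product.\<close>

lemma coeff_finprod_1:
  assumes "finite J" "f \<in> J \<rightarrow> carrier P"
  shows "cf (finprod P f J) 1 =
    (\<Oplus>j\<in>J. cf (f j) 1 \<otimes> cf (finprod P f (J - {j})) 0)"
  using assms
proof (induction J rule: finite_induct)
  case empty
  then show ?case by simp
next
  case (insert x J)
  have fx: "f x \<in> carrier P" and fJ: "f \<in> J \<rightarrow> carrier P" using insert.prems by auto
  have fJ': "f \<in> J - {j} \<rightarrow> carrier P" for j using fJ by auto
  let ?Q = "finprod P f J"
  have Q: "?Q \<in> carrier P" using fJ by simp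
  let ?t = "\<lambda>j. cf (f j) 1 \<otimes> cf (finprod P f (J - {j})) 0"
  let ?s = "\<lambda>j. cf (f j) 1 \<otimes> cf (finprod P f (insert x J - {j})) 0"
  have tc: "?t \<in> J \<rightarrow> carrier R"
    using fJ fJ' by (intro funcsetI R.m_closed coeff_closed P.finprod_closed) auto
  have eqs: "?s j = cf (f x) 0 \<otimes> ?t j" if j: "j \<in> J" for j
  proof -
    have fj: "f j \<in> carrier P" using fJ j by auto
    have "insert x J - {j} = insert x (J - {j})" using insert.hyps j by auto
    then have "finprod P f (insert x J - {j}) = f x \<cdot> finprod P f (J - {j})"
      using insert.hyps fx fJ'[of j] by simp
    then have "cf (finprod P f (insert x J - {j})) 0 =
        cf (f x) 0 \<otimes> cf (finprod P f (J - {j})) 0"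
      using coeff_mult_0[OF fx P.finprod_closed[OF fJ'[of j]]] by simp
    then show ?thesis
      using coeff_closed[OF fx] coeff_closed[OF fj] coeff_closed[OF P.finprod_closed[OF fJ'[of j]]]
      by (simp add: R.m_lcomm)
  qed
  have s_x: "?s x = cf (f x) 1 \<otimes> cf ?Q 0"
    using insert.hyps by simp
  have fJ'': "f \<in> insert x J - {j} \<rightarrow> carrier P" for j using insert.prems by auto
  have "?s j \<in> carrier R" if "f j \<in> carrier P" for j
    using that by (intro R.m_closed coeff_closed P.finprod_closed fJ'')
  then have sc: "?s \<in> J \<rightarrow> carrier R" "?s x \<in> carrier R"
    using fJ fx by blast+
  have "cf (finprod P f (insert x J)) 1 = cf (f x \<cdot> ?Q) 1"
    using insert.hyps fx fJ by simp
  also have "\<dots> = cf (f x) 0 \<otimes> cf ?Q 1 \<oplus> ?s x"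
    unfolding s_x by (rule coeff_mult_1[OF fx Q])
  also have "cf (f x) 0 \<otimes> cf ?Q 1 = (\<Oplus>j\<in>J. cf (f x) 0 \<otimes> ?t j)"
    unfolding insert.IH[OF fJ] using insert.hyps tc fx by (intro R.finsum_rdistr) auto
  also have "\<dots> = (\<Oplus>j\<in>J. ?s j)"
    using eqs sc by (intro R.finsum_cong') auto
  also have "(\<Oplus>j\<in>J. ?s j) \<oplus> ?s x = (\<Oplus>j\<in>insert x J. ?s j)"
    using insert.hyps sc R.a_comm by (subst R.finsum_insert) auto
  finally show ?case .
qed

context
  fixes f g
  assumes fg: "f \<in> carrier P" "g \<in> carrier P" "f \<cdot> g = indet"
begin

text \<open>
  The idempotent \<open>\<epsilon>\<close> given by a factorization \<open>fg\<close> of the indeterminate: where \<open>\<epsilon> = 1\<close>, the constant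
  coefficient of \<open>g\<close> is a unit and that of \<open>f\<close> is 0; where \<open>\<epsilon> = 0\<close>, it is the other way round.
\<close>

definition split_idem :: 'a where
  "split_idem = cf f 1 \<otimes> cf g 0"

private abbreviation "\<epsilon> \<equiv> split_idem"
private abbreviation "E \<equiv> const split_idem"

lemma split_idem_closed: "\<epsilon> \<in> carrier R"
  using fg by (simp add: split_idem_def)

private lemma coeffs:
  "cf f 0 \<otimes> cf g 0 = \<zero>"
  "cf f 0 \<otimes> cf g 1 \<oplus> \<epsilon> = \<one>"
proof -
  show "cf f 0 \<otimes> cf g 0 = \<zero>"
    using coeff_mult_0[OF fg(1,2)] fg(3) by simp
  show "cf f 0 \<otimes> cf g 1 \<oplus> \<epsilon> = \<one>"
    using coeff_mult_1[OF fg(1,2)] fg(3) by (simp add: split_idem_def)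
qed

private lemma compl: "\<one> \<ominus> \<epsilon> = cf f 0 \<otimes> cf g 1"
proof -
  have "\<one> \<ominus> \<epsilon> = (cf f 0 \<otimes> cf g 1 \<oplus> \<epsilon>) \<ominus> \<epsilon>"
    using coeffs(2) by simp
  also have "\<dots> = cf f 0 \<otimes> cf g 1"
    using split_idem_closed coeff_closed[OF fg(1), of 0] coeff_closed[OF fg(2), of 1] by algebra
  finally show ?thesis .
qed

lemma split_idem_mult_f0: "\<epsilon> \<otimes> cf f 0 = \<zero>"
proof -
  have "\<epsilon> \<otimes> cf f 0 =
      cf f 1 \<otimes> (cf f 0 \<otimes> cf g 0)"
    unfolding split_idem_def using fg(1,2) by (simp add: R.m_ac)
  then show ?thesis using coeffs(1) fg by simp
qed

lemma split_idem_compl_mult_g0: "(\<one> \<ominus> \<epsilon>) \<otimes> cf g 0 = \<zero>"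
proof -
  have "(\<one> \<ominus> \<epsilon>) \<otimes> cf g 0 =
      cf g 1 \<otimes> (cf f 0 \<otimes> cf g 0)"
    unfolding compl using fg(1,2) by (simp add: R.m_ac)
  then show ?thesis using coeffs(1) fg by simp
qed

lemma split_idem_idem: "\<epsilon> \<otimes> \<epsilon> = \<epsilon>"
proof -
  have "\<epsilon> = (cf f 0 \<otimes> cf g 1 \<oplus> \<epsilon>) \<otimes> \<epsilon>"
    using coeffs(2) split_idem_closed by simp
  also have "\<dots> = (\<epsilon> \<otimes> cf f 0) \<otimes> cf g 1 \<oplus> \<epsilon> \<otimes> \<epsilon>"
    using split_idem_closed coeff_closed[OF fg(1), of 0] coeff_closed[OF fg(2), of 1] by algebra
  finally show ?thesis
    using split_idem_mult_f0 fg split_idem_closed by simp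
qed

text \<open>The indeterminate of the corner \<open>\<epsilon>R\<close>, with 1 in the complementary corner.\<close>

definition corner_indet :: "nat \<Rightarrow> 'a" where
  "corner_indet = E \<cdot> indet \<oplus>\<^bsub>P\<^esub> (\<one>\<^bsub>P\<^esub> \<ominus>\<^bsub>P\<^esub> E)"

lemma E_closed: "E \<in> carrier P" and indet_closed: "indet \<in> carrier P"
  using split_idem_closed by simp_all

lemma E_idem: "E \<cdot> E = E"
  using const_mult[OF split_idem_closed split_idem_closed] split_idem_idem by simp

lemma corner_indet_closed: "corner_indet \<in> carrier P"
  using E_closed indet_closed by (simp add: corner_indet_def)

text \<open>A factor of the indeterminate is associated to the indeterminate of some corner.\<close>

lemma factor_of_indet:
  obtains w where "w \<in> Units P" "f \<cdot> w = corner_indet"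
proof -
  define F where "F = \<one>\<^bsub>P\<^esub> \<ominus>\<^bsub>P\<^esub> E"
  have F: "F \<in> carrier P" using E_closed by (simp add: F_def)
  note cl = E_closed indet_closed fg(1,2) F
  have FF: "F \<cdot> F = F" and EF: "E \<cdot> F = \<zero>\<^bsub>P\<^esub>"
  proof -
    have "E \<cdot> F = E \<ominus>\<^bsub>P\<^esub> E \<cdot> E" unfolding F_def using E_closed by algebra
    then show EF: "E \<cdot> F = \<zero>\<^bsub>P\<^esub>" using E_idem E_closed P.r_neg by (simp add: P.minus_eq)
    have "F \<cdot> F = F \<ominus>\<^bsub>P\<^esub> E \<cdot> F" unfolding F_def using E_closed by algebra
    then show "F \<cdot> F = F" using EF F by (simp add: P.minus_eq)
  qed
  have EF1: "E \<oplus>\<^bsub>P\<^esub> F = \<one>\<^bsub>P\<^esub>" unfolding F_def using E_closed by algebra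
  have Fc: "F = const (\<one> \<ominus> \<epsilon>)"
    unfolding F_def a_minus_def using split_idem_closed by simp
  have "cf (E \<cdot> f) 0 = \<zero>"
    using coeff_const_mult[OF split_idem_closed fg(1)] split_idem_mult_f0 by simp
  then obtain f' where f': "f' \<in> carrier P" "E \<cdot> f = indet \<cdot> f'"
    using divisible_by_indet[of "E \<cdot> f"] cl by blast
  have "cf (F \<cdot> g) 0 = \<zero>"
    unfolding Fc using coeff_const_mult[of "\<one> \<ominus> \<epsilon>" g] fg split_idem_closed split_idem_compl_mult_g0 by simp
  then obtain g' where g': "g' \<in> carrier P" "F \<cdot> g = indet \<cdot> g'"
    using divisible_by_indet[of "F \<cdot> g"] cl by blast
  have 1: "E \<cdot> (g \<cdot> f') = E"
  proof (rule indet_cancel)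
    have "indet \<cdot> (E \<cdot> (g \<cdot> f')) = E \<cdot> (g \<cdot> (indet \<cdot> f'))"
      using cl f'(1) by (simp add: P.m_ac)
    also have "\<dots> = (E \<cdot> E) \<cdot> (f \<cdot> g)"
      unfolding f'(2)[symmetric] using cl by (simp add: P.m_ac)
    finally show "indet \<cdot> (E \<cdot> (g \<cdot> f')) = indet \<cdot> E"
      unfolding E_idem fg(3) using cl P.m_comm by simp
  qed (use cl f' in auto)
  have 2: "F \<cdot> (g' \<cdot> f) = F"
  proof (rule indet_cancel)
    have "indet \<cdot> (F \<cdot> (g' \<cdot> f)) = F \<cdot> (f \<cdot> (indet \<cdot> g'))"
      using cl g'(1) by (simp add: P.m_ac)
    also have "\<dots> = (F \<cdot> F) \<cdot> (f \<cdot> g)"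
      unfolding g'(2)[symmetric] using cl by (simp add: P.m_ac)
    finally show "indet \<cdot> (F \<cdot> (g' \<cdot> f)) = indet \<cdot> F"
      unfolding FF fg(3) using cl P.m_comm by simp
  qed (use cl g' in auto)
  \<comment> \<open>By 1 and 2, \<open>w\<close> and \<open>w'\<close> are inverse to each other in both corners.\<close>
  define w where "w = E \<cdot> g \<oplus>\<^bsub>P\<^esub> F \<cdot> g'"
  define w' where "w' = E \<cdot> f' \<oplus>\<^bsub>P\<^esub> F \<cdot> f"
  have wc: "w \<in> carrier P" "w' \<in> carrier P" using cl f' g' by (simp_all add: w_def w'_def)
  have "w \<cdot> w' = (E \<cdot> E) \<cdot> (g \<cdot> f') \<oplus>\<^bsub>P\<^esub> (E \<cdot> F) \<cdot> (g \<cdot> f \<oplus>\<^bsub>P\<^esub> g' \<cdot> f')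
      \<oplus>\<^bsub>P\<^esub> (F \<cdot> F) \<cdot> (g' \<cdot> f)"
    unfolding w_def w'_def using cl f'(1) g'(1) by algebra
  also have "\<dots> = \<one>\<^bsub>P\<^esub>"
    unfolding E_idem EF FF 1 2 using cl f'(1) g'(1) EF1 by simp
  finally have "w \<in> Units P" using wc P.Units_iff by blast
  moreover have "f \<cdot> w = corner_indet"
  proof -
    have "f \<cdot> w = E \<cdot> (f \<cdot> g) \<oplus>\<^bsub>P\<^esub> F \<cdot> (g' \<cdot> f)"
      unfolding w_def using cl g'(1) by algebra
    then have "f \<cdot> w = E \<cdot> indet \<oplus>\<^bsub>P\<^esub> F" unfolding 2 fg(3) .
    then show ?thesis unfolding corner_indet_def F_def .
  qed
  ultimately show thesis using that by blast
qed

lemma corner_indet_add_regular: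
  assumes c: "c \<in> carrier R" "\<epsilon> \<otimes> c = c"
  shows "regular_elem P (corner_indet \<oplus>\<^bsub>P\<^esub> const c)"
  unfolding regular_elem_def
proof (intro conjI ballI impI)
  have cc: "const c \<in> carrier P" using c by simp
  note cl = E_closed indet_closed cc corner_indet_closed
  show "corner_indet \<oplus>\<^bsub>P\<^esub> const c \<in> carrier P" using cl by simp
  have Ec: "E \<cdot> const c = const c"
    using const_mult[OF split_idem_closed c(1)] c(2) by simp
  fix t assume t: "t \<in> carrier P" "(corner_indet \<oplus>\<^bsub>P\<^esub> const c) \<cdot> t = \<zero>\<^bsub>P\<^esub>"
  have EE: "E \<ominus>\<^bsub>P\<^esub> E \<cdot> E = \<zero>\<^bsub>P\<^esub>"
    using E_idem E_closed P.r_neg by (simp add: P.minus_eq)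
  have "(indet \<oplus>\<^bsub>P\<^esub> const c) \<cdot> (E \<cdot> t) =
      E \<cdot> ((corner_indet \<oplus>\<^bsub>P\<^esub> const c) \<cdot> t) \<oplus>\<^bsub>P\<^esub> (E \<ominus>\<^bsub>P\<^esub> E \<cdot> E) \<cdot> (indet \<cdot> t \<ominus>\<^bsub>P\<^esub> t)"
    unfolding corner_indet_def using cl t(1) by algebra
  also have "\<dots> = \<zero>\<^bsub>P\<^esub>"
    unfolding t(2) EE using cl t(1) by simp
  finally have Et: "E \<cdot> t = \<zero>\<^bsub>P\<^esub>"
    using monic_linear_regular[OF c(1)] E_closed t(1) by simp
  have "(corner_indet \<oplus>\<^bsub>P\<^esub> E \<cdot> const c) \<cdot> t = t \<oplus>\<^bsub>P\<^esub> (E \<cdot> t) \<cdot> (indet \<oplus>\<^bsub>P\<^esub> const c \<ominus>\<^bsub>P\<^esub> \<one>\<^bsub>P\<^esub>)"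
    unfolding corner_indet_def using cl t(1) by algebra
  then show "t = \<zero>\<^bsub>P\<^esub>"
    unfolding Ec t(2) Et using cl t(1) by simp
qed

lemma split_idem_nonzero:
  assumes "f \<notin> Units P"
  shows "\<epsilon> \<noteq> \<zero>"
proof
  assume z: "\<epsilon> = \<zero>"
  obtain w where w: "w \<in> Units P" "f \<cdot> w = corner_indet"
    using factor_of_indet by blast
  have "corner_indet = \<one>\<^bsub>P\<^esub>"
    unfolding corner_indet_def z using indet_closed by (simp add: P.minus_eq)
  then show False using w assms fg(1) P.Units_iff P.Units_closed by metis
qed

text \<open>
  Let \<open>ab = 0\<close> in the corner \<open>\<epsilon>R\<close>, with indeterminate \<open>y\<close> associated to \<open>f\<close>. As
  \<open>(y + a)(y + b) = y(y + a + b)\<close> is regular, \<open>f\<close> divides \<open>y + a\<close> or \<open>y + b\<close>, hence \<open>a\<close> or \<open>b\<close>. But a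
  constant \<open>c\<close> of the corner that is divisible by \<open>f\<close> is 0: the constant coefficient of \<open>cg\<close> is then 0.
\<close>

lemma split_corner_domain:
  assumes ufr: "weak_strongly_reduced_ufr P" and one: "\<one> \<noteq> \<zero>" and f: "atom P f"
  shows "domain (corner R \<epsilon>)"
proof (rule R.corner_domainI[OF split_idem_closed split_idem_idem split_idem_nonzero])
  show "f \<notin> Units P" using f by (rule atom_nonunit)
  fix a b assume ab: "a \<in> carrier R" "b \<in> carrier R" "\<epsilon> \<otimes> a = a" "\<epsilon> \<otimes> b = b" "a \<otimes> b = \<zero>"
  let ?y = corner_indet
  note cl = corner_indet_closed monom_closed[OF ab(1), of 0] monom_closed[OF ab(2), of 0]
  obtain w where w: "w \<in> Units P" "f \<cdot> w = ?y"
    using factor_of_indet by blast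
  have wc: "w \<in> carrier P" using w(1) by (rule P.Units_closed)
  have one': "\<one>\<^bsub>P\<^esub> \<noteq> \<zero>\<^bsub>P\<^esub>"
  proof
    assume "\<one>\<^bsub>P\<^esub> = \<zero>\<^bsub>P\<^esub>"
    then have "cf \<one>\<^bsub>P\<^esub> 0 = cf \<zero>\<^bsub>P\<^esub> 0" by simp
    then show False using one by simp
  qed
  have ABz: "const a \<cdot> const b = \<zero>\<^bsub>P\<^esub>" using const_mult[OF ab(1,2)] ab(5) by simp
  have "(?y \<oplus>\<^bsub>P\<^esub> const a) \<cdot> (?y \<oplus>\<^bsub>P\<^esub> const b) =
      ?y \<cdot> (?y \<oplus>\<^bsub>P\<^esub> const a \<oplus>\<^bsub>P\<^esub> const b) \<oplus>\<^bsub>P\<^esub> const a \<cdot> const b"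
    using cl by algebra
  also have "\<dots> = (f \<cdot> w) \<cdot> (?y \<oplus>\<^bsub>P\<^esub> const a \<oplus>\<^bsub>P\<^esub> const b)"
    unfolding ABz w(2) using cl by simp
  also have "\<dots> = f \<cdot> (w \<cdot> (?y \<oplus>\<^bsub>P\<^esub> const a \<oplus>\<^bsub>P\<^esub> const b))"
    using fg(1) wc cl by (simp add: P.m_assoc)
  finally have eq: "f \<cdot> (w \<cdot> (?y \<oplus>\<^bsub>P\<^esub> const a \<oplus>\<^bsub>P\<^esub> const b)) =
      (?y \<oplus>\<^bsub>P\<^esub> const a) \<cdot> (?y \<oplus>\<^bsub>P\<^esub> const b)" by simp
  have reg: "regular_elem P ((?y \<oplus>\<^bsub>P\<^esub> const a) \<cdot> (?y \<oplus>\<^bsub>P\<^esub> const b))"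
    using P.regular_elem_mult corner_indet_add_regular ab by blast
  have dvd: "c = \<zero>" if c: "c \<in> carrier R" "\<epsilon> \<otimes> c = c" "f divides\<^bsub>P\<^esub> (?y \<oplus>\<^bsub>P\<^esub> const c)" for c
  proof -
    obtain t where t: "t \<in> carrier P" "?y \<oplus>\<^bsub>P\<^esub> const c = f \<cdot> t" using c(3) by (auto simp: factor_def)
    have "const c = (?y \<oplus>\<^bsub>P\<^esub> const c) \<ominus>\<^bsub>P\<^esub> ?y"
      using cl(1) monom_closed[OF c(1), of 0] by algebra
    also have "\<dots> = f \<cdot> t \<ominus>\<^bsub>P\<^esub> f \<cdot> w" unfolding t(2) w(2) ..
    also have "\<dots> = f \<cdot> (t \<ominus>\<^bsub>P\<^esub> w)"
      using fg(1) t(1) wc by algebra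
    finally have c': "const c = f \<cdot> (t \<ominus>\<^bsub>P\<^esub> w)" .
    have "const c \<cdot> g = indet \<cdot> (t \<ominus>\<^bsub>P\<^esub> w)"
      unfolding c' fg(3)[symmetric] using fg(1,2) t(1) wc by algebra
    then have "c \<otimes> cf g 0 = \<zero>"
      using coeff_const_mult[OF c(1) fg(2), of 0] coeff_indet_mult_0[of "t \<ominus>\<^bsub>P\<^esub> w"] t(1) wc by simp
    moreover have "\<epsilon> \<otimes> c = cf f 1 \<otimes> (c \<otimes> cf g 0)"
      unfolding split_idem_def using fg(1,2) c(1) by (simp add: R.m_ac)
    ultimately show "c = \<zero>" using c(2) fg(1) by simp
  qed
  have "f divides\<^bsub>P\<^esub> (?y \<oplus>\<^bsub>P\<^esub> const a) \<or> f divides\<^bsub>P\<^esub> (?y \<oplus>\<^bsub>P\<^esub> const b)"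
    using P.regular_atom_prime[OF ufr one' f _ _ _ eq reg] wc cl by simp
  then show "a = \<zero> \<or> b = \<zero>" using dvd ab by blast
qed

end

text \<open>
  The indeterminate is a product of atoms; each of them, with the product of the others as its cofactor,
  gives an idempotent. The idempotents are orthogonal because the constant coefficient of the indeterminate
  is 0, and they add up to its linear coefficient 1.
\<close>

theorem domain_decomposition_of_UP_ufr:
  assumes ufr: "weak_strongly_reduced_ufr P" and one: "\<one> \<noteq> \<zero>"
  shows "\<exists>n e. domain_decomposition R n e"
proof -
  have i0: "indet \<noteq> \<zero>\<^bsub>P\<^esub>"
  proof
    assume "indet = \<zero>\<^bsub>P\<^esub>"
    then have "cf indet 1 = cf \<zero>\<^bsub>P\<^esub> 1" by simp
    then show False using one by simp
  qed
  have "indet \<notin> Units P"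
  proof
    assume "indet \<in> Units P"
    then obtain t where "t \<in> carrier P" "indet \<cdot> t = \<one>\<^bsub>P\<^esub>" using P.Units_iff by blast
    then show False using coeff_indet_mult_0[of t] one by simp
  qed
  then have "indet \<in> nonunits P - {\<zero>\<^bsub>P\<^esub>}" using i0 by (simp add: nonunits_def)
  then obtain n f where f: "\<forall>i\<in>{1..n::nat}. atom P (f i)" "indet = finprod P f {1..n}"
    using ufr unfolding weak_strongly_reduced_ufr_def atomic_ring_def by blast
  have fc: "f \<in> {1..n} \<rightarrow> carrier P" using f(1) by (auto intro!: atom_closed)
  have fj: "f j \<in> carrier P" if "j \<in> {1..n}" for j using fc that by auto
  define g where "g j = finprod P f ({1..n} - {j})" for j
  have fg': "f \<in> {1..n} - {j} \<rightarrow> carrier P" for j using fc by auto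
  have gc: "g j \<in> carrier P" for j unfolding g_def using fg' by simp
  have fgj: "f j \<cdot> g j = indet" if j: "j \<in> {1..n}" for j
  proof -
    have "{1..n} = insert j ({1..n} - {j})" using j by blast
    then show ?thesis
      using P.finprod_insert[of "{1..n} - {j}" j f] fg'[of j] fj[OF j] f(2) unfolding g_def by simp
  qed
  define c where "c j = cf (f j) 1 \<otimes> cf (g j) 0" for j
  have cs: "c j = split_idem (f j) (g j)" if "j \<in> {1..n}" for j
    using split_idem_def[OF fj[OF that] gc fgj[OF that]] by (simp add: c_def)
  have cc: "c j \<in> carrier R" if "j \<in> {1..n}" for j
    using fj[OF that] gc by (simp add: c_def)
  have sum: "(\<Oplus>j\<in>{1..n}. c j) = \<one>"
    using coeff_finprod_1[OF finite_atLeastAtMost fc] coeff_monom[OF R.one_closed, of 1 1]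
    unfolding f(2)[symmetric] c_def g_def by simp
  have orth: "c j \<otimes> c k = \<zero>" if jk: "j \<in> {1..n}" "k \<in> {1..n}" "j \<noteq> k" for j k
  proof -
    let ?t = "finprod P f ({1..n} - {k} - {j})"
    have f2: "f \<in> {1..n} - {k} - {j} \<rightarrow> carrier P" using fc by auto
    then have tc: "?t \<in> carrier P" by simp
    have "{1..n} - {k} = insert j ({1..n} - {k} - {j})" using jk by blast
    then have gk: "g k = f j \<cdot> ?t"
      using P.finprod_insert[of "{1..n} - {k} - {j}" j f] f2 fj[OF jk(1)] unfolding g_def by simp
    have "g j \<cdot> g k = indet \<cdot> ?t"
      unfolding gk fgj[OF jk(1), symmetric] using gc[of j] tc fj[OF jk(1)] by (simp add: P.m_ac)
    then have z: "cf (g j) 0 \<otimes> cf (g k) 0 = \<zero>"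
      using coeff_mult_0[OF gc gc, of j k] coeff_indet_mult_0[OF tc] by simp
    have "c j \<otimes> c k = (cf (f j) 1 \<otimes> cf (f k) 1) \<otimes>
        (cf (g j) 0 \<otimes> cf (g k) 0)"
      unfolding c_def using coeff_closed[OF fj[OF jk(1)], of 1] coeff_closed[OF fj[OF jk(2)], of 1]
        coeff_closed[OF gc, of j 0] coeff_closed[OF gc, of k 0] by (simp add: R.m_ac)
    then show ?thesis unfolding z using fj[OF jk(1)] fj[OF jk(2)] by simp
  qed
  have idem: "c j \<otimes> c j = c j" if "j \<in> {1..n}" for j
    using split_idem_idem[OF fj[OF that] gc fgj[OF that]] cs[OF that] by simp
  have dom: "domain (corner R (c j))" if "j \<in> {1..n}" for j
    using split_corner_domain[OF fj[OF that] gc fgj[OF that] ufr one] f(1) cs[OF that] that by simp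
  define e where "e i = c (Suc i)" for i
  have sh: "{1..n} = Suc ` {..<n}" by (auto simp: image_iff Suc_le_eq gr0_conv_Suc)
  have "(\<Oplus>i\<in>{..<n}. e i) = (\<Oplus>j\<in>Suc ` {..<n}. c j)"
    unfolding e_def using cc by (subst R.finsum_reindex) (auto simp: sh[symmetric])
  then have sum': "(\<Oplus>i\<in>{..<n}. e i) = \<one>" using sum sh by simp
  have ji: "Suc i \<in> {1..n}" if "i < n" for i using that by auto
  have "domain_decomposition R n e"
  proof (intro domain_decomposition.intro idempotent_decomposition.intro
      idempotent_decomposition_axioms.intro domain_decomposition_axioms.intro R.cring_axioms)
    fix i assume i: "i < n"
    show "e i \<in> carrier R" unfolding e_def by (rule cc[OF ji[OF i]])
    show "domain (corner R (e i))" unfolding e_def by (rule dom[OF ji[OF i]])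
    fix j assume j: "j < n"
    show "e i \<otimes> e j = (if i = j then e i else \<zero>)"
      using idem[OF ji[OF i]] orth[OF ji[OF i] ji[OF j]] by (cases "i = j") (simp_all add: e_def)
  qed (rule sum')
  then show ?thesis by blast
qed

end

section \<open>Transport along ring isomorphisms\<close>

context
  fixes S :: "('a, 'm) ring_scheme" and T :: "('b, 'k) ring_scheme" and h
  assumes S: "cring S" and T: "cring T" and h: "h \<in> ring_iso S T"
begin

interpretation S: cring S by (rule S)
interpretation T: cring T by (rule T)

private lemma h_simps:
  "x \<in> carrier S \<Longrightarrow> h x \<in> carrier T"
  "x \<in> carrier S \<Longrightarrow> y \<in> carrier S \<Longrightarrow> h (x \<otimes>\<^bsub>S\<^esub> y) = h x \<otimes>\<^bsub>T\<^esub> h y"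
  "h \<one>\<^bsub>S\<^esub> = \<one>\<^bsub>T\<^esub>" "h \<zero>\<^bsub>S\<^esub> = \<zero>\<^bsub>T\<^esub>"
proof -
  show "h \<zero>\<^bsub>S\<^esub> = \<zero>\<^bsub>T\<^esub>"
    using ring_hom_zero[OF _ S.ring_axioms T.ring_axioms, of h] h by (simp add: ring_iso_def)
qed (use ring_iso_memE(1,2,4)[OF h] in blast)+

private lemma h_inj: "x \<in> carrier S \<Longrightarrow> y \<in> carrier S \<Longrightarrow> h x = h y \<longleftrightarrow> x = y"
  using ring_iso_memE(5)[OF h] unfolding bij_betw_def inj_on_def by blast

private lemma h_surj: "y \<in> carrier T \<Longrightarrow> \<exists>x\<in>carrier S. y = h x"
  using ring_iso_memE(5)[OF h] unfolding bij_betw_def by blast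

lemma ring_iso_divides_iff:
  assumes "x \<in> carrier S" "y \<in> carrier S"
  shows "x divides\<^bsub>S\<^esub> y \<longleftrightarrow> h x divides\<^bsub>T\<^esub> h y"
proof
  assume "x divides\<^bsub>S\<^esub> y"
  then show "h x divides\<^bsub>T\<^esub> h y"
    using h_simps assms unfolding factor_def by auto
next
  assume "h x divides\<^bsub>T\<^esub> h y"
  then obtain d where "d \<in> carrier T" "h y = h x \<otimes>\<^bsub>T\<^esub> d" unfolding factor_def by blast
  then obtain c where c: "c \<in> carrier S" "h y = h x \<otimes>\<^bsub>T\<^esub> h c" using h_surj by blast
  then have "y = x \<otimes>\<^bsub>S\<^esub> c"
    using h_inj[OF assms(2) S.m_closed[OF assms(1) c(1)]] h_simps(2)[OF assms(1) c(1)] by simp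
  then show "x divides\<^bsub>S\<^esub> y" using c unfolding factor_def by blast
qed

lemma ring_iso_Units_iff:
  assumes "x \<in> carrier S"
  shows "x \<in> Units S \<longleftrightarrow> h x \<in> Units T"
  unfolding S.divides_one[OF assms, symmetric] T.divides_one[OF h_simps(1)[OF assms], symmetric]
    ring_iso_divides_iff[OF assms S.one_closed] h_simps(3) ..

lemma ring_iso_domain:
  assumes "domain T"
  shows "domain S"
proof unfold_locales
  have c: "\<one>\<^bsub>S\<^esub> \<in> carrier S" "\<zero>\<^bsub>S\<^esub> \<in> carrier S" by simp_all
  show "\<one>\<^bsub>S\<^esub> \<noteq> \<zero>\<^bsub>S\<^esub>"
    using h_simps(3,4) domain.one_not_zero[OF assms] by metis
  fix a b assume ab: "a \<otimes>\<^bsub>S\<^esub> b = \<zero>\<^bsub>S\<^esub>" "a \<in> carrier S" "b \<in> carrier S"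
  then have "h a \<otimes>\<^bsub>T\<^esub> h b = \<zero>\<^bsub>T\<^esub>" using h_simps by metis
  then have "h a = h \<zero>\<^bsub>S\<^esub> \<or> h b = h \<zero>\<^bsub>S\<^esub>"
    using domain.integral[OF assms _ h_simps(1)[OF ab(2)] h_simps(1)[OF ab(3)]] h_simps(4) by simp
  then show "a = \<zero>\<^bsub>S\<^esub> \<or> b = \<zero>\<^bsub>S\<^esub>"
    using h_inj[OF ab(2) c(2)] h_inj[OF ab(3) c(2)] by simp
qed

lemma ring_iso_factorial_domain:
  assumes fT: "factorial_domain T"
  shows "factorial_domain S"
proof -
  have dT: "domain T" using fT by (simp add: factorial_domain_def)
  have dS: "domain S" by (rule ring_iso_domain[OF dT])
  have z: "h x = \<zero>\<^bsub>T\<^esub> \<longleftrightarrow> x = \<zero>\<^bsub>S\<^esub>" if "x \<in> carrier S" for x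
    using h_inj[OF that S.zero_closed] h_simps(4) by simp
  note DS = domain.divides_imp_divides_mult[OF dS] and DT = domain.divides_imp_divides_mult[OF dT]
  show ?thesis
  proof (rule domain.factorial_domainI_wf[OF dS])
    show "wf (proper_factors S)"
    proof (rule wf_subset[OF wf_inv_image[OF factorial_domain.wf_properfactor[OF fT], of h]], rule subrelI)
      fix x y
      assume "(x, y) \<in> proper_factors S"
      then have xy: "x \<in> carrier S" "x \<noteq> \<zero>\<^bsub>S\<^esub>" "y \<in> carrier S" "y \<noteq> \<zero>\<^bsub>S\<^esub>"
        and pf: "properfactor (mult_of S) x y" by blast+
      have "x divides\<^bsub>S\<^esub> y" "\<not> y divides\<^bsub>S\<^esub> x"
        using pf DS[of y x] xy divides_mult_imp_divides[of S x y] unfolding properfactor_def by blast+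
      then have d: "h x divides\<^bsub>T\<^esub> h y" "\<not> h y divides\<^bsub>T\<^esub> h x"
        using ring_iso_divides_iff xy by blast+
      have hxy: "h x \<in> carrier T - {\<zero>\<^bsub>T\<^esub>}" "h y \<in> carrier T - {\<zero>\<^bsub>T\<^esub>}"
        using h_simps(1) z xy by blast+
      have "properfactor (mult_of T) (h x) (h y)"
        unfolding properfactor_def
        using d DT[of "h x" "h y"] divides_mult_imp_divides[of T "h y" "h x"] hxy by blast
      then show "(x, y) \<in> inv_image (proper_factors T) h"
        using hxy by (simp only: in_inv_image mem_Collect_eq case_prod_conv simp_thms)
    qed
  next
    fix p assume p: "p \<in> carrier S" "ring_irreducible\<^bsub>S\<^esub> p"
    note pE = domain.ring_irreducibleE[OF dS p]
    have hp: "h p \<in> carrier T" using h_simps(1) p by blast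
    have "ring_irreducible\<^bsub>T\<^esub> (h p)"
    proof (rule domain.ring_irreducibleI[OF dT])
      show "h p \<in> carrier T - {\<zero>\<^bsub>T\<^esub>}" using hp z[OF p(1)] pE(1) by blast
      show "h p \<notin> Units T" using ring_iso_Units_iff[OF p(1)] pE(4) by blast
      fix a b assume ab: "a \<in> carrier T" "b \<in> carrier T" "h p = a \<otimes>\<^bsub>T\<^esub> b"
      obtain a' b' where ab': "a' \<in> carrier S" "a = h a'" "b' \<in> carrier S" "b = h b'"
        using h_surj[OF ab(1)] h_surj[OF ab(2)] by blast
      have "p = a' \<otimes>\<^bsub>S\<^esub> b'"
        using h_inj[OF p(1) S.m_closed[OF ab'(1,3)]] h_simps(2)[OF ab'(1,3)] ab(3) ab'(2,4) by simp
      then show "a \<in> Units T \<or> b \<in> Units T"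
        using pE(5)[OF ab'(1,3)] ring_iso_Units_iff[OF ab'(1)] ring_iso_Units_iff[OF ab'(3)] ab'(2,4)
        by blast
    qed
    then have "prime T (h p)"
      using factorial_domain.ring_irreducible_imp_prime[OF fT hp] by (simp add: ring_prime_def)
    then have pr: "h p divides\<^bsub>T\<^esub> x \<or> h p divides\<^bsub>T\<^esub> y"
      if "x \<in> carrier T" "y \<in> carrier T" "h p divides\<^bsub>T\<^esub> (x \<otimes>\<^bsub>T\<^esub> y)" for x y
      using that unfolding prime_def by blast
    show "ring_prime\<^bsub>S\<^esub> p"
    proof (rule S.ring_primeI[OF pE(1)], rule primeI[OF pE(4)])
      fix a b assume ab: "a \<in> carrier S" "b \<in> carrier S" "p divides\<^bsub>S\<^esub> a \<otimes>\<^bsub>S\<^esub> b"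
      have "h p divides\<^bsub>T\<^esub> (h a \<otimes>\<^bsub>T\<^esub> h b)"
        using ring_iso_divides_iff[OF p(1) S.m_closed[OF ab(1,2)]] ab(3) h_simps(2)[OF ab(1,2)] by simp
      then show "p divides\<^bsub>S\<^esub> a \<or> p divides\<^bsub>S\<^esub> b"
        using pr h_simps(1)[OF ab(1)] h_simps(1)[OF ab(2)] ring_iso_divides_iff[OF p(1)] ab by blast
    qed
  qed
qed

end

section \<open>Corners of polynomial rings\<close>

lemma (in cring) corner_finsum:
  assumes e: "e \<in> carrier R" "e \<otimes> e = e" and "f \<in> A \<rightarrow> carrier (corner R e)"
  shows "finsum (corner R e) f A = finsum R f A"
proof -
  interpret C: cring "corner R e" by (rule corner_cring[OF e])
  show ?thesis
  proof (cases "finite A")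
    case True
    then show ?thesis
      using assms(3)
    proof (induction A rule: finite_induct)
      case empty
      show ?case unfolding C.finsum_empty finsum_empty by simp
    next
      case (insert x A)
      have f: "f \<in> A \<rightarrow> carrier (corner R e)" "f x \<in> carrier (corner R e)" using insert.prems by blast+
      then have f': "f \<in> A \<rightarrow> carrier R" "f x \<in> carrier R" by auto
      show ?case
        unfolding C.finsum_insert[OF insert.hyps f] finsum_insert[OF insert.hyps f'] insert.IH[OF f(1)]
        by simp
    qed
  next
    case False
    show ?thesis unfolding C.finsum_infinite[OF False] finsum_infinite[OF False] by simp
  qed
qed

context UP_cring
begin

lemma corner_UP_carrier:
  assumes e: "e \<in> carrier R" "e \<otimes> e = e"
  shows "carrier (UP (corner R e)) = carrier (corner P (const e))"
proof -
  have pc: "carrier P = up R" "carrier (UP (corner R e)) = up (corner R e)"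
    by (simp_all add: P_def UP_def)
  have co: "cf p n = p n" if "p \<in> carrier P" for p n
    using that unfolding P_def UP_def by simp
  have "const e \<cdot> p = p \<longleftrightarrow> (\<forall>n. e \<otimes> p n = p n)" if p: "p \<in> carrier P" for p
  proof -
    have m: "e \<odot>\<^bsub>P\<^esub> p \<in> carrier P" using e p by simp
    have "e \<odot>\<^bsub>P\<^esub> p = p \<longleftrightarrow> (\<forall>n. cf (e \<odot>\<^bsub>P\<^esub> p) n = cf p n)"
      using up_eqI[OF _ m p] by auto
    then show ?thesis
      unfolding monom_mult_is_smult[OF e(1) p] coeff_smult[OF e(1) p] co[OF p] .
  qed
  moreover have "p \<in> up (corner R e) \<longleftrightarrow> p \<in> up R \<and> (\<forall>n. e \<otimes> p n = p n)" for p
    by (auto simp: up_def Pi_def)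
  ultimately show ?thesis
    unfolding pc(2) using pc(1) by auto
qed

text \<open>Polynomials over the corner \<open>eR\<close> are literally the elements of the corner \<open>eR[X]\<close> of \<open>R[X]\<close>.\<close>

lemma corner_UP_iso:
  assumes e: "e \<in> carrier R" "e \<otimes> e = e"
  shows "id \<in> ring_iso (UP (corner R e)) (corner P (const e))"
proof (rule ring_iso_memI)
  let ?C = "corner R e"
  note car = corner_UP_carrier[OF e]
  have pc: "carrier P = up R" "carrier (UP ?C) = up ?C"
    by (simp_all add: P_def UP_def)
  have sub: "p \<in> up ?C \<Longrightarrow> p \<in> up R" for p
    using car unfolding pc(2) by (auto simp: pc(1)[symmetric])
  show "bij_betw id (carrier (UP ?C)) (carrier (corner P (const e)))"
    unfolding car by simp
  show "id \<one>\<^bsub>UP ?C\<^esub> = \<one>\<^bsub>corner P (const e)\<^esub>"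
    using e(1) by (auto simp: UP_def P_def)
  show "id p \<in> carrier (corner P (const e))" if "p \<in> carrier (UP ?C)" for p
    using that unfolding car by simp
  fix p q assume "p \<in> carrier (UP ?C)" "q \<in> carrier (UP ?C)"
  then have pq: "p \<in> up ?C" "q \<in> up ?C" unfolding pc by blast+
  note pqR = sub[OF pq(1)] sub[OF pq(2)]
  show "id (p \<oplus>\<^bsub>UP ?C\<^esub> q) = id p \<oplus>\<^bsub>corner P (const e)\<^esub> id q"
    using pq pqR unfolding corner_simps P_def UP_def by simp
  have "(\<Oplus>\<^bsub>?C\<^esub>i\<in>{..n}. p i \<otimes> q (n - i)) = (\<Oplus>i\<in>{..n}. p i \<otimes> q (n - i))" for n
  proof (rule R.corner_finsum[OF e])
    have "p i \<in> carrier R" "q i \<in> carrier R" "e \<otimes> p i = p i" for i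
      using pq mem_upD[OF pq(1), of i] mem_upD[OF pq(2), of i] by simp_all
    then have "p i \<otimes> q j \<in> carrier ?C" for i j
      using e R.m_assoc[of e "p i" "q j"] by simp
    then show "(\<lambda>i. p i \<otimes> q (n - i)) \<in> {..n} \<rightarrow> carrier ?C" by blast
  qed
  then show "id (p \<otimes>\<^bsub>UP ?C\<^esub> q) = id p \<otimes>\<^bsub>corner P (const e)\<^esub> id q"
    using pq pqR unfolding corner_simps P_def UP_def by simp
qed

lemma const_idem:
  assumes e: "e \<in> carrier R" "e \<otimes> e = e"
  shows "const e \<in> carrier P" "const e \<cdot> const e = const e"
  using e const_mult[OF e(1,1)] by simp_all

context
  fixes e
  assumes e: "e \<in> carrier R" "e \<otimes> e = e" and dom: "domain (corner R e)"
begin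

private abbreviation "D \<equiv> corner R e"
private abbreviation "K \<equiv> corner P (const e)"

private lemma UPD: "UP_domain D"
  using dom by (simp add: UP_domain_def)

private lemma cr: "cring (UP D)" "cring K"
proof -
  have "UP_cring D" using R.corner_cring[OF e] by (simp add: UP_cring_def)
  then show "cring (UP D)" by (rule UP_cring.UP_cring)
  show "cring K" by (rule P.corner_cring[OF const_idem[OF e]])
qed

private lemma iso: "id \<in> ring_iso (UP D) K" by (rule corner_UP_iso[OF e])

private lemma iso': "id \<in> ring_iso K (UP D)"
proof (rule ring_iso_memI)
  note car = corner_UP_carrier[OF e]
  show "bij_betw id (carrier K) (carrier (UP D))" unfolding car by simp
  show "id \<one>\<^bsub>K\<^esub> = \<one>\<^bsub>UP D\<^esub>" using ring_iso_memE(4)[OF iso] by simp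
  fix p q assume "p \<in> carrier K" "q \<in> carrier K"
  then have pq: "p \<in> carrier (UP D)" "q \<in> carrier (UP D)" unfolding car by blast+
  show "id p \<in> carrier (UP D)" using pq by simp
  show "id (p \<otimes>\<^bsub>K\<^esub> q) = id p \<otimes>\<^bsub>UP D\<^esub> id q" using ring_iso_memE(2)[OF iso pq] by (simp only: id_apply)
  show "id (p \<oplus>\<^bsub>K\<^esub> q) = id p \<oplus>\<^bsub>UP D\<^esub> id q" using ring_iso_memE(3)[OF iso pq] by (simp only: id_apply)
qed

lemma corner_UP_domain: "domain K"
  by (rule ring_iso_domain[OF cr(2,1) iso' UP_domain.UP_domain[OF UPD]])

lemma corner_UP_factorial_iff: "factorial_domain K \<longleftrightarrow> factorial_domain D"
proof
  assume "factorial_domain K"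
  then have "factorial_domain (UP D)" by (rule ring_iso_factorial_domain[OF cr iso])
  then show "factorial_domain D" by (rule UP_domain.factorial_of_UP[OF UPD])
next
  assume "factorial_domain D"
  then have "factorial_domain (UP D)"
    using UP_factorial.factorial_UP[of D] by (simp add: UP_factorial_def)
  then show "factorial_domain K" by (rule ring_iso_factorial_domain[OF cr(2,1) iso'])
qed

lemma corner_UP_Units_iff: "Units K = {const e} \<longleftrightarrow> Units D = {e}"
proof -
  interpret D: UP_domain D "UP D" by (rule UPD)
  have one: "const e = \<one>\<^bsub>UP D\<^esub>" "\<one>\<^bsub>UP D\<^esub> = up_ring.monom (UP D) e 0"
    using ring_iso_memE(4)[OF iso] D.monom_one by (simp_all add: id_def)
  have UK: "Units K = Units (UP D)"
    using ring_iso_Units_iff[OF cr iso] corner_UP_carrier[OF e] by (auto simp: Units_def)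
  have D1: "e \<in> Units D" using D.R.Units_one_closed by simp
  have U: "Units (UP D) = (\<lambda>u. up_ring.monom (UP D) u 0) ` Units D"
  proof (rule Set.set_eqI, rule iffI)
    fix p assume "p \<in> Units (UP D)"
    then show "p \<in> (\<lambda>u. up_ring.monom (UP D) u 0) ` Units D"
      using D.const_Units_iff[of p] D.P.Units_closed by blast
  next
    fix p assume "p \<in> (\<lambda>u. up_ring.monom (UP D) u 0) ` Units D"
    then show "p \<in> Units (UP D)"
      using D.const_Units_iff[of p] D.monom_closed D.R.Units_closed by blast
  qed
  have "inj_on (\<lambda>u. up_ring.monom (UP D) u 0) (Units D)"
    using D.monom_inj[of 0] D.R.Units_closed unfolding inj_on_def by blast
  then have "Units (UP D) = {up_ring.monom (UP D) e 0} \<longleftrightarrow> Units D = {e}"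
    unfolding U using D1 by (auto simp: inj_on_def)
  then show ?thesis unfolding UK unfolding one .
qed

end

lemma domain_decomposition_UP:
  assumes "domain_decomposition R n e"
  shows "domain_decomposition P n (\<lambda>i. const (e i))"
proof -
  interpret dec: domain_decomposition R n e by (rule assms)
  let ?E = "\<lambda>i. const (e i)"
  have sum: "(\<Oplus>\<^bsub>P\<^esub>i\<in>J. ?E i) = const (\<Oplus>i\<in>J. e i)"
    if "finite J" "e \<in> J \<rightarrow> carrier R" for J
    using that
  proof (induction J rule: finite_induct)
    case empty
    then show ?case by simp
  next
    case (insert j J)
    then have ej: "e j \<in> carrier R" "e \<in> J \<rightarrow> carrier R" by auto
    have "?E \<in> J \<rightarrow> carrier P" using ej(2) by (intro funcsetI monom_closed) blast
    then show ?case
      using P.finsum_insert[OF insert.hyps] R.finsum_insert[OF insert.hyps ej(2,1)] insert.IH[OF ej(2)] ej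
      by simp
  qed
  show ?thesis
  proof (intro domain_decomposition.intro idempotent_decomposition.intro
      idempotent_decomposition_axioms.intro domain_decomposition_axioms.intro P.cring_axioms)
    fix i assume i: "i < n"
    show "?E i \<in> carrier P" using dec.idem_closed[OF i] by simp
    show "domain (corner P (?E i))"
      by (rule corner_UP_domain[OF dec.idem_closed[OF i] dec.idem[OF i] dec.corner_domain[OF i]])
    fix j assume j: "j < n"
    show "?E i \<cdot> ?E j = (if i = j then ?E i else \<zero>\<^bsub>P\<^esub>)"
      using const_mult[OF dec.idem_closed[OF i] dec.idem_closed[OF j]] dec.idem_mult[OF i j] by simp
  next
    show "(\<Oplus>\<^bsub>P\<^esub>i\<in>{..<n}. ?E i) = \<one>\<^bsub>P\<^esub>"
      using sum[of "{..<n}"] dec.idem_sum dec.idem_closed by auto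
  qed
qed

lemma ufd_decomposition_UP_iff:
  assumes "domain_decomposition R n e"
  shows "ufd_decomposition P n (\<lambda>i. const (e i)) \<longleftrightarrow> ufd_decomposition R n e"
proof -
  interpret dec: domain_decomposition R n e by (rule assms)
  have f: "factorial_domain (corner P (const (e i))) \<longleftrightarrow> factorial_domain (corner R (e i))"
    if "i < n" for i
    by (rule corner_UP_factorial_iff[OF dec.idem_closed dec.idem dec.corner_domain]) (rule that)+
  have u: "Units (corner P (const (e i))) = {const (e i)} \<longleftrightarrow>
      Units (corner R (e i)) = {e i}" if "i < n" for i
    by (rule corner_UP_Units_iff[OF dec.idem_closed dec.idem dec.corner_domain]) (rule that)+
  show ?thesis
    unfolding ufd_decomposition_def ufd_decomposition_axioms_def
    using f u by (simp add: assms domain_decomposition_UP[OF assms])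
qed

end

section \<open>Direct products of rings and idempotents\<close>

lemma RDirProd_list_nth:
  assumes "as \<in> carrier (RDirProd_list Rs)" "bs \<in> carrier (RDirProd_list Rs)" "i < length Rs"
  shows "(as \<otimes>\<^bsub>RDirProd_list Rs\<^esub> bs) ! i = as ! i \<otimes>\<^bsub>Rs ! i\<^esub> bs ! i"
    and "(as \<oplus>\<^bsub>RDirProd_list Rs\<^esub> bs) ! i = as ! i \<oplus>\<^bsub>Rs ! i\<^esub> bs ! i"
  using assms
proof (induction Rs arbitrary: as bs i)
  case (Cons R Rs)
  {
    case 1
    then obtain a as' b bs' where c: "as = a # as'" "bs = b # bs'" "a \<in> carrier R" "b \<in> carrier R"
      "as' \<in> carrier (RDirProd_list Rs)" "bs' \<in> carrier (RDirProd_list Rs)"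
      unfolding RDirProd_list_carrier by auto
    have "as \<otimes>\<^bsub>RDirProd_list (R # Rs)\<^esub> bs = (a \<otimes>\<^bsub>R\<^esub> b) # (as' \<otimes>\<^bsub>RDirProd_list Rs\<^esub> bs')"
      using ring_iso_memE(2)[OF RDirProd_list_iso1, of "(a, as')" R Rs "(b, bs')"] c
      by (simp add: RDirProd_carrier) (simp add: RDirProd_def DirProd_def monoid.defs)
    then show ?case using c 1(3) Cons.IH(1)[OF c(5,6)] by (cases i) auto
  next
    case 2
    then obtain a as' b bs' where c: "as = a # as'" "bs = b # bs'" "a \<in> carrier R" "b \<in> carrier R"
      "as' \<in> carrier (RDirProd_list Rs)" "bs' \<in> carrier (RDirProd_list Rs)"
      unfolding RDirProd_list_carrier by auto
    have "as \<oplus>\<^bsub>RDirProd_list (R # Rs)\<^esub> bs = (a \<oplus>\<^bsub>R\<^esub> b) # (as' \<oplus>\<^bsub>RDirProd_list Rs\<^esub> bs')"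
      using ring_iso_memE(3)[OF RDirProd_list_iso1, of "(a, as')" R Rs "(b, bs')"] c
      by (simp add: RDirProd_carrier) (simp add: RDirProd_def DirProd_def monoid.defs)
    then show ?case using c 2(3) Cons.IH(2)[OF c(5,6)] by (cases i) auto
  }
qed simp_all

lemma RDirProd_list_one_nth:
  "i < length Rs \<Longrightarrow> \<one>\<^bsub>RDirProd_list Rs\<^esub> ! i = \<one>\<^bsub>Rs ! i\<^esub>"
  unfolding RDirProd_list_one by (induction Rs arbitrary: i) (auto simp: nth_Cons split: nat.split)

lemma RDirProd_list_nth_hom:
  assumes "i < length Rs"
  shows "(\<lambda>as. as ! i) \<in> ring_hom (RDirProd_list Rs) (Rs ! i)"
proof (rule ring_hom_memI)
  show "x ! i \<in> carrier (Rs ! i)" if "x \<in> carrier (RDirProd_list Rs)" for x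
    using RDirProd_list_carrier_mem(2)[OF that assms] .
  show "(x \<otimes>\<^bsub>RDirProd_list Rs\<^esub> y) ! i = x ! i \<otimes>\<^bsub>Rs ! i\<^esub> y ! i"
    "(x \<oplus>\<^bsub>RDirProd_list Rs\<^esub> y) ! i = x ! i \<oplus>\<^bsub>Rs ! i\<^esub> y ! i"
    if "x \<in> carrier (RDirProd_list Rs)" "y \<in> carrier (RDirProd_list Rs)" for x y
    using RDirProd_list_nth[OF that assms] .
  show "\<one>\<^bsub>RDirProd_list Rs\<^esub> ! i = \<one>\<^bsub>Rs ! i\<^esub>" by (rule RDirProd_list_one_nth[OF assms])
qed

text \<open>
  Ring homomorphisms that identify a ring with a product of domains come from idempotents.
\<close>

lemma (in cring) ufd_decomposition_of_projections:
  fixes D :: "nat \<Rightarrow> ('c, 'd) ring_scheme"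
  assumes fac: "\<And>j. j < n \<Longrightarrow> factorial_domain (D j)"
    and units: "\<And>j. j < n \<Longrightarrow> Units (D j) = {\<one>\<^bsub>D j\<^esub>}"
    and hom: "\<And>j. j < n \<Longrightarrow> \<phi> j \<in> ring_hom R (D j)"
    and inj: "\<And>a b. \<lbrakk>a \<in> carrier R; b \<in> carrier R; \<And>j. j < n \<Longrightarrow> \<phi> j a = \<phi> j b\<rbrakk> \<Longrightarrow> a = b"
    and surj: "\<And>d. (\<And>j. j < n \<Longrightarrow> d j \<in> carrier (D j)) \<Longrightarrow> \<exists>a\<in>carrier R. \<forall>j<n. \<phi> j a = d j"
  shows "\<exists>e. ufd_decomposition R n e"
proof -
  have Dc: "cring (D j)" if "j < n" for j
    using fac[OF that] by (simp add: factorial_domain_def domain_def)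
  have Dr: "ring (D j)" if "j < n" for j using Dc[OF that] by (simp add: cring_def)
  have H: "ring_hom_ring R (D j) (\<phi> j)" if "j < n" for j
    using ring_hom_ringI2[OF ring_axioms Dr[OF that] hom[OF that]] .
  note hmult = ring_hom_mult[OF hom] and hone = ring_hom_one[OF hom] and hcl = ring_hom_closed[OF hom]
    and hzero = ring_hom_zero[OF hom ring_axioms Dr]
  have zc: "\<zero>\<^bsub>D j\<^esub> \<in> carrier (D j)" "\<one>\<^bsub>D j\<^esub> \<in> carrier (D j)" if "j < n" for j
    using Dr[OF that] by (simp_all add: ring.ring_simprules)
  have "\<exists>a\<in>carrier R. \<forall>j<n. \<phi> j a = (if j = i then \<one>\<^bsub>D j\<^esub> else \<zero>\<^bsub>D j\<^esub>)" for i
    using zc by (intro surj) simp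
  then obtain e where e: "\<And>i. e i \<in> carrier R"
    "\<And>i j. j < n \<Longrightarrow> \<phi> j (e i) = (if j = i then \<one>\<^bsub>D j\<^esub> else \<zero>\<^bsub>D j\<^esub>)"
    by metis
  have comp: "\<phi> j (e i \<otimes> a) = (if j = i then \<phi> j a else \<zero>\<^bsub>D j\<^esub>)"
    if "j < n" "a \<in> carrier R" for i j a
  proof -
    interpret Dj: cring "D j" by (rule Dc[OF that(1)])
    show ?thesis
      using hmult[OF that(1) e(1) that(2), of i] e(2)[OF that(1), of i] Dj.l_one[OF hcl[OF that]]
        Dj.l_null[OF hcl[OF that]]
      by (cases "j = i") simp_all
  qed
  have mem: "a \<in> carrier (corner R (e i)) \<longleftrightarrow> a \<in> carrier R \<and> (\<forall>j<n. j \<noteq> i \<longrightarrow> \<phi> j a = \<zero>\<^bsub>D j\<^esub>)"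
    if i: "i < n" for i a
  proof
    assume "a \<in> carrier (corner R (e i))"
    then have a: "a \<in> carrier R" "e i \<otimes> a = a" by simp_all
    have "\<phi> j a = \<zero>\<^bsub>D j\<^esub>" if "j < n" "j \<noteq> i" for j
      using comp[OF that(1) a(1), of i] a(2) that(2) by simp
    then show "a \<in> carrier R \<and> (\<forall>j<n. j \<noteq> i \<longrightarrow> \<phi> j a = \<zero>\<^bsub>D j\<^esub>)"
      using a(1) by blast
  next
    assume a: "a \<in> carrier R \<and> (\<forall>j<n. j \<noteq> i \<longrightarrow> \<phi> j a = \<zero>\<^bsub>D j\<^esub>)"
    then have "e i \<otimes> a = a"
      using e(1) comp by (intro inj) auto
    then show "a \<in> carrier (corner R (e i))" using a by simp
  qed
  have orth: "e i \<otimes> e j = (if i = j then e i else \<zero>)" if "i < n" "j < n" for i j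
    by (rule inj) (use e comp hzero that in auto)
  have iso: "\<phi> i \<in> ring_iso (corner R (e i)) (D i)" if i: "i < n" for i
  proof (rule ring_iso_memI)
    show "\<phi> i \<one>\<^bsub>corner R (e i)\<^esub> = \<one>\<^bsub>D i\<^esub>" using e(2)[OF i, of i] by simp
    show "bij_betw (\<phi> i) (carrier (corner R (e i))) (carrier (D i))"
      unfolding bij_betw_def
    proof (intro conjI inj_onI Set.subset_antisym subsetI)
      fix a b assume ab: "a \<in> carrier (corner R (e i))" "b \<in> carrier (corner R (e i))" "\<phi> i a = \<phi> i b"
      have *: "a \<in> carrier R \<and> (\<forall>j<n. j \<noteq> i \<longrightarrow> \<phi> j a = \<zero>\<^bsub>D j\<^esub>)"
        "b \<in> carrier R \<and> (\<forall>j<n. j \<noteq> i \<longrightarrow> \<phi> j b = \<zero>\<^bsub>D j\<^esub>)"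
        using ab(1,2) unfolding mem[OF i] .
      have "\<phi> j a = \<phi> j b" if "j < n" for j
        using * ab(3) that by (cases "j = i") simp_all
      then show "a = b" using inj * by blast
    next
      fix d assume d: "d \<in> carrier (D i)"
      have "\<exists>a\<in>carrier R. \<forall>j<n. \<phi> j a = (if j = i then d else \<zero>\<^bsub>D j\<^esub>)"
        using zc d by (intro surj) simp
      then obtain a where a: "a \<in> carrier R" "\<And>j. j < n \<Longrightarrow> \<phi> j a = (if j = i then d else \<zero>\<^bsub>D j\<^esub>)"
        by blast
      then have "a \<in> carrier (corner R (e i))" unfolding mem[OF i] by simp
      moreover have "d = \<phi> i a" using a(2)[OF i] by simp
      ultimately show "d \<in> \<phi> i ` carrier (corner R (e i))" by blast
    next
      fix d assume "d \<in> \<phi> i ` carrier (corner R (e i))"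
      then show "d \<in> carrier (D i)" using hcl[OF i] by auto
    qed
  qed (use hcl[OF i] hmult[OF i] ring_hom_add[OF hom[OF i]] in auto)
  have cc: "cring (corner R (e i))" if "i < n" for i
    using corner_cring[OF e(1), of i] orth[OF that that] by simp
  have fc: "factorial_domain (corner R (e i))" if i: "i < n" for i
    by (rule ring_iso_factorial_domain[OF cc[OF i] Dc[OF i] iso[OF i] fac[OF i]])
  have uc: "Units (corner R (e i)) = {e i}" if i: "i < n" for i
  proof -
    interpret C: cring "corner R (e i)" by (rule cc[OF i])
    have "u = e i" if u: "u \<in> Units (corner R (e i))" for u
    proof -
      have c: "u \<in> carrier (corner R (e i))" "e i \<in> carrier (corner R (e i))"
        using C.Units_closed[OF u] C.one_closed by simp_all
      have "\<phi> i u = \<one>\<^bsub>D i\<^esub>"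
        using ring_iso_Units_iff[OF cc[OF i] Dc[OF i] iso[OF i] c(1)] u units[OF i] by simp
      then have "\<phi> i u = \<phi> i (e i)" using e(2)[OF i, of i] by simp
      then show ?thesis
        using ring_iso_memE(5)[OF iso[OF i]] c unfolding bij_betw_def inj_on_def by blast
    qed
    moreover have "e i \<in> Units (corner R (e i))" using C.Units_one_closed by simp
    ultimately show ?thesis by blast
  qed
  have sum: "(\<Oplus>i\<in>{..<n}. e i) = \<one>"
  proof (rule inj)
    show "(\<Oplus>i\<in>{..<n}. e i) \<in> carrier R" using e(1) by (intro finsum_closed) blast
    fix j assume j: "j < n"
    interpret Dj: cring "D j" by (rule Dc[OF j])
    have "\<phi> j (\<Oplus>i\<in>{..<n}. e i) = finsum (D j) (\<phi> j \<circ> e) {..<n}"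
      using e(1) by (intro ring_hom_ring.hom_finsum[OF H[OF j]]) blast
    also have "\<dots> = (\<Oplus>\<^bsub>D j\<^esub>i\<in>{..<n}. if j = i then \<one>\<^bsub>D j\<^esub> else \<zero>\<^bsub>D j\<^esub>)"
      using e(2)[OF j] by (intro Dj.finsum_cong') auto
    also have "\<dots> = \<one>\<^bsub>D j\<^esub>"
      using j by (intro Dj.finsum_singleton) auto
    finally show "\<phi> j (\<Oplus>i\<in>{..<n}. e i) = \<phi> j \<one>" using hone[OF j] by simp
  qed simp
  have "ufd_decomposition R n e"
  proof (intro ufd_decomposition.intro ufd_decomposition_axioms.intro domain_decomposition.intro
      idempotent_decomposition.intro idempotent_decomposition_axioms.intro
      domain_decomposition_axioms.intro cring_axioms)
    show "domain (corner R (e i))" if "i < n" for i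
      using fc[OF that] by (simp add: factorial_domain_def)
  qed (use e orth sum fc uc in blast)+
  then show ?thesis by blast
qed

lemma (in cring) ufd_decomposition_of_product:
  assumes "ufd_product_with_trivial_units R"
  shows "\<exists>n e. ufd_decomposition R n e"
proof -
  obtain Ds :: "'a ring list" and h where Ds: "\<And>D. D \<in> set Ds \<Longrightarrow> factorial_domain D"
    "\<And>D. D \<in> set Ds \<Longrightarrow> Units D = {\<one>\<^bsub>D\<^esub>}" and h: "h \<in> ring_iso R (RDirProd_list Ds)"
    using assms unfolding ufd_product_with_trivial_units_def is_ring_iso_def by blast
  have hb: "bij_betw h (carrier R) (carrier (RDirProd_list Ds))" by (rule ring_iso_memE(5)[OF h])
  have hh: "h \<in> ring_hom R (RDirProd_list Ds)" using h by (simp add: ring_iso_def)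
  have hc: "h a \<in> carrier (RDirProd_list Ds)" if "a \<in> carrier R" for a
    using ring_hom_closed[OF hh that] .
  have "\<exists>e. ufd_decomposition R (length Ds) e"
  proof (rule ufd_decomposition_of_projections[where D = "\<lambda>j. Ds ! j" and \<phi> = "\<lambda>j a. h a ! j"])
    fix j assume j: "j < length Ds"
    show "factorial_domain (Ds ! j)" "Units (Ds ! j) = {\<one>\<^bsub>Ds ! j\<^esub>}"
      using Ds j by simp_all
    show "(\<lambda>a. h a ! j) \<in> ring_hom R (Ds ! j)"
      using ring_hom_trans[OF hh RDirProd_list_nth_hom[OF j]] by (simp add: comp_def)
  next
    fix a b assume ab: "a \<in> carrier R" "b \<in> carrier R" "\<And>j. j < length Ds \<Longrightarrow> h a ! j = h b ! j"
    have "h a = h b"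
      using ab RDirProd_list_carrier_mem(1)[OF hc] by (intro nth_equalityI) auto
    then show "a = b" using hb ab(1,2) unfolding bij_betw_def inj_on_def by blast
  next
    fix d assume d: "\<And>j. j < length Ds \<Longrightarrow> d j \<in> carrier (Ds ! j)"
    have "map d [0..<length Ds] \<in> carrier (RDirProd_list Ds)"
      by (rule RDirProd_list_carrier_memI) (use d in auto)
    then obtain a where "a \<in> carrier R" "h a = map d [0..<length Ds]"
      using hb unfolding bij_betw_def by (metis imageE)
    then show "\<exists>a\<in>carrier R. \<forall>j<length Ds. h a ! j = d j" by (intro bexI[of _ a]) auto
  qed
  then show ?thesis by blast
qed

lemma (in cring) ufd_decomposition_of_factorial:
  assumes "factorial_domain R"
  shows "ufd_decomposition R 1 (\<lambda>_. \<one>)"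
proof (intro ufd_decomposition.intro ufd_decomposition_axioms.intro domain_decomposition.intro
    idempotent_decomposition.intro idempotent_decomposition_axioms.intro
    domain_decomposition_axioms.intro cring_axioms)
  show "(\<Oplus>i\<in>{..<1::nat}. \<one>) = \<one>"
    using finsum_insert[of "{}" "0::nat" "\<lambda>_. \<one>"] by (simp add: lessThan_Suc)
qed (use assms in \<open>auto simp: corner_one factorial_domain_def\<close>)

context ufd_decomposition
begin

text \<open>The corners, as rings without additional record fields, as needed for a list of rings.\<close>

definition factor_ring :: "nat \<Rightarrow> 'a ring" where
  "factor_ring i = \<lparr>carrier = {x \<in> carrier R. e i \<otimes> x = x}, monoid.mult = (\<otimes>), one = e i,
     ring.zero = \<zero>, ring.add = (\<oplus>)\<rparr>"

lemma factor_ring_iso: "id \<in> ring_iso (corner R (e i)) (factor_ring i)"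
  "id \<in> ring_iso (factor_ring i) (corner R (e i))"
  by (rule ring_iso_memI; simp add: factor_ring_def)+

lemma factor_ring_cring:
  assumes "i < n"
  shows "cring (factor_ring i)"
proof -
  interpret C: cring "corner R (e i)"
    by (rule corner_cring[OF idem_closed idem]) (rule assms)+
  have "(factor_ring i)\<lparr>ring.zero := id \<zero>\<^bsub>corner R (e i)\<^esub>\<rparr> = factor_ring i"
    by (simp add: factor_ring_def)
  then show ?thesis using C.ring_iso_imp_img_cring[OF factor_ring_iso(1)[of i]] by (simp only:)
qed

lemma iso_product: "R \<simeq> RDirProd_list (map factor_ring [0..<n])"
proof -
  let ?Ds = "map factor_ring [0..<n]"
  let ?h = "\<lambda>a. map (\<lambda>i. e i \<otimes> a) [0..<n]"
  interpret Q: ring "RDirProd_list ?Ds"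
    using factor_ring_cring by (intro RDirProd_list_is_ring) (simp add: cring_def)
  have fr: "carrier (factor_ring i) = {x \<in> carrier R. e i \<otimes> x = x}"
    "x \<otimes>\<^bsub>factor_ring i\<^esub> y = x \<otimes> y" "x \<oplus>\<^bsub>factor_ring i\<^esub> y = x \<oplus> y" "\<one>\<^bsub>factor_ring i\<^esub> = e i" for i x y
    by (simp_all add: factor_ring_def)
  have cl: "?h a \<in> carrier (RDirProd_list ?Ds)" if "a \<in> carrier R" for a
    using that idem_closed idem_l by (intro RDirProd_list_carrier_memI) (simp_all add: fr)
  have len: "length as = n" if "as \<in> carrier (RDirProd_list ?Ds)" for as
    using RDirProd_list_carrier_mem(1)[OF that] by simp
  have nth: "(as \<otimes>\<^bsub>RDirProd_list ?Ds\<^esub> bs) ! i = as ! i \<otimes> bs ! i"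
    "(as \<oplus>\<^bsub>RDirProd_list ?Ds\<^esub> bs) ! i = as ! i \<oplus> bs ! i"
    if "as \<in> carrier (RDirProd_list ?Ds)" "bs \<in> carrier (RDirProd_list ?Ds)" "i < n" for as bs i
    using RDirProd_list_nth[OF that(1,2), of i] that(3) by (simp_all add: fr)
  have "?h \<in> ring_iso R (RDirProd_list ?Ds)"
  proof (rule ring_iso_memI)
    fix a b assume ab: "a \<in> carrier R" "b \<in> carrier R"
    show "?h (a \<otimes> b) = ?h a \<otimes>\<^bsub>RDirProd_list ?Ds\<^esub> ?h b"
    proof (rule nth_equalityI)
      show "length (?h (a \<otimes> b)) = length (?h a \<otimes>\<^bsub>RDirProd_list ?Ds\<^esub> ?h b)"
        using len[OF Q.m_closed[OF cl[OF ab(1)] cl[OF ab(2)]]] by simp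
      fix i assume "i < length (?h (a \<otimes> b))"
      then have i: "i < n" by simp
      have "(e i \<otimes> a) \<otimes> (e i \<otimes> b) = e i \<otimes> (e i \<otimes> (a \<otimes> b))"
        using ab idem_closed[OF i] by (simp add: m_ac)
      then show "?h (a \<otimes> b) ! i = (?h a \<otimes>\<^bsub>RDirProd_list ?Ds\<^esub> ?h b) ! i"
        using nth(1)[OF cl[OF ab(1)] cl[OF ab(2)] i] idem_l[OF i m_closed[OF ab]] i by simp
    qed
    show "?h (a \<oplus> b) = ?h a \<oplus>\<^bsub>RDirProd_list ?Ds\<^esub> ?h b"
    proof (rule nth_equalityI)
      show "length (?h (a \<oplus> b)) = length (?h a \<oplus>\<^bsub>RDirProd_list ?Ds\<^esub> ?h b)"
        using len[OF Q.a_closed[OF cl[OF ab(1)] cl[OF ab(2)]]] by simp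
      fix i assume "i < length (?h (a \<oplus> b))"
      then have i: "i < n" by simp
      show "?h (a \<oplus> b) ! i = (?h a \<oplus>\<^bsub>RDirProd_list ?Ds\<^esub> ?h b) ! i"
        using nth(2)[OF cl[OF ab(1)] cl[OF ab(2)] i] i r_distr[OF ab idem_closed[OF i]] by simp
    qed
  next
    show "?h \<one> = \<one>\<^bsub>RDirProd_list ?Ds\<^esub>"
    proof (rule nth_equalityI)
      show "length (?h \<one>) = length \<one>\<^bsub>RDirProd_list ?Ds\<^esub>" using len[OF Q.one_closed] by simp
      fix i assume "i < length (?h \<one>)"
      then have i: "i < n" by simp
      then show "?h \<one> ! i = \<one>\<^bsub>RDirProd_list ?Ds\<^esub> ! i"
        using RDirProd_list_one_nth[of i ?Ds] idem_closed[OF i] by (simp add: fr)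
    qed
    show "bij_betw ?h (carrier R) (carrier (RDirProd_list ?Ds))"
      unfolding bij_betw_def
    proof (intro conjI inj_onI Set.subset_antisym subsetI)
      fix a b assume ab: "a \<in> carrier R" "b \<in> carrier R" "?h a = ?h b"
      show "a = b"
        by (rule components_eqI[OF ab(1,2)]) (use ab(3) in simp)
    next
      fix as assume "as \<in> ?h ` carrier R"
      then show "as \<in> carrier (RDirProd_list ?Ds)" using cl by blast
    next
      fix as assume as: "as \<in> carrier (RDirProd_list ?Ds)"
      have asi: "as ! i \<in> carrier R" "e i \<otimes> as ! i = as ! i" if "i < n" for i
        using RDirProd_list_carrier_mem(2)[OF as, of i] that by (simp_all add: fr)
      obtain a where a: "a \<in> carrier R" "\<And>i. i < n \<Longrightarrow> e i \<otimes> a = e i \<otimes> as ! i"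
        by (rule glue[of "\<lambda>i. as ! i"]) (use asi(1) in blast)+
      have "as = ?h a"
        by (rule nth_equalityI) (use len[OF as] a(2) asi(2) in simp_all)
      then show "as \<in> ?h ` carrier R" using a(1) by blast
    qed
  qed (rule cl)
  then show ?thesis by (auto simp: is_ring_iso_def)
qed

lemma factorial_or_product:
  assumes one: "\<one> \<noteq> \<zero>"
  shows "factorial_domain R \<or> ufd_product_with_trivial_units R"
proof (cases "n = 1")
  case True
  then have "e 0 = \<one>"
    using idem_sum idem_closed finsum_insert[of "{}" "0::nat" e] by (simp add: lessThan_Suc)
  then show ?thesis using corner_factorial[of 0] True corner_one by simp
next
  case False
  have "n \<noteq> 0"
  proof
    assume "n = 0"
    then have "(\<Oplus>i\<in>{}. e i) = \<one>" using idem_sum by simp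
    then show False using one by simp
  qed
  then have n: "n \<ge> 2" using False by simp
  have "factorial_domain (factor_ring i) \<and> Units (factor_ring i) = {\<one>\<^bsub>factor_ring i\<^esub>}" if i: "i < n" for i
  proof
    have cr: "cring (corner R (e i))"
      by (rule corner_cring[OF idem_closed idem]) (rule i)+
    show "factorial_domain (factor_ring i)"
      by (rule ring_iso_factorial_domain[OF factor_ring_cring[OF i] cr factor_ring_iso(2) corner_factorial[OF i]])
    \<comment> \<open>Any index other than \<open>i\<close> serves to conclude that the units at \<open>i\<close> are trivial.\<close>
    define k where "k = (if i = 0 then 1 else 0 :: nat)"
    have "k < n" "i \<noteq> k" using n by (auto simp: k_def)
    then have "Units (corner R (e i)) = {e i}" using corner_units[OF i] by blast
    moreover have "Units (factor_ring i) = Units (corner R (e i))"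
      by (simp add: Units_def factor_ring_def corner_def)
    ultimately show "Units (factor_ring i) = {\<one>\<^bsub>factor_ring i\<^esub>}" by (simp add: factor_ring_def)
  qed
  then have "ufd_product_with_trivial_units R"
    unfolding ufd_product_with_trivial_units_def
    using iso_product n by (intro exI[of _ "map factor_ring [0..<n]"]) auto
  then show ?thesis ..
qed

end

lemma (in cring) ufd_decomposition_iff:
  assumes "\<one> \<noteq> \<zero>"
  shows "(\<exists>n e. ufd_decomposition R n e) \<longleftrightarrow> factorial_domain R \<or> ufd_product_with_trivial_units R"
  using ufd_decomposition.factorial_or_product[OF _ assms] ufd_decomposition_of_factorial
    ufd_decomposition_of_product by blast

section \<open>Polynomial rings with unique factorization\<close>

lemma (in UP_cring) ufd_decomposition_of_UP_ufr:
  assumes ufr: "weak_strongly_reduced_ufr P" and "\<one> \<noteq> \<zero>"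
  shows "\<exists>n e. ufd_decomposition R n e"
proof -
  obtain n e where dec: "domain_decomposition R n e"
    using domain_decomposition_of_UP_ufr[OF assms] by blast
  interpret Q: domain_decomposition P n "\<lambda>i. const (e i)"
    by (rule domain_decomposition_UP[OF dec])
  have "ufd_decomposition P n (\<lambda>i. const (e i))"
    using Q.corner_factorial_of_ufr[OF ufr] Q.corner_units_of_ufr[OF ufr]
    by (intro ufd_decomposition.intro ufd_decomposition_axioms.intro Q.domain_decomposition_axioms)
  then show ?thesis using ufd_decomposition_UP_iff[OF dec] by blast
qed

lemma (in UP_cring) UP_reduced_ufr:
  assumes "ufd_decomposition R n e"
  shows "reduced_ufr P"
proof -
  have "domain_decomposition R n e" using assms by (simp add: ufd_decomposition_def)
  then have "ufd_decomposition P n (\<lambda>i. const (e i))"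
    using ufd_decomposition_UP_iff assms by blast
  then show ?thesis by (rule ufd_decomposition.reduced_ufr)
qed

lemma strongly_reduced_imp_reduced:
  "strongly_reduced_factorization A a u n f \<Longrightarrow> reduced_factorization A a u n f"
  unfolding strongly_reduced_factorization_def reduced_factorization_def by blast

lemma reduced_ufr_imp:
  assumes "reduced_ufr A"
  shows "strongly_reduced_ufr A" "weak_strongly_reduced_ufr A" "weak_reduced_ufr A"
proof -
  show "strongly_reduced_ufr A"
    using assms strongly_reduced_imp_reduced[of A] unfolding reduced_ufr_def strongly_reduced_ufr_def by blast
  then show "weak_strongly_reduced_ufr A"
    unfolding strongly_reduced_ufr_def weak_strongly_reduced_ufr_def by blast
  show "weak_reduced_ufr A"
    using assms unfolding reduced_ufr_def weak_reduced_ufr_def by blast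
qed

lemma weak_strongly_reduced_ufrI:
  "strongly_reduced_ufr A \<Longrightarrow> weak_strongly_reduced_ufr A"
  "weak_reduced_ufr A \<Longrightarrow> weak_strongly_reduced_ufr A"
proof -
  show "strongly_reduced_ufr A \<Longrightarrow> weak_strongly_reduced_ufr A"
    unfolding strongly_reduced_ufr_def weak_strongly_reduced_ufr_def by blast
  show "weak_reduced_ufr A \<Longrightarrow> weak_strongly_reduced_ufr A"
    using strongly_reduced_imp_reduced[of A] unfolding weak_reduced_ufr_def weak_strongly_reduced_ufr_def by blast
qed

theorem theorem5p7:
  fixes R :: "('a, 'm) ring_scheme"
  assumes "cring R" and "\<one>\<^bsub>R\<^esub> \<noteq> \<zero>\<^bsub>R\<^esub>"
  shows
    "(strongly_reduced_ufr (UP R) \<longleftrightarrow> factorial_domain R \<or> ufd_product_with_trivial_units R) \<and>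
     (weak_strongly_reduced_ufr (UP R) \<longleftrightarrow> factorial_domain R \<or> ufd_product_with_trivial_units R) \<and>
     (reduced_ufr (UP R) \<longleftrightarrow> factorial_domain R \<or> ufd_product_with_trivial_units R) \<and>
     (weak_reduced_ufr (UP R) \<longleftrightarrow> factorial_domain R \<or> ufd_product_with_trivial_units R)"
proof -
  have UP: "UP_cring R" using assms(1) by (simp add: UP_cring_def)
  have "\<exists>n e. ufd_decomposition R n e" if "weak_strongly_reduced_ufr (UP R)"
    using UP_cring.ufd_decomposition_of_UP_ufr[OF UP that assms(2)] .
  moreover have "reduced_ufr (UP R)" if "\<exists>n e. ufd_decomposition R n e"
    using UP_cring.UP_reduced_ufr[OF UP] that by blast
  moreover note cring.ufd_decomposition_iff[OF assms]
  ultimately show ?thesis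
    using reduced_ufr_imp[of "UP R"] weak_strongly_reduced_ufrI[of "UP R"] by blast
qed

end
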